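(* Let the quiver be of type $A_\infty$, or of type $A^{(1)}_{e-1}$ with $e$ sufficiently large (depending on $\lambda$). Let $i\in I$, let $\lambda=(k,r)$ with $k\ge r\ge1$ be a two-row partition with residues computed with respect to the fundamental weight $\Lambda_i$, and let $\alpha=\alpha_\lambda$. Let $v$ be the standard cyclic generator of the permutation module $M^\lambda$ over $R_\alpha$, $\mathbf i=\mathbf i^\lambda$, and $\psi^{B_1}=\psi^{G^{B_1}}$ where $B_1=(1,1)\in[\lambda]$. Then $M^\lambda$ admits a Specht filtration $$M^\lambda=M_0\supsetneq M_1\supsetneq 0,\qquad M_1=R_\alpha\cdot\psi^{B_1}e(\mathbf i)v,$$ with isomorphisms of $R_\alpha$-modules $$M_0/M_1\cong S^\lambda,\qquad M_1\cong S^{\lambda_1},$$ where $\lambda_1=(k+1\,|\,r-1)$ is a $2$-partition and $S^{\lambda_1}$ is the Specht module (over $R^{\Lambda}_\alpha$, with $\Lambda$ determined by the charge) formed with respect to the charge $\kappa=(i-1,i)$.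
   Context: Quiver and KLR algebra. The quiver is of type $A^{(1)}_{e-1}$ with $e>2$ (vertex set $I=\mathbb Z/e\mathbb Z$) or of type $A_\infty$ (vertex set $I=\mathbb Z$), with arrows $i\to i+1$ for all $i\in I$. "$e$ sufficiently large" means: there is $e_0$ depending on $\lambda$ such that the assertion holds for all $e\ge e_0$. $\Bbbk$ is a field. $Q^+=\bigoplus_{i\in I}\mathbb Z_{\ge0}\alpha_i$. For $\alpha\in Q^+$ of height $n$ (sum of coefficients), $I^\alpha=\{\mathbf i=(i_1,\dots,i_n)\in I^n:\alpha_{i_1}+\cdots+\alpha_{i_n}=\alpha\}$, and $\sigma_r=(r,r+1)\in\mathfrak S_n$ acts on it by place permutation. $R_\alpha$ is the unital $\Bbbk$-algebra generated by $e(\mathbf i)$ ($\mathbf i\in I^\alpha$), $y_1,\dots,y_n$, $\psi_1,\dots,\psi_{n-1}$ subject to: $e(\mathbf i)e(\mathbf j)=\delta_{\mathbf i,\mathbf j}e(\mathbf i)$; $\sum_{\mathbf i}e(\mathbf i)=1$; $y_re(\mathbf i)=e(\mathbf i)y_r$; $\psi_re(\mathbf i)=e(\sigma_r\mathbf i)\psi_r$; $y_ry_s=y_sy_r$; $\psi_ry_s=y_s\psi_r$ if $s\ne r,r+1$; $\psi_r\psi_s=\psi_s\psi_r$ if $|r-s|>1$; $\psi_ry_{r+1}e(\mathbf i)=(y_r\psi_r+\delta_{i_r,i_{r+1}})e(\mathbf i)$; $y_{r+1}\psi_re(\mathbf i)=(\psi_ry_r+\delta_{i_r,i_{r+1}})e(\mathbf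 i)$; $\psi_r^2e(\mathbf i)=qe(\mathbf i)$ with $q=0$ if $i_r=i_{r+1}$, $q=y_{r+1}-y_r$ if $i_r\to i_{r+1}$, $q=y_r-y_{r+1}$ if $i_r\leftarrow i_{r+1}$, $q=1$ otherwise; $\psi_r\psi_{r+1}\psi_re(\mathbf i)=(\psi_{r+1}\psi_r\psi_{r+1}+c)e(\mathbf i)$ with $c=1$ if $i_r=i_{r+2}\to i_{r+1}$, $c=-1$ if $i_r=i_{r+2}\leftarrow i_{r+1}$, $c=0$ otherwise. For a dominant weight $\Lambda=\sum a_i\Lambda_i$, the cyclotomic quotient $R^\Lambda_\alpha$ is obtained by adding the relations $y_1^{a_{i_1}}e(\mathbf i)=0$ for all $\mathbf i\in I^\alpha$; its modules are regarded as $R_\alpha$-modules. Tableaux. An $\ell$-partition $\mu=(\mu^{(1)}|\cdots|\mu^{(\ell)})$ of $n$ is an $\ell$-tuple of partitions (components may be empty) of total size $n$; its Young diagram $[\mu]$ consists of nodes $(m,a,b)$ with $1\le b\le\mu^{(m)}_a$ (for $\ell=1$ write $(a,b)$). Given a charge $\kappa=(\kappa_1,\dots,\kappa_\ell)$, the node $(m,a,b)$ has residue $\kappa_m+b-a\in I$ (mod $e$ in type $A^{(1)}_{e-1}$); the weight determined by $\kappa$ is $\sum_m\Lambda_{\kappa_m}$, and $\alpha_\mu$ is the sum of $\alpha_{\mathrm{res}(A)}$ over the nodes $A$. A partition with fundamental weight $\Lambda_x$ is the case $\kappa=(x)$. A $\mu$-tableau is a bijection $[\mu]\to\{1,\dots,n\}$;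 it is row-standard if entries increase along rows. $T^\mu$ is the tableau with $1,\dots,n$ entered in order along successive rows, first component first; $\mathbf i^\mu$ is its residue sequence ($r$-th entry = residue of the node containing $r$). $\mathfrak S_n$ acts on tableaux from the left on entries, and $w^T$ is defined by $w^TT^\mu=T$. For each $w\in\mathfrak S_n$ fix a reduced expression $w=\sigma_{i_1}\cdots\sigma_{i_m}$ and put $\psi_w=\psi_{i_1}\cdots\psi_{i_m}$, $\psi^T=\psi_{w^T}$. A Garnir node is $A=(m,a,b)\in[\mu]$ with $(m,a+1,b)\in[\mu]$; its Garnir belt is $\{(m,a,c)\in[\mu]:c\ge b\}\cup\{(m,a+1,c):1\le c\le b\}$; the Garnir tableau $G^A$ is the row-standard tableau agreeing with $T^\mu$ outside the belt and whose entries in the belt increase from bottom left to top right (first along the lower row, then along the upper row). Modules. With $\alpha=\alpha_\mu$, the permutation module $M^\mu$ is the cyclic $R_\alpha$-module with standard cyclic generator $z^\mu$ and relations: (1) $e(\mathbf j)z^\mu=\delta_{\mathbf j,\mathbf i^\mu}z^\mu$; (2) $y_rz^\mu=0$ for all $r$; (3) $\psi_rz^\mu=0$ whenever $r,r+1$ lie in the same row of $T^\mu$. The (universal) Specht module $S^\mu$ is the quotient of $M^\mu$ by the additional relations (4) $\psi^{G^A}z^\mu=0$ for all Garnir nodes $A\in[\mu]$ (the correct definition in type $A_\infty$ or for $e$ large). Gradings are disregarded. *)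

theory Defs
  imports
    "HOL-Library.Poly_Mapping"
    "HOL-Library.Multiset"
    "HOL-Library.FuncSet"
    "HOL-Combinatorics.Permutations"
    "HOL-Algebra.QuotRing"
    "HOL-Algebra.Module"
begin

section \<open>Left modules over a ring that need not be commutative\<close>

text \<open>
  The locale \<^locale>\<open>module\<close> of the library asks for a commutative ring of scalars.  Its record type
  and its locale \<^locale>\<open>submodule\<close> are reused; the multiplicative fields of a module record carry
  no information.
\<close>

locale left_module = R?: ring R + M?: abelian_group M for R (structure) and M (structure) +
  assumes smult_closed [simp, intro]:
      "\<lbrakk>a \<in> carrier R; x \<in> carrier M\<rbrakk> \<Longrightarrow> a \<odot>\<^bsub>M\<^esub> x \<in> carrier M"
    and smult_l_distr:
      "\<lbrakk>a \<in> carrier R; b \<in> carrier R; x \<in> carrier M\<rbrakk> \<Longrightarrow>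
        (a \<oplus>\<^bsub>R\<^esub> b) \<odot>\<^bsub>M\<^esub> x = a \<odot>\<^bsub>M\<^esub> x \<oplus>\<^bsub>M\<^esub> b \<odot>\<^bsub>M\<^esub> x"
    and smult_r_distr:
      "\<lbrakk>a \<in> carrier R; x \<in> carrier M; y \<in> carrier M\<rbrakk> \<Longrightarrow>
        a \<odot>\<^bsub>M\<^esub> (x \<oplus>\<^bsub>M\<^esub> y) = a \<odot>\<^bsub>M\<^esub> x \<oplus>\<^bsub>M\<^esub> a \<odot>\<^bsub>M\<^esub> y"
    and smult_assoc:
      "\<lbrakk>a \<in> carrier R; b \<in> carrier R; x \<in> carrier M\<rbrakk> \<Longrightarrow>
        (a \<otimes>\<^bsub>R\<^esub> b) \<odot>\<^bsub>M\<^esub> x = a \<odot>\<^bsub>M\<^esub> (b \<odot>\<^bsub>M\<^esub> x)"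
    and smult_one [simp]:
      "x \<in> carrier M \<Longrightarrow> \<one>\<^bsub>R\<^esub> \<odot>\<^bsub>M\<^esub> x = x"

definition regular_module :: "('a, 'c) ring_scheme \<Rightarrow> ('a, 'a) module" where
  "regular_module R =
     \<lparr>carrier = carrier R, monoid.mult = monoid.mult R, one = one R, zero = zero R, add = add R,
      smult = monoid.mult R\<rparr>"

definition gen_submodule ::
    "('a, 'c) ring_scheme \<Rightarrow> ('a, 'b, 'd) module_scheme \<Rightarrow> 'b set \<Rightarrow> 'b set" where
  "gen_submodule R M S = \<Inter>{N. submodule N R M \<and> S \<subseteq> N}"

definition cyclic_submodule ::
    "('a, 'c) ring_scheme \<Rightarrow> ('a, 'b, 'd) module_scheme \<Rightarrow> 'b \<Rightarrow> 'b set" where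
  "cyclic_submodule R M x = {a \<odot>\<^bsub>M\<^esub> x |a. a \<in> carrier R}"

definition quot_module ::
    "('a, 'b, 'd) module_scheme \<Rightarrow> 'b set \<Rightarrow> ('a, 'b set) module" where
  "quot_module M N =
     \<lparr>carrier = a_rcosets\<^bsub>M\<^esub> N, monoid.mult = (\<lambda>X Y. N), one = N, zero = N, add = set_add M,
      smult = (\<lambda>a X. \<Union>x\<in>X. N +>\<^bsub>M\<^esub> (a \<odot>\<^bsub>M\<^esub> x))\<rparr>"

definition left_module_hom ::
    "('a, 'c) ring_scheme \<Rightarrow> ('a, 'b, 'd) module_scheme \<Rightarrow> ('a, 'f, 'g) module_scheme \<Rightarrow>
     ('b \<Rightarrow> 'f) set" where
  "left_module_hom R M N =
     {h \<in> carrier M \<rightarrow> carrier N.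
        (\<forall>x\<in>carrier M. \<forall>y\<in>carrier M. h (x \<oplus>\<^bsub>M\<^esub> y) = h x \<oplus>\<^bsub>N\<^esub> h y) \<and>
        (\<forall>a\<in>carrier R. \<forall>x\<in>carrier M. h (a \<odot>\<^bsub>M\<^esub> x) = a \<odot>\<^bsub>N\<^esub> h x)}"

definition left_module_iso ::
    "('a, 'c) ring_scheme \<Rightarrow> ('a, 'b, 'd) module_scheme \<Rightarrow> ('a, 'f, 'g) module_scheme \<Rightarrow> bool" where
  "left_module_iso R M N \<longleftrightarrow>
     left_module R M \<and> left_module R N \<and>
     (\<exists>h \<in> left_module_hom R M N. bij_betw h (carrier M) (carrier N))"

definition annihilator ::
    "('a, 'c) ring_scheme \<Rightarrow> ('a, 'b, 'd) module_scheme \<Rightarrow> 'a set" where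
  "annihilator R M = {a \<in> carrier R. \<forall>x\<in>carrier M. a \<odot>\<^bsub>M\<^esub> x = \<zero>\<^bsub>M\<^esub>}"


section \<open>Free associative algebras\<close>

datatype 'g word = Word (letters: "'g list")

text \<open>
  Concatenation is written additively so that \<^typ>\<open>'g word \<Rightarrow>\<^sub>0 'k::ring_1\<close> is the ring of
  noncommutative polynomials with convolution as its product.
\<close>

instantiation word :: (type) monoid_add
begin
definition "0 = Word []"
definition "u + v = Word (letters u @ letters v)"
instance
  by standard (simp_all add: zero_word_def plus_word_def)
end

definition free_algebra :: "'g set \<Rightarrow> ('g word \<Rightarrow>\<^sub>0 'k::field) ring" where
  "free_algebra G =
     \<lparr>carrier = {p. \<forall>w\<in>Poly_Mapping.keys p. set (letters w) \<subseteq> G},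
      monoid.mult = (*), one = 1, zero = 0, add = (+)\<rparr>"


section \<open>The quiver and the KLR algebra\<close>

text \<open>
  The parameter \<open>e\<close> is \<open>0\<close> for type \<open>A\<^sub>\<infinity>\<close>, and \<open>e > 2\<close> for type \<open>A\<^bsub>e-1\<^esub>\<^bsup>(1)\<^esup>\<close>, whose
  vertices are the residues \<open>0, \<dots>, e - 1\<close>.  Since \<open>x mod 0 = x\<close>, reduction modulo \<open>e\<close> serves both.
\<close>

definition vertices :: "nat \<Rightarrow> int set" where
  "vertices e = (if e = 0 then UNIV else {0..<int e})"

definition arrow :: "nat \<Rightarrow> int \<Rightarrow> int \<Rightarrow> bool" where
  "arrow e i j \<longleftrightarrow> i \<in> vertices e \<and> j = (i + 1) mod int e"

text \<open>
  Elements of \<open>Q\<^sup>+\<close> are multisets of vertices, and so are dominant weights (\<open>\<Lambda>\<close> contains the vertex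
  \<open>i\<close> with multiplicity \<open>a\<^sub>i\<close>).  The height is the size of the multiset.  Positions in residue
  sequences are counted from \<open>1\<close>.
\<close>

definition res_seqs :: "int multiset \<Rightarrow> int list set" where
  "res_seqs \<alpha> = {is. mset is = \<alpha>}"

definition entry :: "int list \<Rightarrow> nat \<Rightarrow> int" where
  "entry is r = is ! (r - 1)"

definition swap_entries :: "nat \<Rightarrow> int list \<Rightarrow> int list" where
  "swap_entries r is = is[r - 1 := entry is (r + 1), r := entry is r]"

datatype klr_gen = GenE "int list" | GenY nat | GenPsi nat

definition klr_gens :: "int multiset \<Rightarrow> klr_gen set" where
  "klr_gens \<alpha> = GenE ` res_seqs \<alpha> \<union> GenY ` {1..size \<alpha>} \<union> GenPsi ` {1..<size \<alpha>}"

type_synonym 'k free_klr = "klr_gen word \<Rightarrow>\<^sub>0 'k"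

definition fgen :: "klr_gen \<Rightarrow> 'k::field free_klr" where
  "fgen g = Poly_Mapping.single (Word [g]) 1"

abbreviation fE :: "int list \<Rightarrow> 'k::field free_klr" where "fE is \<equiv> fgen (GenE is)"
abbreviation fY :: "nat \<Rightarrow> 'k::field free_klr" where "fY r \<equiv> fgen (GenY r)"
abbreviation fPsi :: "nat \<Rightarrow> 'k::field free_klr" where "fPsi r \<equiv> fgen (GenPsi r)"

definition quad_term :: "nat \<Rightarrow> int list \<Rightarrow> nat \<Rightarrow> 'k::field free_klr" where
  "quad_term e is r =
     (if entry is r = entry is (r + 1) then 0
      else if arrow e (entry is r) (entry is (r + 1)) then fY (r + 1) - fY r
      else if arrow e (entry is (r + 1)) (entry is r) then fY r - fY (r + 1)
      else 1)"

definition braid_term :: "nat \<Rightarrow> int list \<Rightarrow> nat \<Rightarrow> 'k::field free_klr" where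
  "braid_term e is r =
     (if entry is r = entry is (r + 2) \<and> arrow e (entry is r) (entry is (r + 1)) then 1
      else if entry is r = entry is (r + 2) \<and> arrow e (entry is (r + 1)) (entry is r) then - 1
      else 0)"

definition dlt :: "int list \<Rightarrow> nat \<Rightarrow> 'k::field free_klr" where
  "dlt is r = (if entry is r = entry is (r + 1) then 1 else 0)"

text \<open>A relation \<open>a = b\<close> is represented by the element \<open>a - b\<close>.\<close>

definition klr_relations :: "nat \<Rightarrow> int multiset \<Rightarrow> 'k::field free_klr set" where
  "klr_relations e \<alpha> =
     {fE is * fE js - (if is = js then fE is else 0) |is js. is \<in> res_seqs \<alpha> \<and> js \<in> res_seqs \<alpha>}
   \<union> {(\<Sum>is\<in>res_seqs \<alpha>. fE is) - 1}
   \<union> {fY r * fE is - fE is * fY r |r is. r \<in> {1..size \<alpha>} \<and> is \<in> res_seqs \<alpha>}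
   \<union> {fPsi r * fE is - fE (swap_entries r is) * fPsi r |r is.
        r \<in> {1..<size \<alpha>} \<and> is \<in> res_seqs \<alpha>}
   \<union> {fY r * fY s - fY s * fY r |r s. r \<in> {1..size \<alpha>} \<and> s \<in> {1..size \<alpha>}}
   \<union> {fPsi r * fY s - fY s * fPsi r |r s.
        r \<in> {1..<size \<alpha>} \<and> s \<in> {1..size \<alpha>} \<and> s \<noteq> r \<and> s \<noteq> r + 1}
   \<union> {fPsi r * fPsi s - fPsi s * fPsi r |r s.
        r \<in> {1..<size \<alpha>} \<and> s \<in> {1..<size \<alpha>} \<and> (r + 1 < s \<or> s + 1 < r)}
   \<union> {fPsi r * fY (r + 1) * fE is - (fY r * fPsi r + dlt is r) * fE is |r is.
        r \<in> {1..<size \<alpha>} \<and> is \<in> res_seqs \<alpha>}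
   \<union> {fY (r + 1) * fPsi r * fE is - (fPsi r * fY r + dlt is r) * fE is |r is.
        r \<in> {1..<size \<alpha>} \<and> is \<in> res_seqs \<alpha>}
   \<union> {fPsi r * fPsi r * fE is - quad_term e is r * fE is |r is.
        r \<in> {1..<size \<alpha>} \<and> is \<in> res_seqs \<alpha>}
   \<union> {fPsi r * fPsi (r + 1) * fPsi r * fE is
        - (fPsi (r + 1) * fPsi r * fPsi (r + 1) + braid_term e is r) * fE is |r is.
        1 \<le> r \<and> r + 1 < size \<alpha> \<and> is \<in> res_seqs \<alpha>}"

definition klr_ideal :: "nat \<Rightarrow> int multiset \<Rightarrow> 'k::field free_klr set" where
  "klr_ideal e \<alpha> = Idl\<^bsub>free_algebra (klr_gens \<alpha>)\<^esub> (klr_relations e \<alpha>)"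

type_synonym 'k klr_elt = "'k free_klr set"

definition klr :: "nat \<Rightarrow> int multiset \<Rightarrow> 'k::field klr_elt ring" where
  "klr e \<alpha> = free_algebra (klr_gens \<alpha>) Quot klr_ideal e \<alpha>"

definition klr_class :: "nat \<Rightarrow> int multiset \<Rightarrow> 'k::field free_klr \<Rightarrow> 'k klr_elt" where
  "klr_class e \<alpha> p = klr_ideal e \<alpha> +>\<^bsub>free_algebra (klr_gens \<alpha>)\<^esub> p"

definition klr_e :: "nat \<Rightarrow> int multiset \<Rightarrow> int list \<Rightarrow> 'k::field klr_elt" where
  "klr_e e \<alpha> is = klr_class e \<alpha> (fE is)"

definition klr_y :: "nat \<Rightarrow> int multiset \<Rightarrow> nat \<Rightarrow> 'k::field klr_elt" where
  "klr_y e \<alpha> r = klr_class e \<alpha> (fY r)"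

definition klr_psi :: "nat \<Rightarrow> int multiset \<Rightarrow> nat \<Rightarrow> 'k::field klr_elt" where
  "klr_psi e \<alpha> r = klr_class e \<alpha> (fPsi r)"

text \<open>
  The kernel of \<open>R\<^sub>\<alpha> \<rightarrow> R\<^sub>\<alpha>\<^sup>\<Lambda>\<close>.  Modules over the cyclotomic quotient, regarded as
  \<open>R\<^sub>\<alpha>\<close>-modules, are the \<open>R\<^sub>\<alpha>\<close>-modules annihilated by it.
\<close>

definition cyclotomic_ideal :: "nat \<Rightarrow> int multiset \<Rightarrow> int multiset \<Rightarrow> 'k::field klr_elt set" where
  "cyclotomic_ideal e \<Lambda> \<alpha> =
     Idl\<^bsub>klr e \<alpha>\<^esub> {klr_y e \<alpha> 1 [^]\<^bsub>klr e \<alpha>\<^esub> count \<Lambda> (entry is 1) \<otimes>\<^bsub>klr e \<alpha>\<^esub> klr_e e \<alpha> is |is.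
                  is \<in> res_seqs \<alpha>}"


section \<open>Reduced expressions\<close>

text \<open>The list \<open>[i\<^sub>1, \<dots>, i\<^sub>m]\<close> stands for the product \<open>\<sigma>\<^bsub>i\<^sub>1\<^esub> \<circ> \<cdots> \<circ> \<sigma>\<^bsub>i\<^sub>m\<^esub>\<close>.\<close>

definition expr_prod :: "nat list \<Rightarrow> nat \<Rightarrow> nat" where
  "expr_prod rs = foldr (\<lambda>r f. Transposition.transpose r (r + 1) \<circ> f) rs id"

definition expresses :: "nat \<Rightarrow> (nat \<Rightarrow> nat) \<Rightarrow> nat list \<Rightarrow> bool" where
  "expresses n w rs \<longleftrightarrow> set rs \<subseteq> {1..<n} \<and> expr_prod rs = w"

definition reduced_expression :: "nat \<Rightarrow> (nat \<Rightarrow> nat) \<Rightarrow> nat list \<Rightarrow> bool" where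
  "reduced_expression n w rs \<longleftrightarrow>
     expresses n w rs \<and> (\<forall>rs'. expresses n w rs' \<longrightarrow> length rs \<le> length rs')"

definition reduced_choice :: "nat \<Rightarrow> ((nat \<Rightarrow> nat) \<Rightarrow> nat list) \<Rightarrow> bool" where
  "reduced_choice n red \<longleftrightarrow> (\<forall>w. w permutes {1..n} \<longrightarrow> reduced_expression n w (red w))"

definition klr_psi_perm ::
    "nat \<Rightarrow> int multiset \<Rightarrow> ((nat \<Rightarrow> nat) \<Rightarrow> nat list) \<Rightarrow> (nat \<Rightarrow> nat) \<Rightarrow> 'k::field klr_elt" where
  "klr_psi_perm e \<alpha> red w =
     foldr (\<lambda>r x. klr_psi e \<alpha> r \<otimes>\<^bsub>klr e \<alpha>\<^esub> x) (red w) \<one>\<^bsub>klr e \<alpha>\<^esub>"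


section \<open>Multipartitions and tableaux\<close>

text \<open>
  A multipartition is the list of its components, a component the list of its row lengths.  Rows of
  length \<open>0\<close> contribute no node, so that trailing zeros are harmless.
\<close>

type_synonym node = "nat \<times> nat \<times> nat"

definition diagram :: "nat list list \<Rightarrow> node set" where
  "diagram \<mu> =
     {(m, a, b). 1 \<le> m \<and> m \<le> length \<mu> \<and> 1 \<le> a \<and> a \<le> length (\<mu> ! (m - 1)) \<and>
                 1 \<le> b \<and> b \<le> \<mu> ! (m - 1) ! (a - 1)}"

definition residue :: "nat \<Rightarrow> int list \<Rightarrow> node \<Rightarrow> int" where
  "residue e \<kappa> = (\<lambda>(m, a, b). (\<kappa> ! (m - 1) + int b - int a) mod int e)"

definition charge_weight :: "nat \<Rightarrow> int list \<Rightarrow> int multiset" where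
  "charge_weight e \<kappa> = mset (map (\<lambda>x. x mod int e) \<kappa>)"

definition content :: "nat \<Rightarrow> int list \<Rightarrow> nat list list \<Rightarrow> int multiset" where
  "content e \<kappa> \<mu> = image_mset (residue e \<kappa>) (mset_set (diagram \<mu>))"

definition tableau :: "nat list list \<Rightarrow> (node \<Rightarrow> nat) \<Rightarrow> bool" where
  "tableau \<mu> T \<longleftrightarrow>
     T \<in> extensional (diagram \<mu>) \<and> bij_betw T (diagram \<mu>) {1..card (diagram \<mu>)}"

definition row_standard :: "nat list list \<Rightarrow> (node \<Rightarrow> nat) \<Rightarrow> bool" where
  "row_standard \<mu> T \<longleftrightarrow>
     tableau \<mu> T \<and>
     (\<forall>m a b c. (m, a, b) \<in> diagram \<mu> \<longrightarrow> (m, a, c) \<in> diagram \<mu> \<longrightarrow> b < c \<longrightarrow>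
        T (m, a, b) < T (m, a, c))"

text \<open>The entry of \<open>T\<^sup>\<mu>\<close> at a node is the number of nodes up to it in reading order.\<close>

definition initial_tableau :: "nat list list \<Rightarrow> node \<Rightarrow> nat" where
  "initial_tableau \<mu> =
     restrict (\<lambda>(m, a, b). card {(m', a', b') \<in> diagram \<mu>.
                 m' < m \<or> (m' = m \<and> (a' < a \<or> (a' = a \<and> b' \<le> b)))}) (diagram \<mu>)"

definition initial_residues :: "nat \<Rightarrow> int list \<Rightarrow> nat list list \<Rightarrow> int list" where
  "initial_residues e \<kappa> \<mu> =
     map (\<lambda>r. residue e \<kappa> (inv_into (diagram \<mu>) (initial_tableau \<mu>) r)) [1..<card (diagram \<mu>) + 1]"

definition same_row :: "nat list list \<Rightarrow> nat \<Rightarrow> nat \<Rightarrow> bool" where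
  "same_row \<mu> r s \<longleftrightarrow>
     (\<exists>m a b c. (m, a, b) \<in> diagram \<mu> \<and> (m, a, c) \<in> diagram \<mu> \<and>
        initial_tableau \<mu> (m, a, b) = r \<and> initial_tableau \<mu> (m, a, c) = s)"

definition tableau_perm :: "nat list list \<Rightarrow> (node \<Rightarrow> nat) \<Rightarrow> nat \<Rightarrow> nat" where
  "tableau_perm \<mu> T =
     (THE w. w permutes {1..card (diagram \<mu>)} \<and>
             (\<forall>A\<in>diagram \<mu>. w (initial_tableau \<mu> A) = T A))"

definition garnir_nodes :: "nat list list \<Rightarrow> node set" where
  "garnir_nodes \<mu> = {(m, a, b). (m, a, b) \<in> diagram \<mu> \<and> (m, a + 1, b) \<in> diagram \<mu>}"

definition belt_upper :: "nat list list \<Rightarrow> node \<Rightarrow> node set" where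
  "belt_upper \<mu> = (\<lambda>(m, a, b). {(m, a, c) |c. (m, a, c) \<in> diagram \<mu> \<and> b \<le> c})"

definition belt_lower :: "node \<Rightarrow> node set" where
  "belt_lower = (\<lambda>(m, a, b). {(m, a + 1, c) |c. 1 \<le> c \<and> c \<le> b})"

text \<open>
  Within each of the two rows of the belt the entries increase from left to right because the
  Garnir tableau is row-standard.
\<close>

definition garnir_tableau :: "nat list list \<Rightarrow> node \<Rightarrow> node \<Rightarrow> nat" where
  "garnir_tableau \<mu> A =
     (THE G. row_standard \<mu> G \<and>
        (\<forall>B \<in> diagram \<mu> - (belt_upper \<mu> A \<union> belt_lower A). G B = initial_tableau \<mu> B) \<and>
        (\<forall>B \<in> belt_lower A. \<forall>C \<in> belt_upper \<mu> A. G B < G C))"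

definition psi_garnir ::
    "nat \<Rightarrow> int list \<Rightarrow> ((nat \<Rightarrow> nat) \<Rightarrow> nat list) \<Rightarrow> nat list list \<Rightarrow> node \<Rightarrow> 'k::field klr_elt" where
  "psi_garnir e \<kappa> red \<mu> A =
     klr_psi_perm e (content e \<kappa> \<mu>) red (tableau_perm \<mu> (garnir_tableau \<mu> A))"


section \<open>Permutation modules and Specht modules\<close>

definition perm_relations :: "nat \<Rightarrow> int list \<Rightarrow> nat list list \<Rightarrow> 'k::field klr_elt set" where
  "perm_relations e \<kappa> \<mu> =
     (let \<alpha> = content e \<kappa> \<mu>; R = klr e \<alpha> in
        {klr_e e \<alpha> js \<ominus>\<^bsub>R\<^esub> (if js = initial_residues e \<kappa> \<mu> then \<one>\<^bsub>R\<^esub> else \<zero>\<^bsub>R\<^esub>) |js. js \<in> res_seqs \<alpha>}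
      \<union> {klr_y e \<alpha> r |r. r \<in> {1..size \<alpha>}}
      \<union> {klr_psi e \<alpha> r |r. r \<in> {1..<size \<alpha>} \<and> same_row \<mu> r (r + 1)})"

text \<open>
  The cyclic module with generator \<open>z\<close> and relations \<open>a z = 0\<close>, for \<open>a\<close> in a set of ring elements,
  is the quotient of the regular module by the left ideal generated by that set.
\<close>

definition perm_kernel :: "nat \<Rightarrow> int list \<Rightarrow> nat list list \<Rightarrow> 'k::field klr_elt set" where
  "perm_kernel e \<kappa> \<mu> =
     (let R = klr e (content e \<kappa> \<mu>) in
        gen_submodule R (regular_module R) (perm_relations e \<kappa> \<mu>))"

definition perm_module ::
    "nat \<Rightarrow> int list \<Rightarrow> nat list list \<Rightarrow> ('k::field klr_elt, 'k klr_elt set) module" where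
  "perm_module e \<kappa> \<mu> =
     quot_module (regular_module (klr e (content e \<kappa> \<mu>))) (perm_kernel e \<kappa> \<mu>)"

definition perm_gen :: "nat \<Rightarrow> int list \<Rightarrow> nat list list \<Rightarrow> 'k::field klr_elt set" where
  "perm_gen e \<kappa> \<mu> =
     (let R = klr e (content e \<kappa> \<mu>) in
        perm_kernel e \<kappa> \<mu> +>\<^bsub>regular_module R\<^esub> \<one>\<^bsub>R\<^esub>)"

definition specht_kernel ::
    "nat \<Rightarrow> int list \<Rightarrow> ((nat \<Rightarrow> nat) \<Rightarrow> nat list) \<Rightarrow> nat list list \<Rightarrow> 'k::field klr_elt set set" where
  "specht_kernel e \<kappa> red \<mu> =
     (let M = perm_module e \<kappa> \<mu> in
        gen_submodule (klr e (content e \<kappa> \<mu>)) M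
          {psi_garnir e \<kappa> red \<mu> A \<odot>\<^bsub>M\<^esub> perm_gen e \<kappa> \<mu> |A. A \<in> garnir_nodes \<mu>})"

definition specht_module ::
    "nat \<Rightarrow> int list \<Rightarrow> ((nat \<Rightarrow> nat) \<Rightarrow> nat list) \<Rightarrow> nat list list \<Rightarrow>
     ('k::field klr_elt, 'k klr_elt set set) module" where
  "specht_module e \<kappa> red \<mu> = quot_module (perm_module e \<kappa> \<mu>) (specht_kernel e \<kappa> red \<mu>)"


section \<open>Well-definedness of the constructions\<close>

lemma free_algebra_mem_iff:
  "p \<in> carrier (free_algebra G) \<longleftrightarrow> (\<forall>w\<in>Poly_Mapping.keys p. set (letters w) \<subseteq> G)"
  by (simp add: free_algebra_def)

lemma free_algebra_mult_closed:
  assumes "p \<in> carrier (free_algebra G)" "q \<in> carrier (free_algebra G)"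
  shows "p * q \<in> carrier (free_algebra G)"
  using assms keys_mult[of p q] unfolding free_algebra_mem_iff by (fastforce simp: plus_word_def dest!: subsetD)

lemma free_algebra_add_closed:
  assumes "p \<in> carrier (free_algebra G)" "q \<in> carrier (free_algebra G)"
  shows "p + q \<in> carrier (free_algebra G)"
  using assms Poly_Mapping.keys_add[of p q] unfolding free_algebra_mem_iff by blast

lemma free_algebra_one: "1 \<in> carrier (free_algebra G)"
  by (simp add: free_algebra_mem_iff flip: single_one) (simp add: zero_word_def)

lemma free_algebra_uminus:
  "p \<in> carrier (free_algebra G) \<Longrightarrow> - p \<in> carrier (free_algebra G)"
  by (simp add: free_algebra_mem_iff)

lemma ring_free_algebra: "ring (free_algebra G :: ('g word \<Rightarrow>\<^sub>0 'k::field) ring)"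
proof (rule ringI)
  show "abelian_group (free_algebra G :: ('g word \<Rightarrow>\<^sub>0 'k::field) ring)"
  proof (rule abelian_groupI)
    fix x assume "x \<in> carrier (free_algebra G :: ('g word \<Rightarrow>\<^sub>0 'k::field) ring)"
    then show "\<exists>y\<in>carrier (free_algebra G). y \<oplus>\<^bsub>free_algebra G\<^esub> x = \<zero>\<^bsub>free_algebra G\<^esub>"
      by (intro bexI[of _ "- x"] free_algebra_uminus) (simp_all add: free_algebra_def)
  next
    fix x y assume "x \<in> carrier (free_algebra G :: ('g word \<Rightarrow>\<^sub>0 'k::field) ring)" "y \<in> carrier (free_algebra G :: ('g word \<Rightarrow>\<^sub>0 'k::field) ring)"
    then show "x \<oplus>\<^bsub>free_algebra G\<^esub> y \<in> carrier (free_algebra G)"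
      using free_algebra_add_closed[of x G y] by (simp add: free_algebra_def)
  qed (simp_all add: free_algebra_def add_ac keys_zero)
  show "Group.monoid (free_algebra G :: ('g word \<Rightarrow>\<^sub>0 'k::field) ring)"
  proof (rule monoidI)
    fix x y assume "x \<in> carrier (free_algebra G :: ('g word \<Rightarrow>\<^sub>0 'k::field) ring)" "y \<in> carrier (free_algebra G :: ('g word \<Rightarrow>\<^sub>0 'k::field) ring)"
    then show "x \<otimes>\<^bsub>free_algebra G\<^esub> y \<in> carrier (free_algebra G)"
      using free_algebra_mult_closed[of x G y] by (simp add: free_algebra_def)
  next
    show "\<one>\<^bsub>free_algebra G :: ('g word \<Rightarrow>\<^sub>0 'k::field) ring\<^esub> \<in> carrier (free_algebra G)"
      using free_algebra_one[of G] by (simp add: free_algebra_def)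
  qed (simp_all add: free_algebra_def mult.assoc)
qed (simp_all add: free_algebra_def distrib_left distrib_right)

lemma fgen_closed: "g \<in> G \<Longrightarrow> fgen g \<in> carrier (free_algebra G)"
  by (simp add: free_algebra_mem_iff fgen_def)

lemma free_algebra_sum_closed:
  "(\<And>x. x \<in> A \<Longrightarrow> f x \<in> carrier (free_algebra G)) \<Longrightarrow> sum f A \<in> carrier (free_algebra G)"
  by (induction A rule: infinite_finite_induct)
    (auto simp: free_algebra_add_closed, auto simp: free_algebra_mem_iff)

lemma free_algebra_diff:
  "p \<in> carrier (free_algebra G) \<Longrightarrow> q \<in> carrier (free_algebra G) \<Longrightarrow> p - q \<in> carrier (free_algebra G)"
  using free_algebra_add_closed[of p G "- q"] free_algebra_uminus[of q G] by simp

lemma free_algebra_zero: "0 \<in> carrier (free_algebra G)"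
  by (simp add: free_algebra_mem_iff)

lemmas free_algebra_closed = free_algebra_mult_closed free_algebra_add_closed free_algebra_one
  free_algebra_uminus fgen_closed free_algebra_diff free_algebra_zero

lemma swap_entries_res_seqs:
  assumes "is \<in> res_seqs \<alpha>" "r \<in> {1..<size \<alpha>}"
  shows "swap_entries r is \<in> res_seqs \<alpha>"
proof -
  have "length is = size \<alpha>" using assms by (auto simp: res_seqs_def)
  moreover have "is[r - 1 := is ! r, r := is ! (r-1)] = is[r := is ! (r-1), r - 1 := is ! r]"
    using assms by (intro list_update_swap) auto
  ultimately show ?thesis using assms mset_swap[of r "is" "r-1"]
    by (auto simp: res_seqs_def swap_entries_def entry_def)
qed

lemma klr_relations_closed: "klr_relations e \<alpha> \<subseteq> carrier (free_algebra (klr_gens \<alpha>) :: 'k::field free_klr ring)"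
proof -
  let ?C = "carrier (free_algebra (klr_gens \<alpha>) :: 'k free_klr ring)"
  have E: "is \<in> res_seqs \<alpha> \<Longrightarrow> fE is \<in> ?C" for "is" by (rule fgen_closed) (simp add: klr_gens_def)
  have Y: "r \<in> {1..size \<alpha>} \<Longrightarrow> fY r \<in> ?C" for r by (rule fgen_closed) (simp add: klr_gens_def)
  have P: "r \<in> {1..<size \<alpha>} \<Longrightarrow> fPsi r \<in> ?C" for r by (rule fgen_closed) (simp add: klr_gens_def)
  have D: "dlt is r \<in> ?C" for "is" r by (simp add: dlt_def free_algebra_closed)
  have B: "braid_term e is r \<in> ?C" for "is" r by (simp add: braid_term_def free_algebra_closed)
  have Q: "r \<in> {1..<size \<alpha>} \<Longrightarrow> quad_term e is r \<in> ?C" for "is" r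
    using Y[of r] Y[of "r+1"] by (simp add: quad_term_def free_algebra_zero free_algebra_one free_algebra_diff)
  have S: "(\<Sum>is\<in>res_seqs \<alpha>. fE is) \<in> ?C" by (rule free_algebra_sum_closed) (rule E)
  note cl = free_algebra_mult_closed free_algebra_add_closed free_algebra_diff free_algebra_one free_algebra_zero
  show ?thesis
    unfolding klr_relations_def
    by (intro Un_least subsetI; (elim CollectE exE conjE singletonE)?; hypsubst)
      (simp_all add: cl E Y P D B Q S swap_entries_res_seqs)
qed

lemma ideal_klr_ideal: "ideal (klr_ideal e \<alpha>) (free_algebra (klr_gens \<alpha>))"
  unfolding klr_ideal_def by (rule ring.genideal_ideal[OF ring_free_algebra klr_relations_closed])

lemma ring_klr: "ring (klr e \<alpha>)"
  unfolding klr_def by (rule ideal.quotient_is_ring[OF ideal_klr_ideal])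

lemma left_module_regular: assumes "ring R" shows "left_module R (regular_module R)"
proof -
  interpret ring R by fact
  have "abelian_group (regular_module R)"
  proof (rule abelian_groupI)
    fix x assume "x \<in> carrier (regular_module R)"
    then show "\<exists>y\<in>carrier (regular_module R). y \<oplus>\<^bsub>regular_module R\<^esub> x = \<zero>\<^bsub>regular_module R\<^esub>"
      by (intro bexI[of _ "\<ominus>\<^bsub>R\<^esub> x"]) (simp_all add: regular_module_def l_neg)
  qed (simp_all add: regular_module_def a_ac)
  then show ?thesis
    by (intro left_module.intro left_module_axioms.intro)
      (simp_all add: regular_module_def l_distr r_distr m_assoc assms)
qed

context left_module
begin

lemma gen_submodule_submodule:
  assumes "S \<subseteq> carrier M" shows "submodule (gen_submodule R M S) R M"
proof -
  let ?F = "{N. submodule N R M \<and> S \<subseteq> N}"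
  have c: "submodule (carrier M) R M"
    by (intro submodule.intro submodule_axioms.intro) (use group.subgroup_self[OF M.a_group] in auto)
  have "subgroup (\<Inter>?F) (add_monoid M)"
    by (rule group.subgroups_Inter[OF M.a_group]) (use c assms in \<open>auto simp: submodule_def\<close>)
  then show ?thesis unfolding gen_submodule_def
    by (intro submodule.intro submodule_axioms.intro) (auto simp: submodule_def submodule_axioms_def)
qed

lemma quot_left_module:
  assumes "submodule N R M" shows "left_module R (quot_module M N)"
proof -
  interpret N: submodule N R M by fact
  interpret N: abelian_subgroup N M
    by (rule abelian_subgroupI3[OF _ M.abelian_group_axioms])
      (simp add: additive_subgroup_def N.subgroup_axioms)
  have car: "X \<in> carrier (quot_module M N) \<longleftrightarrow> (\<exists>x\<in>carrier M. X = N +>\<^bsub>M\<^esub> x)" for X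
    by (auto simp: quot_module_def A_RCOSETS_def RCOSETS_def a_r_coset_def)
  have N0: "N \<subseteq> carrier M" by (rule N.a_subset)
  have sm: "a \<odot>\<^bsub>quot_module M N\<^esub> (N +>\<^bsub>M\<^esub> x) = N +>\<^bsub>M\<^esub> (a \<odot>\<^bsub>M\<^esub> x)"
    if "a \<in> carrier R" "x \<in> carrier M" for a x
  proof -
    have "N +>\<^bsub>M\<^esub> (a \<odot>\<^bsub>M\<^esub> y) = N +>\<^bsub>M\<^esub> (a \<odot>\<^bsub>M\<^esub> x)" if y: "y \<in> N +>\<^bsub>M\<^esub> x" for y
    proof -
      from y obtain h where h: "h \<in> N" "y = h \<oplus>\<^bsub>M\<^esub> x" by (auto simp: a_r_coset_def')
      have "a \<odot>\<^bsub>M\<^esub> y = a \<odot>\<^bsub>M\<^esub> h \<oplus>\<^bsub>M\<^esub> a \<odot>\<^bsub>M\<^esub> x"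
        using h that \<open>a \<in> carrier R\<close> \<open>x \<in> carrier M\<close> N0 by (auto simp: smult_r_distr)
      moreover have "a \<odot>\<^bsub>M\<^esub> h \<in> N" using h \<open>a \<in> carrier R\<close> N.smult_closed by blast
      ultimately have "a \<odot>\<^bsub>M\<^esub> y \<in> N +>\<^bsub>M\<^esub> (a \<odot>\<^bsub>M\<^esub> x)" by (auto simp: a_r_coset_def')
      then show ?thesis
        using N.a_repr_independence' smult_closed \<open>a \<in> carrier R\<close> \<open>x \<in> carrier M\<close> by metis
    qed
    moreover have "x \<in> N +>\<^bsub>M\<^esub> x" using N.a_rcos_self that by blast
    ultimately have "(\<Union>y\<in>N +>\<^bsub>M\<^esub> x. N +>\<^bsub>M\<^esub> (a \<odot>\<^bsub>M\<^esub> y)) = N +>\<^bsub>M\<^esub> (a \<odot>\<^bsub>M\<^esub> x)" by blast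
    then show ?thesis by (simp add: quot_module_def)
  qed
  have ad: "(N +>\<^bsub>M\<^esub> x) \<oplus>\<^bsub>quot_module M N\<^esub> (N +>\<^bsub>M\<^esub> y) = N +>\<^bsub>M\<^esub> (x \<oplus>\<^bsub>M\<^esub> y)"
    if "x \<in> carrier M" "y \<in> carrier M" for x y
    using N.a_rcos_sum[OF that] by (simp add: quot_module_def)
  have z: "\<zero>\<^bsub>quot_module M N\<^esub> = N +>\<^bsub>M\<^esub> \<zero>\<^bsub>M\<^esub>"
    using N0 by (auto simp: quot_module_def a_r_coset_def')
  have ab: "abelian_group (quot_module M N)"
  proof (rule abelian_groupI)
    fix X Y assume "X \<in> carrier (quot_module M N)" "Y \<in> carrier (quot_module M N)"
    then obtain x y where x: "x \<in> carrier M" "X = N +>\<^bsub>M\<^esub> x"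
      and y: "y \<in> carrier M" "Y = N +>\<^bsub>M\<^esub> y" by (auto simp only: car)
    show "X \<oplus>\<^bsub>quot_module M N\<^esub> Y \<in> carrier (quot_module M N)"
      unfolding car x(2) y(2) ad[OF x(1) y(1)] using x y by blast
    show "X \<oplus>\<^bsub>quot_module M N\<^esub> Y = Y \<oplus>\<^bsub>quot_module M N\<^esub> X"
      using x y by (simp add: ad M.a_comm)
    show "\<zero>\<^bsub>quot_module M N\<^esub> \<oplus>\<^bsub>quot_module M N\<^esub> X = X"
      using x by (simp add: ad z)
    have "(N +>\<^bsub>M\<^esub> (\<ominus>\<^bsub>M\<^esub> x)) \<oplus>\<^bsub>quot_module M N\<^esub> X = \<zero>\<^bsub>quot_module M N\<^esub>"
      using x by (simp add: ad z M.l_neg)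
    moreover have "(N +>\<^bsub>M\<^esub> (\<ominus>\<^bsub>M\<^esub> x)) \<in> carrier (quot_module M N)"
      unfolding car using x by blast
    ultimately show "\<exists>Y\<in>carrier (quot_module M N). Y \<oplus>\<^bsub>quot_module M N\<^esub> X = \<zero>\<^bsub>quot_module M N\<^esub>" by blast
    fix Z assume "Z \<in> carrier (quot_module M N)"
    then obtain w where w: "w \<in> carrier M" "Z = N +>\<^bsub>M\<^esub> w" by (auto simp only: car)
    show "X \<oplus>\<^bsub>quot_module M N\<^esub> Y \<oplus>\<^bsub>quot_module M N\<^esub> Z = X \<oplus>\<^bsub>quot_module M N\<^esub> (Y \<oplus>\<^bsub>quot_module M N\<^esub> Z)"
      using x y w by (simp add: ad M.a_assoc)
  next
    show "\<zero>\<^bsub>quot_module M N\<^esub> \<in> carrier (quot_module M N)" unfolding car z by blast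
  qed
  show ?thesis
  proof (intro left_module.intro left_module_axioms.intro ab R.ring_axioms)
    fix a X assume a: "a \<in> carrier R" and "X \<in> carrier (quot_module M N)"
    then obtain x where x: "x \<in> carrier M" "X = N +>\<^bsub>M\<^esub> x" by (auto simp only: car)
    show "a \<odot>\<^bsub>quot_module M N\<^esub> X \<in> carrier (quot_module M N)"
      unfolding car x(2) sm[OF a x(1)] using a x by blast
    { fix b assume b: "b \<in> carrier R"
      show "(a \<oplus>\<^bsub>R\<^esub> b) \<odot>\<^bsub>quot_module M N\<^esub> X = a \<odot>\<^bsub>quot_module M N\<^esub> X \<oplus>\<^bsub>quot_module M N\<^esub> b \<odot>\<^bsub>quot_module M N\<^esub> X"
        using a b x by (simp add: sm ad smult_l_distr)
      show "(a \<otimes>\<^bsub>R\<^esub> b) \<odot>\<^bsub>quot_module M N\<^esub> X = a \<odot>\<^bsub>quot_module M N\<^esub> (b \<odot>\<^bsub>quot_module M N\<^esub> X)"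
        using a b x by (simp add: sm ad smult_assoc) }
    { fix Y assume "Y \<in> carrier (quot_module M N)"
      then obtain y where y: "y \<in> carrier M" "Y = N +>\<^bsub>M\<^esub> y" by (auto simp only: car)
      show "a \<odot>\<^bsub>quot_module M N\<^esub> (X \<oplus>\<^bsub>quot_module M N\<^esub> Y) = a \<odot>\<^bsub>quot_module M N\<^esub> X \<oplus>\<^bsub>quot_module M N\<^esub> a \<odot>\<^bsub>quot_module M N\<^esub> Y"
        using a x y by (simp add: sm ad smult_r_distr) }
  next
    fix X assume "X \<in> carrier (quot_module M N)"
    then obtain x where x: "x \<in> carrier M" "X = N +>\<^bsub>M\<^esub> x" by (auto simp only: car)
    show "\<one>\<^bsub>R\<^esub> \<odot>\<^bsub>quot_module M N\<^esub> X = X" using x by (simp add: sm)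
  qed
qed

end

lemma klr_class_closed: "p \<in> carrier (free_algebra (klr_gens \<alpha>)) \<Longrightarrow> klr_class e \<alpha> p \<in> carrier (klr e \<alpha>)"
  by (auto simp: klr_class_def klr_def FactRing_def A_RCOSETS_def RCOSETS_def a_r_coset_def)

lemma perm_relations_closed: "perm_relations e \<kappa> \<mu> \<subseteq> carrier (klr e (content e \<kappa> \<mu>))"
proof -
  interpret ring "klr e (content e \<kappa> \<mu>)" by (rule ring_klr)
  show ?thesis unfolding perm_relations_def Let_def klr_e_def klr_y_def klr_psi_def
    by (auto intro!: klr_class_closed minus_closed fgen_closed simp: klr_gens_def)
qed

lemma left_module_perm: "left_module (klr e (content e \<kappa> \<mu>)) (perm_module e \<kappa> \<mu>)"
proof -
  let ?R = "klr e (content e \<kappa> \<mu>)"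
  interpret left_module ?R "regular_module ?R" by (rule left_module_regular[OF ring_klr])
  show ?thesis unfolding perm_module_def perm_kernel_def Let_def
    by (intro quot_left_module gen_submodule_submodule) (use perm_relations_closed in \<open>auto simp: regular_module_def\<close>)
qed

lemma klr_mult_class:
  assumes "p \<in> carrier (free_algebra (klr_gens \<alpha>))" "q \<in> carrier (free_algebra (klr_gens \<alpha>))"
  shows "klr_class e \<alpha> p \<otimes>\<^bsub>klr e \<alpha>\<^esub> klr_class e \<alpha> q = klr_class e \<alpha> (p * q)"
  using ideal.rcoset_mult_add[OF ideal_klr_ideal assms, of e]
  by (simp add: klr_def klr_class_def FactRing_def free_algebra_def)

lemma finite_diagram: "finite (diagram \<mu>)"
proof -
  have "diagram \<mu> \<subseteq> (SIGMA m:{..length \<mu>}. SIGMA a:{..length (\<mu> ! (m - 1))}. {..\<mu> ! (m - 1) ! (a - 1)})"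
    by (auto simp: diagram_def)
  then show ?thesis by (rule finite_subset) auto
qed
end

theory Submission
  imports Defs "HOL-Library.Function_Algebras" "HOL-Library.List_Lexorder"
begin

text \<open>
  Let \<open>v\<close> be the generator of \<open>M\<^sup>\<lambda>\<close> and \<open>U = \<psi>\<^sup>B\<^sup>1\<close>.  The quadratic and braid relations show that
  \<open>y\<^sub>t U v = 0\<close> for all \<open>t\<close> and \<open>\<psi>\<^sub>t U v = 0\<close> for \<open>t \<noteq> k + 1\<close>, and that every Garnir relation of \<open>\<lambda>\<close> lies in
  \<open>R U v\<close>.  Since \<open>\<lambda>\<^sub>1\<close> has no Garnir nodes, this makes \<open>R U v\<close> a quotient of \<open>S\<^sup>\<lambda>\<^sup>1 = M\<^sup>\<lambda>\<^sup>1\<close> and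
  \<open>M\<^sup>\<lambda> / R U v\<close> equal to \<open>S\<^sup>\<lambda>\<close>.  Now \<open>M\<^sup>\<lambda>\<^sup>1\<close> is spanned by one product of \<open>\<psi>\<close>'s for each shuffle of its two
  rows, and it remains to see that these products, applied to \<open>U v\<close>, are linearly independent.

  This is read off an explicit module.  A residue sequence is a sequence of moves of two tokens,
  which start at \<open>i\<close> and \<open>i - 1\<close>: the letter \<open>c\<close> takes a token from \<open>c\<close> to \<open>c + 1\<close>, across the edge
  \<open>c\<close>.  Each sequence carries the algebra on square-zero variables \<open>x\<^sub>c\<close>, one for each edge, restricted to
  elements which \<open>x\<^sub>c\<close> and \<open>x\<^bsub>c+1\<^esub>\<close> multiply to the same value unless the tokens meet at \<open>c + 1\<close>.  Here \<open>y\<close> acts by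
  \<open>\<plusminus> x\<^sub>c\<close>, and \<open>v\<close> goes to the product of all \<open>x\<^sub>c\<close>.  The image of the product belonging to a shuffle has
  a leading monomial which the images of lexicographically smaller shuffles avoid.
\<close>

section \<open>Two tokens on a line\<close>

text \<open>Rewriting with the relations only bounds the submodule from above; that nothing more
  collapses has to be seen in a concrete module. Residue sequences do not separate the shuffles:
  after a meeting the sequence no longer shows which token moves on first. So each meeting point
  must contribute a two-dimensional space, and the rank two nilHecke algebra offers one: on
  k[x]/(x^2) it acts by y_1 = -x, y_2 = x and psi = d/dx, and 1 and x tell the two ways of leaving
  apart. A variable for every edge, not just for every meeting point, keeps the operators local:
  they depend only on the exchanged letters and the token positions. The price is the constraint
  tying x_c to x_{c+1}, which the quadratic relation forces where one token crosses both edges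
  alone. That all Garnir relations follow from the first rests on a braid relation with correction
  term -1, which expresses the Garnir element of (1, b) through that of (1, b - 1). In shuffles of
  standard tableaux the tokens never meet, so there the corrections vanish.\<close>

text \<open>
  A function \<open>g\<close> on finite sets of edges stands for \<open>\<Sum>\<^sub>Y g Y \<Prod>\<^bsub>c\<in>Y\<^esub> x\<^sub>c\<close> with commuting variables such
  that \<open>x\<^sub>c\<^sup>2 = 0\<close>; \<open>mulx\<close> multiplies by \<open>x\<^sub>c\<close> and \<open>dx\<close> extracts the coefficient of \<open>x\<^sub>c\<close>.
\<close>

definition mulx :: "int \<Rightarrow> (int set \<Rightarrow> 'k::field) \<Rightarrow> int set \<Rightarrow> 'k" where
  "mulx c g = (\<lambda>Y. if c \<in> Y then g (Y - {c}) else 0)"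

definition dx :: "int \<Rightarrow> (int set \<Rightarrow> 'k::field) \<Rightarrow> int set \<Rightarrow> 'k" where
  "dx c g = (\<lambda>Y. if c \<in> Y then 0 else g (insert c Y))"

lemma mulx_zero [simp]: "mulx c 0 = 0" by (auto simp: mulx_def)
lemma mulx_add [simp]: "mulx c (f + g) = mulx c f + mulx c g" by (auto simp: mulx_def)
lemma mulx_minus [simp]: "mulx c (- g) = - mulx c g" by (auto simp: mulx_def)
lemma mulx_diff [simp]: "mulx c (f - g) = mulx c f - mulx c g" by (auto simp: mulx_def)
lemma dx_zero [simp]: "dx c 0 = 0" by (auto simp: dx_def)
lemma dx_add [simp]: "dx c (f + g) = dx c f + dx c g" by (auto simp: dx_def)
lemma dx_minus [simp]: "dx c (- g) = - dx c g" by (auto simp: dx_def)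

lemma mulx_mulx_same [simp]: "mulx c (mulx c g) = 0"
  by (auto simp: mulx_def)
lemma mulx_commute: "mulx c (mulx d g) = mulx d (mulx c g)"
proof -
  have "Y - {c} - {d} = Y - {d} - {c}" for Y by blast
  then show ?thesis by (auto simp: mulx_def fun_eq_iff)
qed
lemma dx_dx_same [simp]: "dx c (dx c g) = 0"
  by (auto simp: dx_def)
lemma dx_mulx_same: "dx c (mulx c g) = g - mulx c (dx c g)"
  by (auto simp: dx_def mulx_def fun_eq_iff insert_absorb)
lemma dx_mulx: "c \<noteq> d \<Longrightarrow> dx c (mulx d g) = mulx d (dx c g)"
  by (auto simp: dx_def mulx_def fun_eq_iff insert_Diff_if)
lemma dx_commute: "dx c (dx d g) = dx d (dx c g)"
  by (auto simp: dx_def fun_eq_iff insert_commute)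

text \<open>
  A state \<open>(p, q)\<close> lists the positions of the leading and of the trailing token.  When they share a
  position the leading one moves, so that \<open>q \<le> p\<close> is preserved.
\<close>

fun step :: "int \<times> int \<Rightarrow> int \<Rightarrow> int \<times> int" where
  "step (p, q) c = (if c = p then (p + 1, q) else (p, q + 1))"

text \<open>The effect of the psi that exchanges the letters a, b read in state \<open>s\<close>.
  For a = b it is the divided difference of the nilHecke algebra. For adjacent letters the
  polynomial of the quadratic relation sits on the ascent and a sign on the descent. An ascent read
  in any state other than (a + 1, a) is made by one token alone and cannot be exchanged, which
  explains the value 0.\<close>

definition cross :: "int \<times> int \<Rightarrow> int \<Rightarrow> int \<Rightarrow> (int set \<Rightarrow> 'k::field) \<Rightarrow> int set \<Rightarrow> 'k" where
  "cross s a b g =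
     (if a = b then dx a g
      else if b = a + 1 then (if s = (a + 1, a) then mulx a g + mulx b g else 0)
      else if b = a - 1 then - g else g)"

fun ok :: "int \<times> int \<Rightarrow> int list \<Rightarrow> bool" where
  "ok s [] = True"
| "ok s (c # w) = ((c = fst s \<or> c = snd s) \<and> ok (step s c) w)"

text \<open>The correction arises when the outer letters agree and the middle one is adjacent. Then
  one side vanishes and the other is, up to sign, (x_a + x_b) d/dx_a applied to g. Differentiating
  \<open>h1\<close> or \<open>h2\<close> with respect to x_a shows that this is g.\<close>

lemma cross_braid:
  assumes ok: "ok (p, q) [a, b, c]" and qp: "q \<le> p"
    and h1: "a = c \<Longrightarrow> b = a + 1 \<Longrightarrow> mulx a g = mulx b g"
    and h2: "a = c \<Longrightarrow> b = a - 1 \<Longrightarrow> mulx b g = mulx a g"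
  shows "cross (p, q) b c (cross (step (p, q) b) a c (cross (p, q) a b g)) =
     cross (step (p, q) c) a b (cross (p, q) a c (cross (step (p, q) a) b c g))
      + (if a = c \<and> b = a + 1 then g else if a = c \<and> b = a - 1 then - g else 0)"
proof -
  have 1: "- mulx a (dx a g) - mulx b (dx a g) + g = 0" if "a = c" and b: "b = a + 1"
  proof -
    have "dx a (mulx b g) = mulx b (dx a g)" using b by (intro dx_mulx) simp
    then have "g - mulx a (dx a g) = mulx b (dx a g)" using arg_cong[OF h1[OF that], of "dx a"] by (metis dx_mulx_same)
    from this[symmetric] show ?thesis by (simp only:) simp
  qed
  have 2: "- mulx b (dx a g) - mulx a (dx a g) = - g" if "a = c" and b: "b = a - 1"
  proof -
    have "dx a (mulx b g) = mulx b (dx a g)" using b by (intro dx_mulx) simp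
    then have "g - mulx a (dx a g) = mulx b (dx a g)" using arg_cong[OF h2[OF that], of "dx a"] by (metis dx_mulx_same)
    from this[symmetric] show ?thesis by (simp only:) simp
  qed
  have A: "a = p \<or> a = q" using ok by simp
  then consider (a1) "p = q" "a = q" | (a2) "q < p" "a = p" | (a3) "q < p" "a = q" using qp by linarith
  then show ?thesis
  proof cases
    case a1
    then have "b = q \<or> b = q + 1" using ok by auto
    then show ?thesis
    proof
      assume b: "b = q"
      then have c: "c = q + 1" using a1 ok by auto
      show ?thesis by (simp add: cross_def a1 b c)
    next
      assume b: "b = q + 1"
      then have "c = q \<or> c = q + 2" using a1 ok by auto
      then show ?thesis using 1 by (auto simp add: cross_def a1 b)
    qed
  next
    case a2
    then have "b = p + 1 \<or> b = q" using ok by auto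
    then show ?thesis
    proof
      assume b: "b = p + 1"
      then have "c = p + 2 \<or> c = q" using a2 ok by auto
      then show ?thesis using a2(1) by (elim disjE; cases "p = q + 1"; cases "p = q + 2"; simp add: cross_def a2(2) b)
    next
      assume b: "b = q"
      then have "c = p + 1 \<or> c = q + 1" using a2 ok by auto
      then show ?thesis using a2(1) 2 by (elim disjE; cases "p = q + 1"; cases "p = q + 2"; simp add: cross_def a2(2) b)
    qed
  next
    case a3
    then have "b = p \<or> b = q + 1" using ok by auto
    then show ?thesis
    proof
      assume b: "b = p"
      then have "c = p + 1 \<or> c = q + 1" using a3 ok by (auto split: if_splits)
      then show ?thesis using a3(1) 1 by (elim disjE; cases "p = q + 1"; cases "p = q + 2"; simp add: cross_def a3(2) b)
    next
      assume b: "b = q + 1"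
      then have "c = p \<or> c = p + 1 \<or> c = q + 2" using a3 ok by (auto split: if_splits)
      then show ?thesis using a3(1) by (elim disjE; cases "p = q + 1"; cases "p = q + 2"; cases "p = q + 3"; simp add: cross_def a3(2) b)
    qed
  qed
qed

lemma cross_zero [simp]: "cross s a b 0 = 0" by (simp add: cross_def)
lemma cross_zero_fun [simp]: "cross s a b (\<lambda>Y. 0) = 0"
  using cross_zero[of s a b] by (simp add: zero_fun_def del: cross_zero)
lemma cross_add [simp]: "cross s a b (f + g) = cross s a b f + cross s a b g"
  by (simp add: cross_def)
lemma cross_minus [simp]: "cross s a b (- g) = - cross s a b g"
  by (simp add: cross_def)

lemma mulx_eq_mulx: "mulx c g = mulx c' g \<Longrightarrow> mulx c (mulx d g) = mulx c' (mulx d g)"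
  by (metis mulx_commute)

lemma cross_mulx: "a \<noteq> b \<or> c \<noteq> a \<Longrightarrow> cross s a b (mulx c g) = mulx c (cross s a b g)"
  by (auto simp: cross_def dx_mulx mulx_commute)

lemma cross_dx: "c \<noteq> a \<Longrightarrow> c \<noteq> b \<Longrightarrow> cross s a b (dx c g) = dx c (cross s a b g)"
  by (auto simp: cross_def dx_mulx dx_commute)

lemma cross_commute:
  assumes "c = d \<Longrightarrow> c \<noteq> a \<and> c \<noteq> b" "a = b \<Longrightarrow> a \<noteq> c \<and> a \<noteq> d"
  shows "cross s a b (cross s' c d g) = cross s' c d (cross s a b g)"
proof (cases "a = b")
  case True
  then show ?thesis using assms by (auto simp: cross_def dx_mulx dx_commute)
next
  case False
  then show ?thesis using assms by (auto simp: cross_def[of s' c d] cross_mulx cross_dx)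
qed

section \<open>Trajectories of the tokens and their meeting points\<close>

definition run :: "int \<times> int \<Rightarrow> int list \<Rightarrow> int \<times> int" where "run = foldl step"

lemma run_simps [simp]:
  "run s [] = s" "run s (c # w) = run (step s c) w" "run s (u @ w) = run (run s u) w"
  by (simp_all add: run_def)

lemma ok_append [simp]: "ok s (u @ w) \<longleftrightarrow> ok s u \<and> ok (run s u) w"
  by (induction u arbitrary: s) auto

definition collision :: "int \<times> int \<Rightarrow> int set" where "collision s = (if fst s = snd s then {fst s} else {})"

fun touch :: "int \<times> int \<Rightarrow> int list \<Rightarrow> int set" where
  "touch s [] = collision s"
| "touch s (c # w) = collision s \<union> touch (step s c) w"

lemma collision_in_touch: "collision s \<subseteq> touch s w" by (cases w) auto

lemma touch_append [simp]: "touch s (u @ w) = touch s u \<union> touch (run s u) w"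
  using collision_in_touch by (induction u arbitrary: s) auto

lemma collision_run: "collision (run s u) \<subseteq> touch s u"
  using touch_append[of s u "[]"] collision_in_touch[of "run s u" "[]"] by auto

lemma step_mono: "fst s \<le> fst (step s c)" "snd s \<le> snd (step s c)" by (cases s; simp)+

lemma run_mono: "fst s \<le> fst (run s w) \<and> snd s \<le> snd (run s w)"
  by (induction w arbitrary: s) (auto intro: order.trans step_mono)

lemma step_ordered: "snd s \<le> fst s \<Longrightarrow> c = fst s \<or> c = snd s \<Longrightarrow> snd (step s c) \<le> fst (step s c)"
  by (cases s) auto

lemma run_ordered: "ok s w \<Longrightarrow> snd s \<le> fst s \<Longrightarrow> snd (run s w) \<le> fst (run s w)"
  by (induction w arbitrary: s) (auto simp del: step.simps simp: step_ordered)

text \<open>No token ever moves back, so the leading one cannot be met before its starting position,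
  nor the trailing one beyond its final position.\<close>

lemma touch_bounds: "ok s w \<Longrightarrow> snd s \<le> fst s \<Longrightarrow> c \<in> touch s w \<Longrightarrow> fst s \<le> c \<and> c \<le> snd (run s w)"
proof (induction w arbitrary: s)
  case Nil then show ?case by (auto simp: collision_def split: if_splits)
next
  case (Cons a w)
  show ?case
  proof (cases "c \<in> touch (step s a) w")
    case True
    then have "fst (step s a) \<le> c \<and> c \<le> snd (run (step s a) w)"
      using Cons.prems by (intro Cons.IH) (auto simp del: step.simps simp: step_ordered)
    then show ?thesis using step_mono[of s a] by (auto simp del: step.simps)
  next
    case False
    then show ?thesis using Cons.prems run_mono[of "step s a" w] step_mono[of s a]
      by (auto simp: collision_def simp del: step.simps split: if_splits)
  qed
qed

lemma letter_bounds: "ok s w \<Longrightarrow> snd s \<le> fst s \<Longrightarrow> c \<in> set w \<Longrightarrow> snd s \<le> c \<and> c < fst (run s w)"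
proof (induction w arbitrary: s)
  case (Cons a w)
  have o: "snd (step s a) \<le> fst (step s a)" "ok (step s a) w"
    using Cons.prems by (auto simp del: step.simps simp: step_ordered)
  show ?case
  proof (cases "c \<in> set w")
    case True
    then show ?thesis using Cons.IH[OF o(2,1)] step_mono[of s a] by (auto simp del: step.simps)
  next
    case False
    then have c: "c = a" using Cons.prems by auto
    have "a < fst (step s a)" using Cons.prems by (cases s) auto
    then show ?thesis using c Cons.prems run_mono[of "step s a" w] by (auto simp del: step.simps)
  qed
qed simp

lemma step_swap: "snd s \<le> fst s \<Longrightarrow> ok s [a, b] \<Longrightarrow> ok s [b, a] \<Longrightarrow> step (step s a) b = step (step s b) a"
  by (cases s) (auto split: if_splits)

lemma cross_not_ok: "ok s [a, b] \<Longrightarrow> snd s \<le> fst s \<Longrightarrow> \<not> ok s [b, a] \<Longrightarrow> cross s a b g = 0"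
  by (cases s) (auto simp: cross_def split: if_splits)

lemma run_sum: "ok s w \<Longrightarrow> fst (run s w) + snd (run s w) = fst s + snd s + int (length w)"
proof (induction w arbitrary: s)
  case (Cons a w)
  have "fst (step s a) + snd (step s a) = fst s + snd s + 1" by (cases s) simp
  then show ?case using Cons by (simp del: step.simps)
qed simp

text \<open>Each token crosses an edge at most once. Two consecutive crossings of one edge therefore
  use up both tokens, which must stand together just before.\<close>

lemma double_letter:
  assumes "ok s (u @ [a, a] @ w)" "snd s \<le> fst s"
  shows "a \<notin> set u" "a \<notin> set w" "run s u = (a, a)"
proof -
  have o: "ok s u" "ok (run s u) [a, a]" using assms by auto
  have "snd (run s u) \<le> fst (run s u)" using run_ordered[OF o(1) assms(2)] .
  then show r: "run s u = (a, a)" using o(2) by (cases "run s u") (auto split: if_splits)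
  show "a \<notin> set u" using letter_bounds[OF o(1) assms(2), of a] r by auto
  have "ok (a + 1, a + 1) w" using assms(1) r by auto
  from letter_bounds[OF this, of a] show "a \<notin> set w" by auto
qed

lemma split_at_pair:
  assumes "1 \<le> t" "t < length J"
  shows "\<exists>u a b w. J = u @ a # b # w \<and> t = Suc (length u)"
proof -
  have "drop (t - 1) J = J ! (t - 1) # J ! t # drop (t + 1) J"
    using assms Cons_nth_drop_Suc[of "t - 1" J] Cons_nth_drop_Suc[of t J] by simp
  then have "J = take (t - 1) J @ J ! (t - 1) # J ! t # drop (t + 1) J"
    by (metis append_take_drop_id)
  moreover have "t = Suc (length (take (t - 1) J))" using assms by simp
  ultimately show ?thesis by blast
qed

lemma split_at_letter:
  assumes "1 \<le> t" "t \<le> length J"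
  shows "\<exists>u a w. J = u @ a # w \<and> t = Suc (length u)"
proof -
  have "J = take (t - 1) J @ J ! (t - 1) # drop t J"
    using assms id_take_nth_drop[of "t - 1" J] by simp
  moreover have "t = Suc (length (take (t - 1) J))" using assms by simp
  ultimately show ?thesis by blast
qed

lemma entry_append [simp]:
  "entry (u @ a # w) (Suc (length u)) = a"
  "entry (u @ a # b # w) (Suc (Suc (length u))) = b"
  "entry (u @ a # b # c # w) (Suc (Suc (Suc (length u)))) = c"
  by (simp_all add: entry_def nth_append)

lemma swap_entries_append [simp]: "swap_entries (Suc (length u)) (u @ a # b # w) = u @ b # a # w"
  by (simp add: swap_entries_def entry_def nth_append list_update_append)

lemma length_swap_entries [simp]: "length (swap_entries t J) = length J"
  by (simp add: swap_entries_def)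

text \<open>
  The bound on \<open>e\<close> makes equality and adjacency of residues modulo \<open>e\<close> agree with those of the
  integers that occur.
\<close>

locale two_tokens =
  fixes e k r :: nat and i :: int
  assumes r1: "1 \<le> r" and rk: "r \<le> k" and e_large: "e = 0 \<or> k + r + 5 \<le> e"
begin

abbreviation s0 :: "int \<times> int" where "s0 \<equiv> (i, i - 1)"

text \<open>The end state serves both shapes: the rows of \<lambda> make k moves from i and r moves
  from i - 1, the rows of \<lambda>_1 make k + 1 moves from i - 1 and r - 1 moves from i.\<close>

definition words :: "int list set" where
  "words = {J. ok s0 J \<and> run s0 J = (i + int k, i + int r - 1)}"

text \<open>The equation on \<open>mulx\<close> is forced. Where one token crosses c and then c + 1,
  the two letters cannot be exchanged, so psi^2 is 0 and the quadratic relation demands that the two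
  y's cancel. A meeting at c + 1 lets the two letters come from different tokens and lifts the
  constraint.\<close>

definition space :: "(int list \<Rightarrow> int set \<Rightarrow> 'k::field) set" where
  "space = {f. (\<forall>J. J \<notin> words \<longrightarrow> f J = 0) \<and>
     (\<forall>J c. i - 1 \<le> c \<longrightarrow> c + 1 < i + int k \<longrightarrow> c + 1 \<notin> touch s0 J \<longrightarrow> mulx c (f J) = mulx (c + 1) (f J))}"

definition resid :: "int list \<Rightarrow> int list" where "resid = map (\<lambda>c. c mod int e)"

definition opE :: "int list \<Rightarrow> (int list \<Rightarrow> int set \<Rightarrow> 'k::field) \<Rightarrow> int list \<Rightarrow> int set \<Rightarrow> 'k" where
  "opE js f = (\<lambda>J. if resid J = js then f J else 0)"

text \<open>The opposite signs of the two tokens give y_1 = -x and y_2 = x at a double letter, the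
  action of the rank two nilHecke algebra on its coinvariants.\<close>

definition opY :: "nat \<Rightarrow> (int list \<Rightarrow> int set \<Rightarrow> 'k::field) \<Rightarrow> int list \<Rightarrow> int set \<Rightarrow> 'k" where
  "opY t f = (\<lambda>J. if entry J t = fst (run s0 (take (t - 1) J)) then - mulx (entry J t) (f J)
                  else mulx (entry J t) (f J))"

text \<open>The component at J comes from the word in which the letters t and t + 1 are exchanged
  back, hence the order of the arguments of \<open>cross\<close>.\<close>

definition opP :: "nat \<Rightarrow> (int list \<Rightarrow> int set \<Rightarrow> 'k::field) \<Rightarrow> int list \<Rightarrow> int set \<Rightarrow> 'k" where
  "opP t f = (\<lambda>J. cross (run s0 (take (t - 1) J)) (entry J (t + 1)) (entry J t) (f (swap_entries t J)))"

lemma opY_at: "opY (Suc (length u)) f (u @ a # w) =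
    (if a = fst (run s0 u) then - mulx a (f (u @ a # w)) else mulx a (f (u @ a # w)))"
  by (simp add: opY_def)

lemma opP_at: "opP (Suc (length u)) f (u @ b # a # w) = cross (run s0 u) a b (f (u @ a # b # w))"
  by (simp add: opP_def)

lemma words_length: "J \<in> words \<Longrightarrow> length J = k + r"
  using run_sum[of s0 J] by (auto simp: words_def)

lemma words_pair: "u @ a # b # w \<in> words \<longleftrightarrow>
    ok s0 u \<and> ok (run s0 u) [a, b] \<and> ok (step (step (run s0 u) a) b) w \<and>
    run (step (step (run s0 u) a) b) w = (i + int k, i + int r - 1)"
  by (auto simp: words_def)

lemma words_swap:
  assumes "u @ a # b # w \<in> words" "ok (run s0 u) [b, a]"
  shows "u @ b # a # w \<in> words"
  using assms step_swap[of "run s0 u" a b] run_ordered[of s0 u] unfolding words_pair by auto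

lemma words_ordered: "ok s0 u \<Longrightarrow> snd (run s0 u) \<le> fst (run s0 u)"
  using run_ordered[of s0 u] by simp

lemma space_zero: "f \<in> space \<Longrightarrow> J \<notin> words \<Longrightarrow> f J = 0" by (simp add: space_def)

lemma space_touch:
  "f \<in> space \<Longrightarrow> i - 1 \<le> c \<Longrightarrow> c + 1 < i + int k \<Longrightarrow> c + 1 \<notin> touch s0 J \<Longrightarrow> mulx c (f J) = mulx (c + 1) (f J)"
  by (simp add: space_def)

lemma space_eqI:
  "f \<in> space \<Longrightarrow> g \<in> space \<Longrightarrow> (\<And>J. J \<in> words \<Longrightarrow> f J = g J) \<Longrightarrow> f = g"
  by (rule ext) (metis space_zero)

lemma space_0 [simp]: "0 \<in> space" by (simp add: space_def)
lemma space_add: "f \<in> space \<Longrightarrow> g \<in> space \<Longrightarrow> f + g \<in> space" by (simp add: space_def)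
lemma space_diff: "f \<in> space \<Longrightarrow> g \<in> space \<Longrightarrow> f - g \<in> space" by (simp add: space_def)

lemma space_opE: "f \<in> space \<Longrightarrow> opE js f \<in> space" by (simp add: space_def opE_def)

lemma space_opY: "f \<in> space \<Longrightarrow> opY t f \<in> space"
  by (auto simp: space_def opY_def intro: mulx_eq_mulx)

lemma touch_pair: "touch s0 (u @ a # b # w) =
    touch s0 u \<union> collision (step (run s0 u) a) \<union> touch (step (step (run s0 u) a) b) w"
  using collision_in_touch[of "run s0 u" "[]"] by (cases u rule: rev_cases) (auto simp: collision_def)

text \<open>Exchanging two letters alters the run only in the state between them. A constraint is
  new at J only if in the other word the tokens meet there, at c + 1. In that case psi multiplies by
  x_c + x_{c+1}, and x_c and x_{c+1} multiply this to the same value because squares vanish.\<close>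

lemma space_opP:
  assumes f: "f \<in> space" and t: "1 \<le> t" "t < k + r"
  shows "opP t f \<in> space"
proof -
  have 1: "opP t f J = 0" if J: "J \<notin> words" for J
  proof (cases "swap_entries t J \<in> words")
    case False
    then show ?thesis using f by (simp add: opP_def space_zero)
  next
    case True
    then have "length J = k + r" using words_length by fastforce
    then obtain u b a w where J': "J = u @ b # a # w" "t = Suc (length u)"
      using split_at_pair[of t J] t by auto
    then have W: "u @ a # b # w \<in> words" using True by simp
    then have "\<not> ok (run s0 u) [b, a]" using words_swap J J' by blast
    then have "cross (run s0 u) a b (f (u @ a # b # w)) = 0"
      using W words_ordered by (intro cross_not_ok) (auto simp: words_pair)
    then show ?thesis using J' by (simp add: opP_at)
  qed
  have 2: "mulx c (opP t f J) = mulx (c + 1) (opP t f J)"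
    if c: "i - 1 \<le> c" "c + 1 < i + int k" "c + 1 \<notin> touch s0 J" for J c
  proof (cases "J \<in> words \<and> swap_entries t J \<in> words")
    case False
    then show ?thesis using f 1 by (auto simp: opP_def space_zero)
  next
    case True
    then have "length J = k + r" using words_length by blast
    then obtain u b a w where J': "J = u @ b # a # w" "t = Suc (length u)"
      using split_at_pair[of t J] t by auto
    let ?S = "run s0 u" and ?g = "f (u @ a # b # w)"
    have W: "u @ a # b # w \<in> words" "u @ b # a # w \<in> words" using True J' by simp_all
    have S: "snd ?S \<le> fst ?S" using W words_ordered by (auto simp: words_pair)
    have o: "ok ?S [a, b]" "ok ?S [b, a]" using W by (auto simp: words_pair)
    have C: "c + 1 \<notin> touch s0 u" "c + 1 \<notin> collision ?S" "c + 1 \<notin> collision (step ?S b)" "c + 1 \<notin> touch (step (step ?S a) b) w"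
      using c(3) step_swap[OF S o] collision_run[of s0 u] unfolding J' touch_pair by auto
    have *: "c + 1 \<notin> collision (step ?S a) \<Longrightarrow> mulx c ?g = mulx (c + 1) ?g"
      using C c(1,2) by (intro space_touch[OF f]) (auto simp: touch_pair)
    have "mulx c (cross ?S a b ?g) = mulx (c + 1) (cross ?S a b ?g)"
    proof (cases "a = b")
      case True
      then have "?S = (a, a)" using S o by (cases ?S) (auto split: if_splits)
      \<comment> \<open>Both tokens are at a before the pair and at a + 1 after it. As c + 1 is no
        meeting point, neither x_c nor x_{c+1} is x_a, so both commute with d/dx_a.\<close>
      then have "c + 1 \<noteq> a" "c \<noteq> a" using C True collision_in_touch[of "(a+1,a+1)" w]
        using collision_in_touch[of s0 u] touch_append[of s0 u "[]"] by (auto simp: collision_def)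
      moreover have "c + 1 \<notin> collision (step ?S a)" using C True by simp
      ultimately show ?thesis using True * by (simp add: cross_mulx[symmetric])
    next
      case False
      show ?thesis
      proof (cases "c + 1 \<in> collision (step ?S a)")
        case False
        then show ?thesis using * \<open>a \<noteq> b\<close> by (simp add: cross_mulx[symmetric])
      next
        case True
        then have "b = c + 1 \<and> a = c \<and> ?S = (c + 1, c)" using S o \<open>a \<noteq> b\<close>
          by (cases ?S) (auto simp: collision_def split: if_splits)
        then show ?thesis by (simp add: cross_def mulx_commute)
      qed
    qed
    then show ?thesis using J' by (simp add: opP_at)
  qed
  show ?thesis using 1 2 by (simp add: space_def)
qed

end

section \<open>The relations on the configuration space\<close>

context two_tokens begin

lemma window:
  assumes "u @ a # w \<in> words"
  shows "i - 1 \<le> a" "a < i + int k"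
  using letter_bounds[of s0 "u @ a # w" a] assms by (auto simp: words_def)

lemma mod_eq_iff: 
  assumes "i - 1 \<le> a" "a < i + int k" "i - 1 \<le> b" "b < i + int k"
  shows "a mod int e = b mod int e \<longleftrightarrow> a = b"
proof (cases "e = 0")
  case False
  have "a mod int e = b mod int e \<longleftrightarrow> int e dvd (a - b)" by (simp add: mod_eq_dvd_iff)
  moreover have "int e dvd (a - b) \<longleftrightarrow> a = b"
    using assms False e_large zdvd_imp_le[of "int e" "a - b"] zdvd_imp_le[of "int e" "b - a"]
    by (cases a b rule: linorder_cases) (auto simp: dvd_diff_commute)
  ultimately show ?thesis by simp
qed simp

lemma mod_in_vertices: "a mod int e \<in> vertices e"
  by (auto simp: vertices_def)

lemma arrow_mod_iff:
  assumes "i - 1 \<le> a" "a < i + int k" "i - 1 \<le> b" "b < i + int k"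
  shows "arrow e (a mod int e) (b mod int e) \<longleftrightarrow> b = a + 1"
proof (cases "e = 0")
  case False
  have "arrow e (a mod int e) (b mod int e) \<longleftrightarrow> b mod int e = (a + 1) mod int e"
    by (simp add: arrow_def mod_in_vertices mod_simps)
  also have "\<dots> \<longleftrightarrow> int e dvd (b - (a + 1))" by (simp add: mod_eq_dvd_iff)
  also have "\<dots> \<longleftrightarrow> b = a + 1"
    using assms False e_large zdvd_imp_le[of "int e" "b - (a + 1)"] zdvd_imp_le[of "int e" "a + 1 - b"]
    by (cases b "a + 1" rule: linorder_cases) (auto simp: dvd_diff_commute)
  finally show ?thesis .
qed (simp add: arrow_def vertices_def)

lemma resid_simps [simp]: "resid [] = []" "resid (a # w) = (a mod int e) # resid w" "resid (u @ w) = resid u @ resid w"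
  "length (resid w) = length w"
  by (simp_all add: resid_def)

lemma entry_resid [simp]:
  "entry (resid u @ a # w) (Suc (length u)) = a"
  "entry (resid u @ a # b # w) (Suc (Suc (length u))) = b"
  "entry (resid u @ a # b # c # w) (Suc (Suc (Suc (length u)))) = c"
  using entry_append[of "resid u"] by simp_all

lemma swap_resid [simp]:
  "swap_entries (Suc (length u)) (resid u @ a # b # w) = resid u @ b # a # w"
  using swap_entries_append[of "resid u"] by simp

lemma resid_swap: "1 \<le> t \<Longrightarrow> t < length J \<Longrightarrow> resid (swap_entries t J) = swap_entries t (resid J)"
  using split_at_pair[of t J] by auto

lemma swap_swap: "1 \<le> t \<Longrightarrow> t < length J \<Longrightarrow> swap_entries t (swap_entries t J) = J"
  using split_at_pair[of t J] by auto

lemma opE_idem: "opE js (opE ks f) = (if js = ks then opE js f else 0)"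
  by (auto simp: opE_def fun_eq_iff)

lemma opY_opE: "opY t (opE js f) = opE js (opY t f)"
  by (auto simp: opE_def opY_def fun_eq_iff)

lemma opP_opE:
  assumes "f \<in> space" "1 \<le> t" "t < k + r" "length js = k + r"
  shows "opP t (opE js f) = opE (swap_entries t js) (opP t f)"
proof
  fix J
  show "opP t (opE js f) J = opE (swap_entries t js) (opP t f) J"
  proof (cases "length J = k + r")
    case True
    then have "resid (swap_entries t J) = js \<longleftrightarrow> resid J = swap_entries t js"
      using assms swap_swap[of t js] swap_swap[of t "resid J"] resid_swap[of t J] by auto
    then show ?thesis by (auto simp: opE_def opP_def)
  next
    case False
    then have "J \<notin> words" "swap_entries t J \<notin> words" using words_length by fastforce+
    then show ?thesis using assms by (auto simp: opE_def opP_def space_zero)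
  qed
qed

lemma opY_opY: "opY s (opY t f) = opY t (opY s f)"
  by (auto simp: opY_def fun_eq_iff[where f = "opY s _"] mulx_commute)

lemma words_pairE:
  assumes "J \<in> words" "1 \<le> t" "t < k + r"
  obtains u a b w where "J = u @ a # b # w" "t = Suc (length u)"
  using split_at_pair[of t J] words_length assms by metis

lemma words_letterE:
  assumes "J \<in> words" "1 \<le> t" "t \<le> k + r"
  obtains u a w where "J = u @ a # w" "t = Suc (length u)"
  using split_at_letter[of t J] words_length assms by metis

lemma words_double:
  assumes "u @ a # a # w \<in> words"
  shows "a \<notin> set u" "a \<notin> set w"
  using double_letter[of s0 u a w] assms by (auto simp: words_def)

lemma opY_value:
  assumes "t = Suc (length u)"
  shows "opY t f (u @ a # w) = (if a = fst (run s0 u) then - mulx a (f (u @ a # w)) else mulx a (f (u @ a # w)))"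
  using assms by (simp add: opY_at)

text \<open>\<open>cross\<close> can fail to commute with a multiplication only where it
  differentiates, at a double letter a. By \<open>words_double\<close> no other letter of such a
  word is a.\<close>

lemma opP_opY_far:
  fixes f :: "int list \<Rightarrow> int set \<Rightarrow> 'k::field"
  assumes f: "f \<in> space" and t: "1 \<le> t" "t < k + r" and s: "1 \<le> s" "s \<le> k + r" "s \<noteq> t" "s \<noteq> t + 1"
  shows "opP t (opY s f) = opY s (opP t f)"
proof (rule space_eqI)
  show "opP t (opY s f) \<in> space" "opY s (opP t f) \<in> space"
    using f t by (simp_all add: space_opP space_opY)
  fix J assume J: "J \<in> words"
  then obtain u b a w where J': "J = u @ b # a # w" and t': "t = Suc (length u)"
    using words_pairE t by metis
  show "opP t (opY s f) J = opY s (opP t f) J"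
  proof (cases "u @ a # b # w \<in> words")
    case False
    then show ?thesis using f space_opY[OF f, of s]
      unfolding J' t' opY_def[of s "opP _ _"] by (simp add: opP_at space_zero)
  next
    case True
    let ?S = "run s0 u"
    have S: "snd ?S \<le> fst ?S" using True words_ordered by (auto simp: words_pair)
    have o: "ok ?S [a, b]" "ok ?S [b, a]" using True J J' by (auto simp: words_pair)
    show ?thesis
    proof (cases "s < t")
      case True
      then obtain u1 c u2 where u: "u = u1 @ c # u2" "s = Suc (length u1)"
        using split_at_letter[of s u] s t' by auto
      have c: "a \<noteq> b \<or> c \<noteq> a" using words_double[of u a w] \<open>u @ a # b # w \<in> words\<close> u by auto
      define B where "B \<longleftrightarrow> c = fst (run s0 u1)"
      have "opY s g (u @ v) = (if B then - mulx c (g (u @ v)) else mulx c (g (u @ v)))"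
        for g :: "int list \<Rightarrow> int set \<Rightarrow> 'k" and v using opY_at[of u1 g c "u2 @ v"] u by (simp add: B_def)
      then show ?thesis using c by (simp add: J' t' opP_at cross_mulx)
    next
      case False
      then have "1 \<le> s - t - 1" "s - t - 1 \<le> length w" using s t' J' words_length[OF J] by auto
      then obtain w1 c w2 where w: "w = w1 @ c # w2" "s - t - 1 = Suc (length w1)"
        using split_at_letter[of "s - t - 1" w] by auto
      have s': "s = Suc (length (u @ a # b # w1))" "s = Suc (length (u @ b # a # w1))" using w t' False s by auto
      have c: "a \<noteq> b \<or> c \<noteq> a" using words_double[of u a w] \<open>u @ a # b # w \<in> words\<close> w by auto
      define B where "B \<longleftrightarrow> c = fst (run s0 (u @ a # b # w1))"
      have "opY s f (u @ a # b # w) = (if B then - mulx c (f (u @ a # b # w)) else mulx c (f (u @ a # b # w)))"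
        using opY_value[OF s'(1), of f c w2] by (simp add: w B_def del: step.simps)
      moreover have "opY s (opP t f) (u @ b # a # w) =
          (if B then - mulx c (opP t f (u @ b # a # w)) else mulx c (opP t f (u @ b # a # w)))"
        using opY_value[OF s'(2), of "opP t f" c w2] by (simp add: w B_def step_swap[OF S o] del: step.simps)
      ultimately show ?thesis using c by (simp add: J' t' opP_at cross_mulx)
    qed
  qed
qed

lemma opP_opP_far':
  assumes f: "f \<in> space" and t: "1 \<le> t" "s < k + r" "t + 1 < s"
  shows "opP t (opP s f) = opP s (opP t f)"
proof (rule space_eqI)
  show "opP t (opP s f) \<in> space" "opP s (opP t f) \<in> space"
    using f t by (simp_all add: space_opP)
  fix J assume J: "J \<in> words"
  then obtain u b a w where J': "J = u @ b # a # w" and t': "t = Suc (length u)"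
    using words_pairE[of J t] t by (metis add_lessD1 less_trans)
  then have "1 \<le> s - t - 1" "s - t - 1 < length w" using t t' J' words_length[OF J] by auto
  then obtain w1 d c w2 where w: "w = w1 @ d # c # w2" "s - t - 1 = Suc (length w1)"
    using split_at_pair[of "s - t - 1" w] by auto
  have s': "s = Suc (length (u @ a # b # w1))" "s = Suc (length (u @ b # a # w1))" using w t' t by auto
  let ?S = "run s0 u" and ?F = "f (u @ a # b # w1 @ c # d # w2)"
  have L: "opP t (opP s f) J = cross ?S a b (cross (run (step (step ?S a) b) w1) c d ?F)"
    unfolding J' t' opP_at w(1) using opP_at[of "u @ a # b # w1" f d c w2] s' by simp
  have R: "opP s (opP t f) J = cross (run (step (step ?S b) a) w1) c d (cross ?S a b ?F)"
    unfolding J' w(1) using opP_at[of "u @ b # a # w1" "opP t f" d c w2] s' t' opP_at[of u f b a "w1 @ c # d # w2"]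
    by simp
  show "opP t (opP s f) J = opP s (opP t f) J"
  proof (cases "u @ a # b # w1 @ c # d # w2 \<in> words")
    case False
    then have "?F = 0" using f space_zero by blast
    then show ?thesis unfolding L R by simp
  next
    case W: True
    have S: "snd ?S \<le> fst ?S" using W words_ordered by (auto simp: words_pair)
    have o: "ok ?S [a, b]" using W by (auto simp: words_pair)
    have "a = b \<Longrightarrow> a \<noteq> c \<and> a \<noteq> d" using words_double(2)[of u a "w1 @ c # d # w2"] W by auto
    moreover have "c = d \<Longrightarrow> c \<noteq> a \<and> c \<noteq> b" using words_double(1)[of "u @ a # b # w1" c w2] W by auto
    ultimately have C: "cross ?S a b (cross s' c d ?F) = cross s' c d (cross ?S a b ?F)" for s'
      by (intro cross_commute) auto
    show ?thesis
    proof (cases "ok ?S [b, a]")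
      case True
      then show ?thesis unfolding L R by (simp only: C step_swap[OF S o True])
    next
      case False
      then show ?thesis unfolding L R by (simp only: C cross_not_ok[OF o S False] cross_zero)
    qed
  qed
qed

lemma opP_opP_far:
  assumes f: "f \<in> space" and "1 \<le> t" "t < k + r" "1 \<le> s" "s < k + r" "t + 1 < s \<or> s + 1 < t"
  shows "opP t (opP s f) = opP s (opP t f)"
  using opP_opP_far'[OF f, of t s] opP_opP_far'[OF f, of s t] assms by auto

end

definition sgnx :: "int \<times> int \<Rightarrow> int \<Rightarrow> (int set \<Rightarrow> 'k::field) \<Rightarrow> int set \<Rightarrow> 'k" where
  "sgnx s c g = (if c = fst s then - mulx c g else mulx c g)"

lemma sgnx_zero [simp]: "sgnx s c 0 = 0" by (simp add: sgnx_def)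

lemma cross_sgnx:
  assumes "ok (p, q) [a, b]" "q \<le> p"
  shows "cross (p, q) a b (sgnx (step (p, q) a) b g) = sgnx (p, q) b (cross (p, q) a b g) + (if a = b then g else 0)"
proof -
  have "a = p \<and> b = p + 1 \<or> a = p \<and> b = q \<or> q < p \<and> a = q \<and> b = p \<or> q < p \<and> a = q \<and> b = q + 1"
    using assms by (auto split: if_splits)
  then show ?thesis using assms(2)
    by (elim disjE conjE; cases "p = q"; cases "p = q + 1"; 
        simp add: cross_def sgnx_def dx_mulx_same mulx_commute[of "q + 1" q])
qed

lemma sgnx_cross:
  assumes "ok (p, q) [a, b]" "q \<le> p"
  shows "sgnx (step (p, q) b) a (cross (p, q) a b g) = cross (p, q) a b (sgnx (p, q) a g) + (if a = b then g else 0)"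
proof -
  have "a = p \<and> b = p + 1 \<or> a = p \<and> b = q \<or> q < p \<and> a = q \<and> b = p \<or> q < p \<and> a = q \<and> b = q + 1"
    using assms by (auto split: if_splits)
  then show ?thesis using assms(2)
    by (elim disjE conjE; cases "p = q"; cases "p = q + 1"; 
        simp add: cross_def sgnx_def dx_mulx_same mulx_commute[of "q + 1" q])
qed

lemma cross_cross:
  assumes "ok (p, q) [a, b]" "q \<le> p" and "b = a + 1 \<Longrightarrow> (p, q) \<noteq> (a + 1, a) \<Longrightarrow> mulx a g = mulx b g"
  shows "cross (p, q) b a (cross (p, q) a b g) =
    (if a = b then 0
     else if b = a + 1 then sgnx (step (p, q) a) b g - sgnx (p, q) a g
     else if a = b + 1 then sgnx (p, q) a g - sgnx (step (p, q) a) b g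
     else g)"
proof -
  have "a = p \<and> b = p + 1 \<or> a = p \<and> b = q \<or> q < p \<and> a = q \<and> b = p \<or> q < p \<and> a = q \<and> b = q + 1"
    using assms by (auto split: if_splits)
  then show ?thesis using assms(2,3)
    by (elim disjE conjE; cases "p = q"; cases "p = q + 1"; 
        simp add: cross_def sgnx_def dx_mulx_same mulx_commute[of "q + 1" q])
qed

context two_tokens begin

lemma opY_sgnx: "opY (Suc (length u)) f (u @ a # w) = sgnx (run s0 u) a (f (u @ a # w))"
  by (simp add: opY_at sgnx_def)

lemma opY_sgnx2: "opY (Suc (Suc (length u))) f (u @ a # b # w) = sgnx (step (run s0 u) a) b (f (u @ a # b # w))"
  using opY_sgnx[of "u @ [a]"] by simp

lemma opP_at2: "opP (Suc (Suc (length u))) f (u @ c # b # a # w) = cross (step (run s0 u) c) a b (f (u @ c # a # b # w))"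
  using opP_at[of "u @ [c]"] by simp

text \<open>For an identity between components that holds at 0 it suffices to look at words in
  \<open>words\<close>, where the state is ordered and both letters are legal moves. The predicate
  \<open>P\<close> takes the state as an argument so that it can be named by its two
  coordinates.\<close>

lemma swapped_in_words:
  assumes "f \<in> space"
    "\<And>p q. u @ a # b # w \<in> words \<Longrightarrow> run s0 u = (p, q) \<Longrightarrow> q \<le> p \<Longrightarrow> ok (p, q) [a, b] \<Longrightarrow> P (p, q) (f (u @ a # b # w))"
    "\<And>s. P s 0"
  shows "P (run s0 u) (f (u @ a # b # w))"
proof (cases "u @ a # b # w \<in> words")
  case True
  moreover obtain p q where "run s0 u = (p, q)" by fastforce
  ultimately show ?thesis using assms(2)[of p q] words_ordered[of u] by (simp add: words_pair)
next
  case False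
  from space_zero[OF assms(1) this] show ?thesis using assms(3) by (simp only:)
qed

lemma delta_eq:
  assumes "f \<in> space" "length js = k + r"
  shows "(if entry js (Suc (length u)) = entry js (Suc (Suc (length u))) then opE js f (u @ b # a # w) else 0) =
    (if a = b then opE js f (u @ b # a # w) else 0)"
proof (cases "u @ b # a # w \<in> words \<and> resid (u @ b # a # w) = js")
  case True
  then have "a mod int e = b mod int e \<longleftrightarrow> a = b"
    using window[of u b "a # w"] window[of "u @ [b]" a w] by (intro mod_eq_iff) auto
  then show ?thesis using True by auto
next
  case False
  then show ?thesis using assms by (auto simp: opE_def space_zero)
qed

lemma opP_opY:
  assumes f: "f \<in> space" and t: "1 \<le> t" "t < k + r" and js: "length js = k + r"
  shows "opP t (opY (t + 1) (opE js f)) =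
     opY t (opP t (opE js f)) + (if entry js t = entry js (t + 1) then opE js f else 0)"
proof (rule space_eqI)
  let ?g = "opE js f"
  have g: "?g \<in> space" using f by (rule space_opE)
  show "opP t (opY (t + 1) ?g) \<in> space" "opY t (opP t ?g) + (if entry js t = entry js (t + 1) then ?g else 0) \<in> space"
    using g t by (auto intro!: space_opP space_opY space_add)
  fix J assume "J \<in> words"
  then obtain u b a w where J: "J = u @ b # a # w" and t': "t = Suc (length u)"
    using words_pairE t by metis
  have "cross (run s0 u) a b (sgnx (step (run s0 u) a) b (?g (u @ a # b # w))) =
      sgnx (run s0 u) b (cross (run s0 u) a b (?g (u @ a # b # w))) + (if a = b then ?g (u @ a # b # w) else 0)"
    by (rule swapped_in_words[OF g, where P = "\<lambda>s h. cross s a b (sgnx (step s a) b h) =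
          sgnx s b (cross s a b h) + (if a = b then h else 0)"]) (simp_all add: cross_sgnx del: step.simps)
  moreover have "(if entry js t = entry js (t + 1) then ?g else 0) J = (if a = b then ?g (u @ a # b # w) else 0)"
    using delta_eq[OF f js, of u b a w] unfolding J t' by (auto split: if_splits)
  ultimately show "opP t (opY (t + 1) ?g) J =
      (opY t (opP t ?g) + (if entry js t = entry js (t + 1) then ?g else 0)) J"
    by (simp add: J t' opP_at opY_sgnx opY_sgnx2 del: step.simps)
qed

lemma opY_opP:
  assumes f: "f \<in> space" and t: "1 \<le> t" "t < k + r" and js: "length js = k + r"
  shows "opY (t + 1) (opP t (opE js f)) =
     opP t (opY t (opE js f)) + (if entry js t = entry js (t + 1) then opE js f else 0)"
proof (rule space_eqI)
  let ?g = "opE js f"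
  have g: "?g \<in> space" using f by (rule space_opE)
  show "opY (t + 1) (opP t ?g) \<in> space" "opP t (opY t ?g) + (if entry js t = entry js (t + 1) then ?g else 0) \<in> space"
    using g t by (auto intro!: space_opP space_opY space_add)
  fix J assume "J \<in> words"
  then obtain u b a w where J: "J = u @ b # a # w" and t': "t = Suc (length u)"
    using words_pairE t by metis
  have "sgnx (step (run s0 u) b) a (cross (run s0 u) a b (?g (u @ a # b # w))) =
      cross (run s0 u) a b (sgnx (run s0 u) a (?g (u @ a # b # w))) + (if a = b then ?g (u @ a # b # w) else 0)"
    by (rule swapped_in_words[OF g, where P = "\<lambda>s h. sgnx (step s b) a (cross s a b h) =
          cross s a b (sgnx s a h) + (if a = b then h else 0)"]) (simp_all add: sgnx_cross del: step.simps)
  moreover have "(if entry js t = entry js (t + 1) then ?g else 0) J = (if a = b then ?g (u @ a # b # w) else 0)"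
    using delta_eq[OF f js, of u b a w] unfolding J t' by (auto split: if_splits)
  ultimately show "opY (t + 1) (opP t ?g) J =
      (opP t (opY t ?g) + (if entry js t = entry js (t + 1) then ?g else 0)) J"
    by (simp add: J t' opP_at opY_sgnx opY_sgnx2 del: step.simps)
qed

text \<open>Before \<open>v\<close> the trailing token has not reached c, and after \<open>v\<close>
  the leading one is past it, so only \<open>v\<close> itself leaves time for a meeting at
  c.\<close>

lemma not_touching:
  assumes "u @ v @ w \<in> words" "snd (run s0 u) < c" "c < fst (run s0 (u @ v))" "c \<notin> touch (run s0 u) v"
  shows "c \<notin> touch s0 (u @ v @ w)"
proof -
  have o: "ok s0 u" "ok s0 (u @ v)" "ok (run s0 (u @ v)) w" using assms(1) by (auto simp: words_def)
  have "c \<notin> touch s0 u" using touch_bounds[OF o(1), of c] assms(2) by auto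
  moreover have "c \<notin> touch (run s0 (u @ v)) w"
    using touch_bounds[OF o(3) words_ordered[OF o(2)], of c] assms(3) by auto
  ultimately show ?thesis using assms(4) by auto
qed

text \<open>One token makes both moves and passes a + 1 while the other is strictly behind or
  strictly ahead. This supplies the hypothesis of \<open>cross_cross\<close>.\<close>

lemma ascent_mulx:
  assumes f: "f \<in> space" and J: "u @ a # b # w \<in> words" and "b = a + 1" "run s0 u \<noteq> (a + 1, a)"
  shows "mulx a (f (u @ a # b # w)) = mulx b (f (u @ a # b # w))"
proof -
  obtain p q where S: "run s0 u = (p, q)" by fastforce
  have o: "q \<le> p" "ok (p, q) [a, b]" using J S words_ordered[of u] by (auto simp: words_pair)
  have "a + 1 \<notin> touch s0 (u @ [a, b] @ w)"
    using J S o assms(3,4) by (intro not_touching) (auto simp: collision_def split: if_splits)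
  moreover have "i - 1 \<le> a" "a + 1 < i + int k"
    using window[of u a "b # w"] window[of "u @ [a]" b w] J assms(3) by auto
  ultimately show ?thesis using space_touch[OF f, of a] assms(3) by auto
qed

lemma opP_opP:
  assumes f: "f \<in> space" and t: "1 \<le> t" "t < k + r" and js: "length js = k + r"
  shows "opP t (opP t (opE js f)) =
     (if entry js t = entry js (t + 1) then 0
      else if arrow e (entry js t) (entry js (t + 1)) then opY (t + 1) (opE js f) - opY t (opE js f)
      else if arrow e (entry js (t + 1)) (entry js t) then opY t (opE js f) - opY (t + 1) (opE js f)
      else opE js f)" (is "_ = ?R")
proof (rule space_eqI)
  let ?g = "opE js f"
  have g: "?g \<in> space" using f by (rule space_opE)
  show "opP t (opP t ?g) \<in> space" "?R \<in> space"
    using g t by (auto intro!: space_opP space_opY space_diff)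
  fix J assume W: "J \<in> words"
  then obtain u a b w where J: "J = u @ a # b # w" and t': "t = Suc (length u)"
    using words_pairE t by metis
  obtain p q where S: "run s0 u = (p, q)" by fastforce
  have o: "q \<le> p" "ok (p, q) [a, b]" using W J S words_ordered[of u] by (auto simp: words_pair)
  have win: "i - 1 \<le> a" "a < i + int k" "i - 1 \<le> b" "b < i + int k"
    using window[of u a "b # w"] window[of "u @ [a]" b w] W J by auto
  have "cross (p, q) b a (cross (p, q) a b (?g J)) =
    (if a = b then 0
     else if b = a + 1 then sgnx (step (p, q) a) b (?g J) - sgnx (p, q) a (?g J)
     else if a = b + 1 then sgnx (p, q) a (?g J) - sgnx (step (p, q) a) b (?g J)
     else ?g J)"
    using ascent_mulx[OF g W[unfolded J]] J S by (intro cross_cross[OF o(2,1)]) auto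
  also have "\<dots> = ?R J"
  proof (cases "resid J = js")
    case True
    have "entry js t = a mod int e" "entry js (t + 1) = b mod int e" using True t' J by auto
    then show ?thesis using win S
      by (simp add: mod_eq_iff arrow_mod_iff J t' opY_sgnx opY_sgnx2 del: step.simps)
  next
    case False
    then have 0: "?g J = 0" by (simp add: opE_def)
    then have "opY t ?g J = 0" "opY (t + 1) ?g J = 0" by (simp_all add: opY_def)
    then show ?thesis by (simp add: 0)
  qed
  finally show "opP t (opP t ?g) J = ?R J" using S by (simp add: J t' opP_at)
qed

text \<open>The pattern a, b, a fixes the state: (a, a) if b = a + 1 and (a, a - 1) if b = a - 1. In
  both cases the leader has left the point between the two edges when the other token arrives, so no
  meeting lifts the constraint.\<close>

lemma braid_mulx:
  assumes f: "f \<in> space" and J: "u @ a # b # a # w \<in> words"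
  shows "b = a + 1 \<Longrightarrow> mulx a (f (u @ a # b # a # w)) = mulx b (f (u @ a # b # a # w))"
    "b = a - 1 \<Longrightarrow> mulx b (f (u @ a # b # a # w)) = mulx a (f (u @ a # b # a # w))"
proof -
  obtain p q where S: "run s0 u = (p, q)" by fastforce
  have o: "q \<le> p" "ok (p, q) [a, b, a]" using J S words_ordered[of u] by (auto simp: words_def)
  have win: "i - 1 \<le> a" "a < i + int k" "i - 1 \<le> b" "b < i + int k"
    using window[of u a "b # a # w"] window[of "u @ [a]" b "a # w"] J by auto
  { assume b: "b = a + 1"
    then have "p = a" "q = a" using o by (auto split: if_splits)
    then have "a + 1 \<notin> touch s0 (u @ [a, b, a] @ w)"
      using J S b by (intro not_touching) (auto simp: collision_def)
    then show "mulx a (f (u @ a # b # a # w)) = mulx b (f (u @ a # b # a # w))"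
      using space_touch[OF f, of a] win b by auto }
  { assume b: "b = a - 1"
    then have "p = a" "q = a - 1" using o by (auto split: if_splits)
    then have "b + 1 \<notin> touch s0 (u @ [a, b, a] @ w)"
      using J S b by (intro not_touching) (auto simp: collision_def)
    then show "mulx b (f (u @ a # b # a # w)) = mulx a (f (u @ a # b # a # w))"
      using space_touch[OF f, of b] win b by auto }
qed

lemma opP_braid:
  assumes f: "f \<in> space" and t: "1 \<le> t" "t + 1 < k + r" and js: "length js = k + r"
  shows "opP t (opP (t + 1) (opP t (opE js f))) = opP (t + 1) (opP t (opP (t + 1) (opE js f))) +
     (if entry js t = entry js (t + 2) \<and> arrow e (entry js t) (entry js (t + 1)) then opE js f
      else if entry js t = entry js (t + 2) \<and> arrow e (entry js (t + 1)) (entry js t) then - opE js f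
      else 0)" (is "_ = _ + ?R")
proof (rule space_eqI)
  let ?g = "opE js f"
  have g: "?g \<in> space" using f by (rule space_opE)
  show "opP t (opP (t + 1) (opP t ?g)) \<in> space" "opP (t + 1) (opP t (opP (t + 1) ?g)) + ?R \<in> space"
    using g t by (auto intro!: space_opP space_add space_diff)
  fix J assume W: "J \<in> words"
  then have "t < length J" using words_length t by auto
  then obtain u c b w' where "J = u @ c # b # w'" and t': "t = Suc (length u)"
    using split_at_pair[of t J] t by auto
  moreover then obtain a w where "w' = a # w" using words_length[OF W] t by (cases w') auto
  ultimately have J: "J = u @ c # b # a # w" by simp
  let ?J = "u @ a # b # c # w" and ?S = "run s0 u"
  have L: "opP t (opP (t + 1) (opP t ?g)) J = cross ?S b c (cross (step ?S b) a c (cross ?S a b (?g ?J)))"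
    by (simp add: J t' opP_at opP_at2 del: step.simps)
  have R: "opP (t + 1) (opP t (opP (t + 1) ?g)) J = cross (step ?S c) a b (cross ?S a c (cross (step ?S a) b c (?g ?J)))"
    by (simp add: J t' opP_at opP_at2 del: step.simps)
  have D: "?R J = (if a = c \<and> b = a + 1 then ?g ?J else if a = c \<and> b = a - 1 then - ?g ?J else 0)"
  proof (cases "resid J = js")
    case True
    have win: "i - 1 \<le> a" "a < i + int k" "i - 1 \<le> b" "b < i + int k" "i - 1 \<le> c" "c < i + int k"
      using window[of u c "b # a # w"] window[of "u @ [c]" b "a # w"] window[of "u @ [c, b]" a w] W J by auto
    have "entry js t = c mod int e" "entry js (t + 1) = b mod int e" "entry js (t + 2) = a mod int e"
      using True t' J by auto
    then show ?thesis using win by (auto simp: mod_eq_iff arrow_mod_iff J)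
  next
    case False
    then show ?thesis by (auto simp: opE_def J)
  qed
  have "cross ?S b c (cross (step ?S b) a c (cross ?S a b (?g ?J))) =
      cross (step ?S c) a b (cross ?S a c (cross (step ?S a) b c (?g ?J))) +
      (if a = c \<and> b = a + 1 then ?g ?J else if a = c \<and> b = a - 1 then - ?g ?J else 0)"
  proof (cases "?J \<in> words")
    case False
    then have "?g ?J = 0" using g space_zero by blast
    then show ?thesis by (simp only: cross_zero) simp
  next
    case True
    obtain p q where S: "?S = (p, q)" by fastforce
    have o: "q \<le> p" "ok (p, q) [a, b, c]" using True S words_ordered[of u] by (auto simp: words_def)
    show ?thesis unfolding S using braid_mulx[OF g, of u a b w] True
      by (intro cross_braid[OF o(2,1)]) auto
  qed
  then show "opP t (opP (t + 1) (opP t ?g)) J = (opP (t + 1) (opP t (opP (t + 1) ?g)) + ?R) J"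
    using L R D by simp
qed

end

section \<open>Linear actions of a free algebra\<close>

lemma poly_mapping_sum_single:
  "p = (\<Sum>w\<in>Poly_Mapping.keys p. Poly_Mapping.single w (Poly_Mapping.lookup p w))"
  by (rule poly_mapping_eqI)
    (auto simp: lookup_sum lookup_single when_def in_keys_iff sum.delta' if_distrib cong: if_cong)

lemma free_algebra_induct [consumes 1, case_names zero add single]:
  assumes "p \<in> carrier (free_algebra G)" and "P 0"
    and add: "\<And>p q. p \<in> carrier (free_algebra G) \<Longrightarrow> q \<in> carrier (free_algebra G) \<Longrightarrow> P p \<Longrightarrow> P q \<Longrightarrow> P (p + q)"
    and single: "\<And>w a. set (letters w) \<subseteq> G \<Longrightarrow> P (Poly_Mapping.single w a)"
  shows "P (p :: 'g word \<Rightarrow>\<^sub>0 'k::field)"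
proof -
  have "A \<subseteq> Poly_Mapping.keys p \<Longrightarrow>
      (\<Sum>w\<in>A. Poly_Mapping.single w (Poly_Mapping.lookup p w)) \<in> carrier (free_algebra G) \<and>
      P (\<Sum>w\<in>A. Poly_Mapping.single w (Poly_Mapping.lookup p w))" if "finite A" for A
    using that
  proof (induction A)
    case empty
    then show ?case using assms by (simp add: free_algebra_zero)
  next
    case (insert w A)
    then have w: "set (letters w) \<subseteq> G" using assms(1) by (auto simp: free_algebra_mem_iff)
    have "Poly_Mapping.single w (Poly_Mapping.lookup p w) \<in> carrier (free_algebra G)"
      using w by (auto simp: free_algebra_mem_iff)
    then show ?case using insert w by (auto intro!: free_algebra_add_closed add single)
  qed
  from this[of "Poly_Mapping.keys p"] show ?thesis by (simp flip: poly_mapping_sum_single)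
qed

definition scl :: "'k::field \<Rightarrow> ('a \<Rightarrow> 'b \<Rightarrow> 'k) \<Rightarrow> 'a \<Rightarrow> 'b \<Rightarrow> 'k" where
  "scl a f = (\<lambda>J Y. a * f J Y)"

lemma scl_simps [simp]: "scl 0 f = 0" "scl 1 f = f" "scl a 0 = 0" "scl a (scl b f) = scl (a * b) f"
  "scl a (f + g) = scl a f + scl a g" "scl (- a) f = - scl a f" "scl a (- f) = - scl a f"
  by (auto simp: scl_def fun_eq_iff algebra_simps)

lemma scl_add: "scl (a + b) f = scl a f + scl b f"
  by (auto simp: scl_def fun_eq_iff algebra_simps)

lemma scl_sum: "scl a (sum f A) = (\<Sum>x\<in>A. scl a (f x))"
  by (induction A rule: infinite_finite_induct) (simp_all only: sum.infinite sum.empty sum.insert scl_simps not_False_eq_True)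

locale free_action =
  fixes oper :: "'g \<Rightarrow> ('a \<Rightarrow> 'b \<Rightarrow> 'k::field) \<Rightarrow> 'a \<Rightarrow> 'b \<Rightarrow> 'k"
  assumes oper_add: "oper g (f + h) = oper g f + oper g h"
    and oper_scl: "oper g (scl a f) = scl a (oper g f)"
begin

definition act :: "('g word \<Rightarrow>\<^sub>0 'k) \<Rightarrow> ('a \<Rightarrow> 'b \<Rightarrow> 'k) \<Rightarrow> 'a \<Rightarrow> 'b \<Rightarrow> 'k" where
  "act p f = (\<Sum>w\<in>Poly_Mapping.keys p. scl (Poly_Mapping.lookup p w) (foldr oper (letters w) f))"

lemma act_zero [simp]: "act 0 f = 0" by (simp add: act_def)

lemma act_add: "act (p + q) f = act p f + act q f"
  unfolding act_def
  by (rule setsum_keys_plus_distrib[where f = "\<lambda>w a. scl a (foldr oper (letters w) f)"]) (simp_all only: scl_add scl_simps)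

lemma act_single: "act (Poly_Mapping.single w a) f = scl a (foldr oper (letters w) f)"
  by (simp add: act_def)

lemma foldr_oper_add: "foldr oper ls (f + h) = foldr oper ls f + foldr oper ls h"
  by (induction ls) (simp_all only: foldr_Cons foldr_Nil o_apply id_apply oper_add)

lemma foldr_oper_scl: "foldr oper ls (scl a f) = scl a (foldr oper ls f)"
  by (induction ls) (simp_all only: foldr_Cons foldr_Nil o_apply id_apply oper_scl)

lemma act_add_right: "act p (f + h) = act p f + act p h"
  by (simp add: act_def foldr_oper_add sum.distrib)

lemma act_scl_right: "act p (scl a f) = scl a (act p f)"
  by (simp add: act_def foldr_oper_scl scl_sum mult.commute)

lemma act_zero_right [simp]: "act p 0 = 0" using act_scl_right[of p 0 0] by simp

lemma act_minus: "act (- p) f = - act p f"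
  using act_add[of p "- p" f] by (simp add: eq_neg_iff_add_eq_0 add.commute)

lemma act_diff: "act (p - q) f = act p f - act q f"
  using act_add[of p "- q" f] by (simp add: act_minus)

lemma act_sum: "act (sum p A) f = (\<Sum>x\<in>A. act (p x) f)"
  by (induction A rule: infinite_finite_induct) (simp_all add: act_add)

lemma act_mult: "act (p * q) f = act p (act q f)"
proof -
  have U: "p \<in> carrier (free_algebra UNIV)" "q \<in> carrier (free_algebra UNIV)"
    by (simp_all add: free_algebra_mem_iff)
  from U(1) show ?thesis
  proof (induction p rule: free_algebra_induct)
    case (single w a)
    from U(2) show ?case
    proof (induction q rule: free_algebra_induct)
      case (single v b)
      show ?case by (simp add: mult_single act_single plus_word_def foldr_oper_scl)
    qed (simp_all only: act_add distrib_left act_add_right mult_zero_right act_zero act_zero_right)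
  qed (simp_all only: act_add distrib_right mult_zero_left act_zero)
qed

lemma act_one [simp]: "act 1 f = f"
  using act_single[of 0 1 f] by (simp add: zero_word_def flip: single_one)

lemma act_if: "act (if b then p else q) f = (if b then act p f else act q f)"
  by simp

lemma act_invariant:
  assumes "p \<in> carrier (free_algebra G)" "f \<in> V" "0 \<in> V"
    and "\<And>f h. f \<in> V \<Longrightarrow> h \<in> V \<Longrightarrow> f + h \<in> V" "\<And>a f. f \<in> V \<Longrightarrow> scl a f \<in> V"
    and "\<And>g f. g \<in> G \<Longrightarrow> f \<in> V \<Longrightarrow> oper g f \<in> V"
  shows "act p f \<in> V"
  using assms(1)
proof (induction p rule: free_algebra_induct)
  case (single w a)
  have "set ls \<subseteq> G \<Longrightarrow> foldr oper ls f \<in> V" for ls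
    using assms(2,6) by (induction ls) simp_all
  then have "foldr oper (letters w) f \<in> V" using single by blast
  then show ?case by (simp add: act_single assms(5))
qed (simp_all only: act_add act_zero assms)

end

lemma mulx_scale: "mulx c (\<lambda>Y. a * g Y) = (\<lambda>Y. a * mulx c g Y)" by (auto simp: mulx_def)
lemma dx_scale: "dx c (\<lambda>Y. a * g Y) = (\<lambda>Y. a * dx c g Y)" by (auto simp: dx_def)
lemma cross_scale: "cross s b c (\<lambda>Y. a * g Y) = (\<lambda>Y. a * cross s b c g Y)"
  by (auto simp: cross_def dx_scale mulx_scale fun_eq_iff algebra_simps)

lemma mset_run:
  "ok (p, q) w \<Longrightarrow> run (p, q) w = (p', q') \<Longrightarrow> mset w = mset [p..p' - 1] + mset [q..q' - 1]"
proof (induction w arbitrary: p q)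
  case (Cons c w)
  show ?case
  proof (cases "c = p")
    case True
    then have "mset w = mset [p + 1..p' - 1] + mset [q..q' - 1]" using Cons by auto
    moreover have "p + 1 \<le> p'" using run_mono[of "(p + 1, q)" w] Cons.prems True by auto
    ultimately show ?thesis using True upto_rec1[of p "p' - 1"] by simp
  next
    case False
    then have "mset w = mset [p..p' - 1] + mset [q + 1..q' - 1]" "c = q" using Cons by auto
    moreover have "q + 1 \<le> q'" using run_mono[of "(p, q + 1)" w] Cons.prems False by auto
    ultimately show ?thesis using upto_rec1[of q "q' - 1"] by simp
  qed
qed simp

lemma sum_apply: "(\<Sum>x\<in>A. f x) y = (\<Sum>x\<in>A. f x y)"
  by (induction A rule: infinite_finite_induct) auto

lemma finite_res_seqs: "finite (res_seqs \<alpha>)"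
  using mset_eq_finite by (metis res_seqs_def ex_mset)

context two_tokens begin

primrec genop :: "klr_gen \<Rightarrow> (int list \<Rightarrow> int set \<Rightarrow> 'k::field) \<Rightarrow> int list \<Rightarrow> int set \<Rightarrow> 'k" where
  "genop (GenE js) = opE js"
| "genop (GenY t) = opY t"
| "genop (GenPsi t) = opP t"

sublocale free_action genop
proof
  fix g :: klr_gen and f h :: "int list \<Rightarrow> int set \<Rightarrow> 'k::field" and a :: 'k
  show "genop g (f + h) = genop g f + genop g h"
    by (cases g) (auto simp: opE_def opY_def opP_def fun_eq_iff[where f = "genop _ _"])
  show "genop g (scl a f) = scl a (genop g f)"
    by (intro ext; cases g; simp add: opE_def opY_def opP_def scl_def cross_scale mulx_scale)
qed

definition alpha :: "int multiset" where
  "alpha = image_mset (\<lambda>c. c mod int e) (mset [i..i + int k - 1] + mset [i - 1..i + int r - 2])"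

lemma size_alpha: "size alpha = k + r" by (simp add: alpha_def)

lemma resid_words: "J \<in> words \<Longrightarrow> resid J \<in> res_seqs alpha"
  using mset_run[of i "i - 1" J] by (auto simp: words_def res_seqs_def alpha_def resid_def)

lemma act_fgen [simp]: "act (fgen g) f = genop g f"
  by (simp add: fgen_def act_single)

lemma space_act:
  assumes "p \<in> carrier (free_algebra (klr_gens alpha))" "f \<in> space"
  shows "act p f \<in> space"
proof (rule act_invariant[OF assms])
  fix g and f :: "int list \<Rightarrow> int set \<Rightarrow> 'a" assume "g \<in> klr_gens alpha" "f \<in> space"
  then show "genop g f \<in> space"
    by (auto simp: klr_gens_def size_alpha space_opE space_opY space_opP)
next
  fix a and f :: "int list \<Rightarrow> int set \<Rightarrow> 'a" assume "f \<in> space"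
  then show "scl a f \<in> space"
    by (auto simp: space_def scl_def mulx_scale fun_eq_iff[where f = "\<lambda>Y. a * _ Y"])
qed (simp_all add: space_add)

lemma length_res_seqs: "js \<in> res_seqs alpha \<Longrightarrow> length js = k + r"
  by (metis (mono_tags) mem_Collect_eq res_seqs_def size_alpha size_mset)

lemma act_klr_relation:
  assumes "p \<in> klr_relations e alpha" "f \<in> space"
  shows "act p f = 0"
proof -
  have sum: "(\<Sum>is\<in>res_seqs alpha. opE is f) = f"
  proof (rule ext)
    fix J
    have "(\<Sum>is\<in>res_seqs alpha. opE is f) J = (\<Sum>is\<in>res_seqs alpha. if resid J = is then f J else 0)"
      by (simp add: sum_apply opE_def)
    also have "\<dots> = f J" using finite_res_seqs[of alpha] resid_words[of J] space_zero[OF assms(2), of J]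
      by (cases "J \<in> words") (simp_all add: sum.delta')
    finally show "(\<Sum>is\<in>res_seqs alpha. opE is f) J = f J" .
  qed
  note s = assms(2)
  show ?thesis
    \<comment> \<open>One subgoal for each family of relations, in the order of
      \<open>klr_relations\<close>. That the idempotents add up to 1 rests on \<open>sum\<close>:
      every word in the support of f has its residue sequence in
      \<open>res_seqs alpha\<close>.\<close>
    apply (insert assms(1)[unfolded klr_relations_def size_alpha])
    apply (elim UnE CollectE exE conjE singletonE; hypsubst)
    subgoal by (simp add: act_diff act_mult opE_idem)
    subgoal by (simp add: act_diff act_sum sum)
    subgoal by (simp add: act_diff act_mult opY_opE)
    subgoal using s by (simp add: act_diff act_mult opP_opE length_res_seqs)
    subgoal by (simp add: act_diff act_mult opY_opY)
    subgoal for t t' using opP_opY_far[OF s, of t t'] by (simp add: act_diff act_mult)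
    subgoal for t t' using opP_opP_far[OF s, of t t'] by (simp add: act_diff act_mult)
    subgoal for t js using opP_opY[OF s, of t js] by (simp add: act_diff act_mult act_add length_res_seqs dlt_def act_if
        cong: if_cong split del: if_split)
    subgoal for t js using opY_opP[OF s, of t js] by (simp add: act_diff act_mult act_add length_res_seqs dlt_def act_if
        cong: if_cong split del: if_split)
    subgoal for t js using opP_opP[OF s, of t js] by (simp add: act_diff act_mult act_add length_res_seqs quad_term_def act_if
        cong: if_cong split del: if_split)
    subgoal for t js using opP_braid[OF s, of t js] by (simp add: act_diff act_minus act_mult act_add length_res_seqs braid_term_def act_if
        numeral_2_eq_2 cong: if_cong split del: if_split)
    done
qed

end

section \<open>Left ideals and shuffles of two rows\<close>

abbreviation scal :: "'k::field \<Rightarrow> 'k free_klr" where "scal a \<equiv> Poly_Mapping.single 0 a"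

lemma scal_closed: "scal a \<in> carrier (free_algebra G)"
  by (simp add: free_algebra_mem_iff zero_word_def)

lemma scal_commute: "scal a * p = p * scal a"
proof -
  have "p \<in> carrier (free_algebra UNIV)" by (simp add: free_algebra_mem_iff)
  then show ?thesis
    by (induction p rule: free_algebra_induct) (simp_all add: distrib_left distrib_right mult_single mult.commute)
qed

lemma mult_scal_left: "g * (scal a * m) = scal a * (g * m)"
  by (metis mult.assoc scal_commute)

section \<open>Computation modulo a left ideal of the free algebra\<close>

lemma klr_relations_intros:
  "is \<in> res_seqs \<alpha> \<Longrightarrow> js \<in> res_seqs \<alpha> \<Longrightarrow> fE is * fE js - (if is = js then fE is else 0) \<in> klr_relations e \<alpha>"
  "t \<in> {1..<size \<alpha>} \<Longrightarrow> is \<in> res_seqs \<alpha> \<Longrightarrow> fPsi t * fE is - fE (swap_entries t is) * fPsi t \<in> klr_relations e \<alpha>"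
  "t \<in> {1..<size \<alpha>} \<Longrightarrow> s \<in> {1..size \<alpha>} \<Longrightarrow> s \<noteq> t \<Longrightarrow> s \<noteq> t + 1 \<Longrightarrow> fPsi t * fY s - fY s * fPsi t \<in> klr_relations e \<alpha>"
  "t \<in> {1..<size \<alpha>} \<Longrightarrow> s \<in> {1..<size \<alpha>} \<Longrightarrow> t + 1 < s \<or> s + 1 < t \<Longrightarrow> fPsi t * fPsi s - fPsi s * fPsi t \<in> klr_relations e \<alpha>"
  "t \<in> {1..<size \<alpha>} \<Longrightarrow> is \<in> res_seqs \<alpha> \<Longrightarrow>
     fPsi t * fY (t + 1) * fE is - (fY t * fPsi t + dlt is t) * fE is \<in> klr_relations e \<alpha>"
  "t \<in> {1..<size \<alpha>} \<Longrightarrow> is \<in> res_seqs \<alpha> \<Longrightarrow>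
     fY (t + 1) * fPsi t * fE is - (fPsi t * fY t + dlt is t) * fE is \<in> klr_relations e \<alpha>"
  "t \<in> {1..<size \<alpha>} \<Longrightarrow> is \<in> res_seqs \<alpha> \<Longrightarrow>
     fPsi t * fPsi t * fE is - quad_term e is t * fE is \<in> klr_relations e \<alpha>"
  "1 \<le> t \<Longrightarrow> t + 1 < size \<alpha> \<Longrightarrow> is \<in> res_seqs \<alpha> \<Longrightarrow>
     fPsi t * fPsi (t + 1) * fPsi t * fE is
        - (fPsi (t + 1) * fPsi t * fPsi (t + 1) + braid_term e is t) * fE is \<in> klr_relations e \<alpha>"
  unfolding klr_relations_def by blast+

text \<open>A cyclic module over the KLR algebra is represented by a left ideal of the free algebra,
  so that calculations concern polynomials instead of cosets. \<open>I_rel\<close> asks that a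
  relation times anything lies in \<open>I\<close>; together with \<open>I_mult\<close> this puts
  the whole two-sided ideal of relations into \<open>I\<close>
  (\<open>klr_ideal_subset\<close>).\<close>

locale klr_left_ideal =
  fixes e :: nat and \<alpha> :: "int multiset" and I :: "'k::field free_klr set"
  assumes I_sub: "I \<subseteq> carrier (free_algebra (klr_gens \<alpha>))"
    and I_zero [simp]: "0 \<in> I"
    and I_add: "p \<in> I \<Longrightarrow> q \<in> I \<Longrightarrow> p + q \<in> I"
    and I_mult: "g \<in> carrier (free_algebra (klr_gens \<alpha>)) \<Longrightarrow> p \<in> I \<Longrightarrow> g * p \<in> I"
    and I_rel: "g \<in> klr_relations e \<alpha> \<Longrightarrow> p \<in> carrier (free_algebra (klr_gens \<alpha>)) \<Longrightarrow> g * p \<in> I"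
begin

abbreviation C :: "'k free_klr set" where "C \<equiv> carrier (free_algebra (klr_gens \<alpha>))"

abbreviation n :: nat where "n \<equiv> size \<alpha>"

definition eqv :: "'k free_klr \<Rightarrow> 'k free_klr \<Rightarrow> bool" (infix "\<approx>" 50) where "p \<approx> q \<longleftrightarrow> p - q \<in> I"

lemma fE_C: "js \<in> res_seqs \<alpha> \<Longrightarrow> fE js \<in> C" by (rule fgen_closed) (simp add: klr_gens_def)
lemma fY_C: "1 \<le> t \<Longrightarrow> t \<le> n \<Longrightarrow> fY t \<in> C" by (rule fgen_closed) (simp add: klr_gens_def)
lemma fPsi_C: "1 \<le> t \<Longrightarrow> t < n \<Longrightarrow> fPsi t \<in> C" by (rule fgen_closed) (simp add: klr_gens_def)

lemmas C_intros = free_algebra_mult_closed free_algebra_add_closed free_algebra_one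
  free_algebra_uminus free_algebra_diff free_algebra_zero scal_closed fE_C fY_C fPsi_C

lemma I_uminus: "p \<in> I \<Longrightarrow> - p \<in> I"
proof -
  assume p: "p \<in> I"
  have "- 1 \<in> C" by (intro free_algebra_uminus free_algebra_one)
  from I_mult[OF this p] show "- p \<in> I" by simp
qed

lemma I_diff: "p \<in> I \<Longrightarrow> q \<in> I \<Longrightarrow> p - q \<in> I"
  using I_add[of p "- q"] I_uminus[of q] by simp

lemma eqv_refl [simp]: "p \<approx> p" by (simp add: eqv_def)
lemma eqv_sym: "p \<approx> q \<Longrightarrow> q \<approx> p" using I_uminus[of "p - q"] by (simp add: eqv_def)
lemma eqv_trans [trans]: "p \<approx> q \<Longrightarrow> q \<approx> s \<Longrightarrow> p \<approx> s" using I_add[of "p - q" "q - s"] by (simp add: eqv_def)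
lemma eqv_add: "p \<approx> q \<Longrightarrow> p' \<approx> q' \<Longrightarrow> p + p' \<approx> q + q'"
  using I_add[of "p - q" "p' - q'"] by (simp add: eqv_def algebra_simps)
lemma eqv_mult: "g \<in> C \<Longrightarrow> p \<approx> q \<Longrightarrow> g * p \<approx> g * q"
  using I_mult[of g "p - q"] by (simp add: eqv_def algebra_simps)
lemma eqv_I: "p \<approx> q \<Longrightarrow> q \<in> I \<Longrightarrow> p \<in> I"
  using I_add[of "p - q" q] by (simp add: eqv_def)
lemma eqv_I': "p \<approx> q \<Longrightarrow> p \<in> I \<Longrightarrow> q \<in> I"
  using eqv_I eqv_sym by blast
lemma eqv_eq [trans]: "p \<approx> q \<Longrightarrow> q = s \<Longrightarrow> p \<approx> s" by simp
lemma eq_eqv [trans]: "p = q \<Longrightarrow> q \<approx> s \<Longrightarrow> p \<approx> s" by simp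

definition wt :: "int list \<Rightarrow> 'k free_klr \<Rightarrow> bool" where
  "wt js p \<longleftrightarrow> js \<in> res_seqs \<alpha> \<and> p \<in> C \<and> fE js * p \<approx> p"

lemma wtD: "wt js p \<Longrightarrow> js \<in> res_seqs \<alpha>" "wt js p \<Longrightarrow> p \<in> C" "wt js p \<Longrightarrow> fE js * p \<approx> p"
  by (auto simp: wt_def)

text \<open>Many defining relations carry an idempotent on the right, and a weight element absorbs
  it modulo \<open>I\<close>.\<close>

lemma wt_relation:
  assumes "wt js p" "X \<in> C" "X * fE js \<in> klr_relations e \<alpha>"
  shows "X * p \<in> I"
proof -
  have "X * fE js * p \<in> I" using assms I_rel wtD by blast
  moreover have "X * (fE js * p - p) \<in> I" using I_mult[OF assms(2)] wtD(3)[OF assms(1)] by (simp add: eqv_def)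
  ultimately show ?thesis using I_diff[of "X * fE js * p" "X * (fE js * p - p)"] by (simp add: algebra_simps)
qed

lemma fE_wt:
  assumes "wt js p" "ks \<in> res_seqs \<alpha>"
  shows "fE ks * p \<approx> (if ks = js then p else 0)"
proof (cases "ks = js")
  case False
  then have "fE ks * fE js \<in> klr_relations e \<alpha>"
    using klr_relations_intros(1)[of ks \<alpha> js] assms wtD by auto
  then show ?thesis using wt_relation[OF assms(1), of "fE ks"] assms(2) False by (simp add: eqv_def fE_C)
qed (use assms wtD in auto)

lemma wt_psi:
  assumes "wt js p" "1 \<le> t" "t < n"
  shows "wt (swap_entries t js) (fPsi t * p)"
proof -
  have js: "js \<in> res_seqs \<alpha>" "p \<in> C" using assms wtD by auto
  have s: "swap_entries t js \<in> res_seqs \<alpha>" using js assms by (intro swap_entries_res_seqs) auto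
  have "fPsi t * fE js - fE (swap_entries t js) * fPsi t \<in> klr_relations e \<alpha>"
    using js assms
    by (intro klr_relations_intros(2)) auto
  then have "fPsi t * (fE js * p) \<approx> fE (swap_entries t js) * (fPsi t * p)"
    using I_rel[OF _ js(2)] by (fastforce simp: eqv_def algebra_simps)
  moreover have "fPsi t * (fE js * p) \<approx> fPsi t * p" using assms wtD by (intro eqv_mult fPsi_C) auto
  ultimately have "fE (swap_entries t js) * (fPsi t * p) \<approx> fPsi t * p" using eqv_sym eqv_trans by blast
  then show ?thesis using s js assms by (simp add: wt_def C_intros)
qed

lemma psi_y_far:
  assumes "p \<in> C" "1 \<le> t" "t < n" "1 \<le> s" "s \<le> n" "s \<noteq> t" "s \<noteq> t + 1"
  shows "fPsi t * (fY s * p) \<approx> fY s * (fPsi t * p)"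
proof -
  have "fPsi t * fY s - fY s * fPsi t \<in> klr_relations e \<alpha>"
    using assms
    by (intro klr_relations_intros(3)) auto
  then show ?thesis using I_rel[OF _ assms(1)] by (fastforce simp: eqv_def algebra_simps)
qed

lemma psi_psi_far:
  assumes "p \<in> C" "1 \<le> t" "t < n" "1 \<le> s" "s < n" "t + 1 < s \<or> s + 1 < t"
  shows "fPsi t * (fPsi s * p) \<approx> fPsi s * (fPsi t * p)"
proof -
  have "fPsi t * fPsi s - fPsi s * fPsi t \<in> klr_relations e \<alpha>"
    using assms
    by (intro klr_relations_intros(4)) auto
  then show ?thesis using I_rel[OF _ assms(1)] by (fastforce simp: eqv_def algebra_simps)
qed

lemma dlt_mult: "dlt js t * p = (if entry js t = entry js (t + 1) then p else 0)"
  by (simp add: dlt_def)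

lemma psi_y:
  assumes "wt js p" "1 \<le> t" "t < n"
  shows "fPsi t * (fY (t + 1) * p) \<approx> fY t * (fPsi t * p) + (if entry js t = entry js (t + 1) then p else 0)"
proof -
  have "fPsi t * fY (t + 1) * fE js - (fY t * fPsi t + dlt js t) * fE js \<in> klr_relations e \<alpha>"
    using assms wtD
    by (intro klr_relations_intros(5)) auto
  then have "(fPsi t * fY (t + 1) - (fY t * fPsi t + dlt js t)) * p \<in> I"
    using assms by (intro wt_relation[OF assms(1)]) (auto simp: dlt_def left_diff_distrib intro!: C_intros)
  then show ?thesis by (simp add: eqv_def left_diff_distrib distrib_right mult.assoc dlt_mult split del: if_split)
qed

lemma y_psi:
  assumes "wt js p" "1 \<le> t" "t < n"
  shows "fY (t + 1) * (fPsi t * p) \<approx> fPsi t * (fY t * p) + (if entry js t = entry js (t + 1) then p else 0)"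
proof -
  have "fY (t + 1) * fPsi t * fE js - (fPsi t * fY t + dlt js t) * fE js \<in> klr_relations e \<alpha>"
    using assms wtD
    by (intro klr_relations_intros(6)) auto
  then have "(fY (t + 1) * fPsi t - (fPsi t * fY t + dlt js t)) * p \<in> I"
    using assms by (intro wt_relation[OF assms(1)]) (auto simp: dlt_def left_diff_distrib intro!: C_intros)
  then show ?thesis by (simp add: eqv_def left_diff_distrib distrib_right mult.assoc dlt_mult split del: if_split)
qed

lemma quad_C: "1 \<le> t \<Longrightarrow> t < n \<Longrightarrow> quad_term e js t \<in> C"
  by (auto simp: quad_term_def intro!: C_intros)

lemma psi_psi:
  assumes "wt js p" "1 \<le> t" "t < n"
  shows "fPsi t * (fPsi t * p) \<approx> quad_term e js t * p"
proof -
  have "fPsi t * fPsi t * fE js - quad_term e js t * fE js \<in> klr_relations e \<alpha>"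
    using assms wtD
    by (intro klr_relations_intros(7)) auto
  then have "(fPsi t * fPsi t - quad_term e js t) * p \<in> I"
    using assms by (intro wt_relation[OF assms(1)]) (auto simp: left_diff_distrib quad_C intro!: C_intros)
  then show ?thesis by (simp add: eqv_def left_diff_distrib mult.assoc)
qed

lemma psi_braid:
  assumes "wt js p" "1 \<le> t" "t + 1 < n"
  shows "fPsi t * (fPsi (t + 1) * (fPsi t * p)) \<approx> fPsi (t + 1) * (fPsi t * (fPsi (t + 1) * p)) + braid_term e js t * p"
proof -
  have "fPsi t * fPsi (t + 1) * fPsi t * fE js
        - (fPsi (t + 1) * fPsi t * fPsi (t + 1) + braid_term e js t) * fE js \<in> klr_relations e \<alpha>"
    using assms wtD
    by (intro klr_relations_intros(8)) auto
  then have "(fPsi t * fPsi (t + 1) * fPsi t - (fPsi (t + 1) * fPsi t * fPsi (t + 1) + braid_term e js t)) * p \<in> I"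
    using assms by (intro wt_relation[OF assms(1)]) (auto simp: left_diff_distrib braid_term_def intro!: C_intros)
  then show ?thesis by (simp add: eqv_def left_diff_distrib distrib_right mult.assoc)
qed

end

text \<open>
  A shuffle of two rows is a word in which \<open>False\<close> stands for the first row and \<open>True\<close> for the
  second; \<open>x\<close> and \<open>y\<close> are the residues at which the rows start.
\<close>

fun row_res :: "int \<Rightarrow> int \<Rightarrow> bool list \<Rightarrow> int list" where
  "row_res x y [] = []"
| "row_res x y (b # T) = (if b then y # row_res x (y + 1) T else x # row_res (x + 1) y T)"

abbreviation nF :: "bool list \<Rightarrow> nat" where "nF T \<equiv> count_list T False"
abbreviation nT :: "bool list \<Rightarrow> nat" where "nT T \<equiv> count_list T True"

lemma row_res_append [simp]:
  "row_res x y (u @ w) = row_res x y u @ row_res (x + int (nF u)) (y + int (nT u)) w"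
  by (induction u arbitrary: x y) (auto simp: algebra_simps)

lemma length_row_res [simp]: "length (row_res x y T) = length T"
  by (induction T arbitrary: x y) auto

lemma nF_nT: "nF T + nT T = length T"
  by (induction T) auto

fun inv_count :: "bool list \<Rightarrow> nat" where
  "inv_count [] = 0"
| "inv_count (b # T) = (if b then nF T else 0) + inv_count T"

lemma inv_count_swap: "inv_count (u @ True # False # w) = Suc (inv_count (u @ False # True # w))"
  by (induction u) auto

definition top_word :: "nat \<Rightarrow> nat \<Rightarrow> bool list" where
  "top_word K N = replicate K False @ replicate N True"

lemma count_list_replicate [simp]: "count_list (replicate m a) b = (if a = b then m else 0)"
  by (induction m) auto

lemma top_word_counts [simp]: "nF (top_word K N) = K" "nT (top_word K N) = N"
  by (simp_all add: top_word_def)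

lemma inv_top_word: "inv_count (top_word K N) = 0"
proof -
  have "inv_count (replicate N True) = 0" by (induction N) auto
  then show ?thesis unfolding top_word_def by (induction K) auto
qed

lemma no_descent: "(\<nexists>u w. T = u @ True # False # w) \<Longrightarrow> T = top_word (nF T) (nT T)"
proof (induction T)
  case (Cons b T)
  then have IH: "T = top_word (nF T) (nT T)" by (metis append_Cons)
  show ?case
  proof (cases b)
    case True
    have "nF T = 0"
    proof (rule ccontr)
      assume "nF T \<noteq> 0"
      then obtain T' where "T = False # T'" using IH by (cases "nF T") (auto simp: top_word_def)
      then show False using Cons.prems True by (metis append_Nil)
    qed
    then show ?thesis using True IH by (simp add: top_word_def)
  next
    case False
    then show ?thesis using IH by (simp add: top_word_def)
  qed
qed (simp add: top_word_def)

text \<open>The cases are those in which two simple reflections are equal, commute (on either side),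
  or satisfy a braid relation (on either side).\<close>

lemma pair_split_cases:
  assumes "u @ a # b # w = u' @ c # d # w'"
  obtains "u = u'" "a = c" "b = d" "w = w'"
    | v where "u' = u @ a # b # v" "w = v @ c # d # w'"
    | v where "u = u' @ c # d # v" "w' = v @ a # b # w"
    | "u' = u @ [a]" "c = b" "w = d # w'"
    | "u = u' @ [c]" "a = d" "w' = b # w"
  using assms
proof (induction u arbitrary: u' thesis)
  case Nil
  then show ?case by (cases u'; cases "tl u'") auto
next
  case (Cons z u)
  show ?case
  proof (cases u')
    case Nil
    then show ?thesis using Cons.prems by (cases u) auto
  next
    case u': (Cons z' v)
    then have "u @ a # b # w = v @ c # d # w'" "z = z'" using Cons.prems(6) by auto
    then show ?thesis using Cons.IH[of v thesis] Cons.prems(1-5) u' by (auto)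
  qed
qed

text \<open>These are the elements psi_w for the reduced expressions of the shortest coset
  representative w that belongs to the shuffle: each step creates one inversion. It is a relation
  because a shuffle has several reduced expressions.\<close>

inductive rep :: "nat \<Rightarrow> nat \<Rightarrow> bool list \<Rightarrow> 'k::field free_klr \<Rightarrow> bool" for K N where
  rep_top: "rep K N (top_word K N) 1"
| rep_step: "rep K N (u @ False # True # w) m \<Longrightarrow> rep K N (u @ True # False # w) (fPsi (Suc (length u)) * m)"

lemma rep_counts: "rep K N T m \<Longrightarrow> nF T = K \<and> nT T = N"
  by (induction rule: rep.induct) auto

lemma rep_length: "rep K N T m \<Longrightarrow> length T = K + N"
  using rep_counts[of K N T m] nF_nT[of T] by simp

lemma rep_exists: "nF T = K \<Longrightarrow> nT T = N \<Longrightarrow> \<exists>m. rep K N T (m :: 'k::field free_klr)"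
proof (induction "inv_count T" arbitrary: T rule: less_induct)
  case less
  show ?case
  proof (cases "\<exists>u w. T = u @ True # False # w")
    case True
    then obtain u w where T: "T = u @ True # False # w" by blast
    then have "\<exists>m. rep K N (u @ False # True # w) (m :: 'k free_klr)" using less inv_count_swap by (intro less.hyps) auto
    then show ?thesis using T rep_step by blast
  next
    case False
    then show ?thesis using no_descent[of T] less.prems by (auto intro: rep_top)
  qed
qed

lemma rep_topD: "rep K N (top_word K N) m \<Longrightarrow> m = 1"
  by (erule rep.cases) (auto simp: inv_top_word inv_count_swap dest: arg_cong[of _ _ inv_count])

lemma rep_cases [consumes 1, case_names top step]:
  assumes "rep K N T m"
  obtains "T = top_word K N" "m = 1"
    | u w m' where "T = u @ True # False # w" "m = fPsi (Suc (length u)) * m'" "rep K N (u @ False # True # w) m'"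
  using assms by (cases rule: rep.cases) auto

section \<open>The spanning set indexed by the shuffles of two rows\<close>

locale two_row = klr_left_ideal e \<alpha> I for e \<alpha> and I :: "'k::field free_klr set" +
  fixes K N :: nat and x y :: int
  assumes size_content: "size \<alpha> = K + N"
    and top_seq: "map (\<lambda>c. c mod int e) (row_res x y (top_word K N)) \<in> res_seqs \<alpha>"
    and top_e: "fE (map (\<lambda>c. c mod int e) (row_res x y (top_word K N))) - 1 \<in> I"
    and top_y: "1 \<le> t \<Longrightarrow> t \<le> K + N \<Longrightarrow> fY t \<in> I"
    and top_psi: "1 \<le> t \<Longrightarrow> t < K + N \<Longrightarrow> t \<noteq> K \<Longrightarrow> fPsi t \<in> I"
begin

lemma eqv_move: "p \<approx> q + d \<Longrightarrow> q \<approx> p + - d"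
  using eqv_sym[of p "q + d"] by (simp add: eqv_def algebra_simps)

definition seq :: "bool list \<Rightarrow> int list" where
  "seq T = map (\<lambda>c. c mod int e) (row_res x y T)"

lemma rep_index: "rep K N (u @ a # b # w) (m :: 'k free_klr) \<Longrightarrow> 1 \<le> Suc (length u) \<and> Suc (length u) < n"
  using rep_length[of K N "u @ a # b # w" m] size_content by auto

lemma rep_C: "rep K N T m \<Longrightarrow> m \<in> C"
proof (induction rule: rep.induct)
  case (rep_step u w m)
  then show ?case using rep_index[OF rep_step(1)] by (intro C_intros) auto
qed (rule free_algebra_one)

lemma swap_seq: "swap_entries (Suc (length u)) (seq (u @ False # True # w)) = seq (u @ True # False # w)"
  using swap_entries_append[of "map (\<lambda>c. c mod int e) (row_res x y u)"]
  by (simp add: seq_def algebra_simps)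

lemma rep_wt: "rep K N T m \<Longrightarrow> wt (seq T) m"
proof (induction rule: rep.induct)
  case rep_top
  then show ?case using top_seq top_e by (simp add: wt_def seq_def eqv_def free_algebra_one)
next
  case (rep_step u w m)
  then show ?case using wt_psi[OF rep_step(2), of "Suc (length u)"] rep_index[OF rep_step(1)]
    by (simp add: swap_seq)
qed

text \<open>Two descents True False never overlap, so two different last steps commute, and the
  reduced expressions of a shuffle are connected by commutations alone. The braid relation with its
  correction term never enters.\<close>

lemma rep_unique:
  fixes m m' :: "'k free_klr"
  assumes "rep K N T m" "rep K N T m'"
  shows "m \<approx> m'"
  using assms
proof (induction "inv_count T" arbitrary: T m m' rule: less_induct)
  case less
  from less.prems(1) show ?case
  proof (cases rule: rep_cases)
    case top
    have "m' = 1" using less.prems(2) unfolding top(1) by (rule rep_topD)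
    then show ?thesis using top by simp
  next
    case s1: (step u w m1)
    from less.prems(2) show ?thesis
    proof (cases rule: rep_cases)
      case top
      then show ?thesis using s1 inv_count_swap[of u w] inv_top_word by (metis nat.simps(3))
    next
      case s2: (step u' w' m2)
      have far: "fPsi (Suc (length u)) * m1 \<approx> fPsi (Suc (length u')) * m2"
        if T1: "rep K N (u @ False # True # v @ True # False # w') m1"
          and T2: "rep K N (u @ True # False # v @ False # True # w') m2"
          and u': "u' = u @ True # False # v"
          and T: "T = u @ True # False # v @ True # False # w'" for u u' v w' and m1 m2 :: "'k free_klr"
      proof -
        let ?T0 = "u @ False # True # v @ False # True # w'"
        have "nF ?T0 = K" "nT ?T0 = N" using rep_counts[OF T1] by auto
        then obtain m0 :: "'k free_klr" where m0: "rep K N ?T0 m0" using rep_exists by blast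
        have i: "Suc (length u) < n" "Suc (length u') < n" "Suc (length u) + 1 < Suc (length u')"
          using rep_length[OF T1] size_content u' by auto
        have "rep K N (u @ True # False # v @ False # True # w') (fPsi (Suc (length u)) * m0)"
          using m0 by (rule rep_step)
        then have 2: "m2 \<approx> fPsi (Suc (length u)) * m0"
          using T2 inv_count_swap[of "u @ True # False # v" w'] T by (intro less.hyps) auto
        have "rep K N ((u @ False # True # v) @ False # True # w') m0" using m0 by simp
        from rep_step[OF this] have "rep K N (u @ False # True # v @ True # False # w') (fPsi (Suc (length u')) * m0)"
          using u' by simp
        then have 1: "m1 \<approx> fPsi (Suc (length u')) * m0"
          using T1 inv_count_swap[of u "v @ True # False # w'"] T by (intro less.hyps) auto
        have "fPsi (Suc (length u)) * m1 \<approx> fPsi (Suc (length u)) * (fPsi (Suc (length u')) * m0)"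
          using 1 i by (intro eqv_mult fPsi_C) auto
        also have "\<dots> \<approx> fPsi (Suc (length u')) * (fPsi (Suc (length u)) * m0)"
          using i rep_C[OF m0] by (intro psi_psi_far) auto
        also have "\<dots> \<approx> fPsi (Suc (length u')) * m2"
          using eqv_sym[OF 2] i by (intro eqv_mult fPsi_C) auto
        finally show ?thesis .
      qed
      from s1(1)[unfolded s2(1)] show ?thesis
      proof (cases rule: pair_split_cases)
        case 1
        then have "m1 \<approx> m2" using s1 s2 inv_count_swap[of u w] by (intro less.hyps) auto
        then show ?thesis using s1 s2 1 rep_index[OF s1(3)] by (auto intro!: eqv_mult fPsi_C)
      next
        case (2 v)
        then show ?thesis using far[of u' v w m2 m1 u] s1 s2 eqv_sym by auto
      next
        case (3 v)
        then show ?thesis using far[of u v w' m1 m2 u'] s1 s2 by auto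
      qed auto
    qed
  qed
qed

text \<open>By uniqueness every descent of a shuffle can serve as the last step of its
  construction.\<close>

lemma rep_descent:
  fixes m :: "'k free_klr"
  assumes "rep K N (u @ True # False # w) m"
  obtains m' where "rep K N (u @ False # True # w) m'" "m \<approx> fPsi (Suc (length u)) * m'"
proof -
  have "nF (u @ False # True # w) = K" "nT (u @ False # True # w) = N" using rep_counts[OF assms] by auto
  then obtain m' :: "'k free_klr" where "rep K N (u @ False # True # w) m'" using rep_exists by blast
  then show ?thesis using that rep_unique[OF assms] rep_step by blast
qed

inductive_set span :: "nat \<Rightarrow> 'k free_klr set" for l where
  span_I: "p \<in> I \<Longrightarrow> p \<in> span l"
| span_add_rep: "p \<in> span l \<Longrightarrow> rep K N T m \<Longrightarrow> inv_count T < l \<Longrightarrow> scal a * m + p \<in> span l"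

lemma span_add: "p \<in> span l \<Longrightarrow> q \<in> span l \<Longrightarrow> p + q \<in> span l"
proof (induction rule: span.induct)
  case (span_I p)
  from \<open>q \<in> span l\<close> \<open>p \<in> I\<close> show ?case
  proof (induction rule: span.induct)
    case (span_add_rep q T m a)
    then have "scal a * m + (p + q) \<in> span l" by (intro span.span_add_rep) auto
    then show ?case by (simp add: algebra_simps)
  qed (auto intro: span.span_I I_add)
next
  case (span_add_rep p T m a)
  then have "scal a * m + (p + q) \<in> span l" by (intro span.span_add_rep) auto
  then show ?case by (simp add: algebra_simps)
qed

lemma span_scal: "p \<in> span l \<Longrightarrow> scal b * p \<in> span l"
proof (induction rule: span.induct)
  case (span_add_rep p T m a)
  then have "scal (b * a) * m + scal b * p \<in> span l" by (intro span.span_add_rep) auto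
  then show ?case by (simp add: distrib_left mult.assoc[symmetric] mult_single)
qed (auto intro: span_I I_mult scal_closed)

lemma span_rep: "rep K N T m \<Longrightarrow> inv_count T < l \<Longrightarrow> m \<in> span l"
  using span_add_rep[OF span_I[OF I_zero], of T m l 1] by simp

lemma span_eqv: "p \<approx> q \<Longrightarrow> q \<in> span l \<Longrightarrow> p \<in> span l"
  using span_add[of q l "p - q"] by (simp add: eqv_def span_I)

lemma span_mono: "p \<in> span l \<Longrightarrow> l \<le> l' \<Longrightarrow> p \<in> span l'"
  by (induction rule: span.induct) (auto intro: span.intros)

lemma span_uminus: "p \<in> span l \<Longrightarrow> - p \<in> span l"
  using span_scal[of p l "- 1"] by (simp add: single_uminus)

lemma span_mult:
  assumes "p \<in> span l" "g \<in> C" "\<And>T (m :: 'k free_klr). rep K N T m \<Longrightarrow> inv_count T < l \<Longrightarrow> g * m \<in> span l'"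
  shows "g * p \<in> span l'"
  using assms(1)
proof (induction rule: span.induct)
  case (span_add_rep p T m a)
  then have "scal a * (g * m) + g * p \<in> span l'" using assms(3) by (intro span_add span_scal) auto
  then show ?case by (simp add: distrib_left mult_scal_left)
qed (use assms in \<open>auto intro!: span_I I_mult\<close>)

text \<open>Only an ascent leads to a new shuffle. All other generators push the product for T
  strictly down in the filtration by inversions: \<open>span (inv_count T)\<close> admits only
  shuffles with fewer inversions than T.\<close>

definition good :: "bool list \<Rightarrow> bool" where
  "good T \<longleftrightarrow> (\<forall>m :: 'k free_klr. rep K N T m \<longrightarrow> (\<forall>t. 1 \<le> t \<longrightarrow> t \<le> n \<longrightarrow> fY t * m \<in> span (inv_count T)) \<and>
     (\<forall>u b w. T = u @ b # b # w \<longrightarrow> fPsi (Suc (length u)) * m \<in> span (inv_count T)) \<and>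
     (\<forall>u w. T = u @ True # False # w \<longrightarrow> fPsi (Suc (length u)) * m \<in> span (inv_count T)))"

lemma good_span:
  assumes "\<And>T. inv_count T < l \<Longrightarrow> good T" and "p \<in> span l"
  shows "1 \<le> t \<Longrightarrow> t \<le> n \<Longrightarrow> fY t * p \<in> span (l - 1)" and "1 \<le> t \<Longrightarrow> t < n \<Longrightarrow> fPsi t * p \<in> span (Suc l)"
proof -
  assume t: "1 \<le> t" "t \<le> n"
  show "fY t * p \<in> span (l - 1)"
  proof (rule span_mult[OF assms(2)])
    fix T and m :: "'k free_klr" assume T: "rep K N T m" "inv_count T < l"
    then show "fY t * m \<in> span (l - 1)" using assms(1)[OF T(2)] t
      unfolding good_def by (auto intro: span_mono[of _ "inv_count T"])
  qed (use t fY_C in auto)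
next
  assume t: "1 \<le> t" "t < n"
  show "fPsi t * p \<in> span (Suc l)"
  proof (rule span_mult[OF assms(2)])
    fix T and m :: "'k free_klr" assume T: "rep K N T m" "inv_count T < l"
    then have "t < length T" using rep_length[of K N T m] t size_content by simp
    then obtain u a b w where u: "T = u @ a # b # w" "t = Suc (length u)" using split_at_pair[of t T] t by auto
    show "fPsi t * m \<in> span (Suc l)"
    proof (cases "\<not> a \<and> b")
      case True
      then have "rep K N (u @ True # False # w) (fPsi t * m)" using rep_step[of K N u w m] T u by simp
      moreover have "inv_count (u @ True # False # w) < Suc l" using inv_count_swap[of u w] T u True by simp
      ultimately show ?thesis by (rule span_rep)
    next
      case False
      then have "fPsi t * m \<in> span (inv_count T)" using assms(1)[OF T(2)] T(1) u unfolding good_def by (cases a; cases b) auto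
      then show ?thesis using T by (auto intro: span_mono)
    qed
  qed (use t fPsi_C in auto)
qed

lemma quad_span:
  assumes "p \<in> span l" "\<And>t. 1 \<le> t \<Longrightarrow> t \<le> n \<Longrightarrow> fY t * p \<in> span l" "1 \<le> t" "t < n"
  shows "quad_term e js t * p \<in> span l"
  using assms assms(2)[of t] assms(2)[of "t + 1"] span_add[of "fY (t + 1) * p" l "- (fY t * p)"]
    span_add[of "fY t * p" l "- (fY (t + 1) * p)"] span_uminus[of "fY t * p" l] span_uminus[of "fY (t + 1) * p" l]
  by (auto simp: quad_term_def left_diff_distrib intro: span_I)

lemma braid_span: "p \<in> span l \<Longrightarrow> braid_term e js t * p \<in> span l"
  using span_uminus[of p l] by (auto simp: braid_term_def intro: span_I)

text \<open>Induction on inversions. With m equal to psi_s m', the generator is carried past psi_s.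
  What acts on m' is covered by the induction hypothesis, and the correction terms are multiples of
  elements with fewer inversions.\<close>

lemma good_all: "good T"
proof (induction "inv_count T" arbitrary: T rule: less_induct)
  case less
  show ?case unfolding good_def
  proof (intro allI impI conjI)
    fix m :: "'k free_klr" assume T: "rep K N T m"
    { fix t assume t: "1 \<le> t" "t \<le> n"
      from T show "fY t * m \<in> span (inv_count T)"
      proof (cases rule: rep_cases)
        case top
        then show ?thesis using top_y[of t] t size_content by (auto intro: span_I)
      next
        case (step u w m')
        let ?s = "Suc (length u)" and ?l = "inv_count (u @ False # True # w)"
        have s: "1 \<le> ?s" "?s < n" using rep_index[OF step(3)] by auto
        have l: "inv_count T = Suc ?l" using step inv_count_swap by simp
        have m': "m' \<in> span (Suc ?l)" using span_rep[OF step(3)] by simp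
        have Y: "fY t' * m' \<in> span ?l" if "1 \<le> t'" "t' \<le> n" for t'
          using less.hyps[of "u @ False # True # w"] l step(3) that unfolding good_def by auto
        have PY: "fPsi ?s * (fY t' * m') \<in> span (Suc ?l)" if "1 \<le> t'" "t' \<le> n" for t'
          using less.hyps l s by (intro good_span(2)[OF _ Y[OF that]]) auto
        have d: "(if b then m' else 0) \<in> span (Suc ?l)" for b using m' by (auto intro: span_I)
        note w = rep_wt[OF step(3)]
        consider "t = ?s" | "t = ?s + 1" | "t \<noteq> ?s" "t \<noteq> ?s + 1" by blast
        then show ?thesis
        proof cases
          case 1
          show ?thesis unfolding 1 l step(2)
            using PY[of "?s + 1"] d s by (intro span_eqv[OF eqv_move[OF psi_y[OF w s]]] span_add span_uminus) auto
        next
          case 2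
          show ?thesis unfolding 2 l step(2)
            using PY[of ?s] d s by (intro span_eqv[OF y_psi[OF w s]] span_add) auto
        next
          case 3
          have "fY t * (fPsi ?s * m') \<approx> fPsi ?s * (fY t * m')"
            using 3 t s rep_C[OF step(3)] by (intro eqv_sym[OF psi_y_far]) auto
          then show ?thesis unfolding l step(2) using PY[OF t] span_eqv by blast
        qed
      qed }
    { fix u b w assume uT: "T = u @ b # b # w"
      let ?t = "Suc (length u)"
      have t: "1 \<le> ?t" "?t < n" using rep_index T uT by blast+
      from T show "fPsi ?t * m \<in> span (inv_count T)"
      proof (cases rule: rep_cases)
        case top
        have "?t \<noteq> K"
        proof
          assume "?t = K"
          then have "top_word K N ! length u \<noteq> top_word K N ! Suc (length u)"
            using t size_content by (simp add: top_word_def nth_append)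
          then show False using top uT by (metis nth_append_length append.assoc append_Cons append_Nil length_append_singleton)
        qed
        then show ?thesis using top_psi[of ?t] top t size_content by (auto intro: span_I)
      next
        case (step u' w' m')
        let ?s = "Suc (length u')" and ?T' = "u' @ False # True # w'" 
        have s: "1 \<le> ?s" "?s < n" using rep_index[OF step(3)] by auto
        have l: "inv_count T = Suc (inv_count ?T')" using step inv_count_swap by simp
        have P: "fPsi ?s * p \<in> span (inv_count T)" if "p \<in> span (inv_count ?T')" for p
          using that less.hyps l s by (intro span_mono[OF good_span(2)[OF _ that]]) auto
        have far: "fPsi ?t * m \<in> span (inv_count T)" if "?t + 1 < ?s \<or> ?s + 1 < ?t" "fPsi ?t * m' \<in> span (inv_count ?T')"
        proof -
          have "fPsi ?t * (fPsi ?s * m') \<approx> fPsi ?s * (fPsi ?t * m')"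
            using that t s rep_C[OF step(3)] by (intro psi_psi_far) auto
          then show ?thesis using P[OF that(2)] span_eqv step by blast
        qed
        have G: "fPsi (Suc (length v)) * m'' \<in> span (inv_count T'')"
          if "rep K N T'' m''" "T'' = v @ c # c # z" "inv_count T'' < inv_count T" for v T'' c z and m'' :: "'k free_klr"
          using less.hyps[OF that(3)] that unfolding good_def by blast
        from step(1)[unfolded uT] show ?thesis
        proof (cases rule: pair_split_cases)
          case (2 v)
          then show ?thesis using l G[OF step(3), of u b "v @ False # True # w'"] by (intro far) auto
        next
          case (3 v)
          then show ?thesis using l G[OF step(3), of "u' @ False # True # v" b w] by (intro far) auto
        next
          case 4
          \<comment> \<open>T has True True False where m'' has False True True, and m is psi_{t+1}
            psi_t m''. The braid relation moves the outer psi onto the equal pair of m''.\<close>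
          then have T': "?T' = (u @ [b]) @ False # True # w'" "b" by auto
          have "rep K N ((u @ [b]) @ False # True # w') m'" using step(3) T' by simp
          then have "rep K N (u @ True # False # True # w') m'" using T' by simp
          then obtain m'' where m'': "rep K N (u @ False # True # True # w') m''" "m' \<approx> fPsi ?t * m''" by (rule rep_descent)
          have s': "?s = ?t + 1" using 4 by simp
          have l2: "inv_count ?T' = Suc (inv_count (u @ False # True # True # w'))" using T' inv_count_swap by simp
          have "fPsi ?t * m = fPsi ?t * (fPsi (?t + 1) * m')" using step s' by simp
          also have "\<dots> \<approx> fPsi ?t * (fPsi (?t + 1) * (fPsi ?t * m''))"
            using m''(2) t s s' by (intro eqv_mult fPsi_C) auto
          also have "\<dots> \<approx> fPsi (?t + 1) * (fPsi ?t * (fPsi (?t + 1) * m'')) + braid_term e (seq (u @ False # True # True # w')) ?t * m''"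
            using t s s' by (intro psi_braid rep_wt[OF m''(1)]) auto
          finally have E: "fPsi ?t * m \<approx> \<dots>" .
          have Z: "fPsi (?t + 1) * m'' \<in> span (inv_count (u @ False # True # True # w'))"
            using G[OF m''(1), of "u @ [False]" True w'] l l2 by simp
          have "fPsi ?t * (fPsi (?t + 1) * m'') \<in> span (inv_count ?T')"
            using less.hyps l l2 t by (intro span_mono[OF good_span(2)[OF _ Z]]) auto
          then have "fPsi (?t + 1) * (fPsi ?t * (fPsi (?t + 1) * m'')) \<in> span (inv_count T)"
            using P s' by simp
          moreover have "m'' \<in> span (inv_count T)" using m''(1) l l2 by (intro span_rep) auto
          ultimately show ?thesis using E by (intro span_eqv[OF E] span_add braid_span)
        next
          case 5
          \<comment> \<open>The mirror image of the preceding case: T has True False False where m''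
            has False False True.\<close>
          then have w: "w' = b # w" "\<not> b" "u = u' @ [True]" by auto
          have T': "?T' = (u' @ [False]) @ True # False # w" using w by simp
          have "rep K N ((u' @ [False]) @ True # False # w) m'" using step(3) w by simp
          then obtain m'' where m'': "rep K N ((u' @ [False]) @ False # True # w) m''" "m' \<approx> fPsi (Suc (length (u' @ [False]))) * m''"
            by (rule rep_descent)
          let ?T'' = "u' @ False # False # True # w"
          have r: "rep K N ?T'' m''" using m''(1) by simp
          have t': "?t = ?s + 1" using w by simp
          have l2: "inv_count ?T' = Suc (inv_count ?T'')" using inv_count_swap[of "u' @ [False]" w] T' by simp
          have "fPsi ?t * m = fPsi ?t * (fPsi ?s * m')" using step by simp
          also have "\<dots> \<approx> fPsi ?t * (fPsi ?s * (fPsi ?t * m''))"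
            using m''(2) t s w by (intro eqv_mult fPsi_C) auto
          finally have E1: "fPsi ?t * m \<approx> fPsi (?s + 1) * (fPsi ?s * (fPsi (?s + 1) * m''))" using t' by simp
          have E2: "fPsi ?s * (fPsi (?s + 1) * (fPsi ?s * m'')) \<approx>
              fPsi (?s + 1) * (fPsi ?s * (fPsi (?s + 1) * m'')) + braid_term e (seq ?T'') ?s * m''"
            using t s t' by (intro psi_braid rep_wt[OF r]) auto
          have Z: "fPsi ?s * m'' \<in> span (inv_count ?T'')"
            using G[OF r, of u' False "True # w"] l l2 by simp
          have "fPsi (?s + 1) * (fPsi ?s * m'') \<in> span (inv_count ?T')"
            using less.hyps l l2 t t' by (intro span_mono[OF good_span(2)[OF _ Z]]) auto
          then have X: "fPsi ?s * (fPsi (?s + 1) * (fPsi ?s * m'')) \<in> span (inv_count T)"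
            by (rule P)
          have "m'' \<in> span (inv_count T)" using r l l2 by (intro span_rep) auto
          then have "fPsi ?s * (fPsi (?s + 1) * (fPsi ?s * m'')) + - (braid_term e (seq ?T'') ?s * m'') \<in> span (inv_count T)"
            using X by (intro span_add span_uminus braid_span)
          moreover have "fPsi ?t * m \<approx> fPsi ?s * (fPsi (?s + 1) * (fPsi ?s * m'')) + - (braid_term e (seq ?T'') ?s * m'')"
            by (rule eqv_trans[OF E1 eqv_move[OF E2]])
          ultimately show ?thesis using span_eqv by blast
        qed auto
      qed }
    { fix u w assume uT: "T = u @ True # False # w"
      let ?t = "Suc (length u)" and ?T' = "u @ False # True # w"
      obtain m' where m': "rep K N ?T' m'" "m \<approx> fPsi ?t * m'" using rep_descent T uT by blast
      have t: "1 \<le> ?t" "?t < n" using rep_index m'(1) by blast+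
      have l: "inv_count T = Suc (inv_count ?T')" using uT inv_count_swap by simp
      have "fPsi ?t * m \<approx> fPsi ?t * (fPsi ?t * m')" using m' t by (intro eqv_mult fPsi_C) auto
      also have "\<dots> \<approx> quad_term e (seq ?T') ?t * m'" using psi_psi[OF rep_wt[OF m'(1)]] t by auto
      finally have E: "fPsi ?t * m \<approx> quad_term e (seq ?T') ?t * m'" .
      have Y: "fY s * m' \<in> span (inv_count T)" if "1 \<le> s" "s \<le> n" for s
      proof -
        have "fY s * m' \<in> span (inv_count ?T')"
          using less.hyps[of ?T'] l m'(1) that unfolding good_def by auto
        then show ?thesis using l by (auto intro: span_mono)
      qed
      show "fPsi ?t * m \<in> span (inv_count T)"
        using l t by (intro span_eqv[OF E quad_span[OF span_rep[OF m'(1)] Y]]) auto }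
  qed
qed

lemma span_gen:
  assumes "g \<in> klr_gens \<alpha>" "p \<in> span l"
  shows "fgen g * p \<in> span (Suc l)"
proof (cases g)
  case (GenE js)
  then have js: "js \<in> res_seqs \<alpha>" using assms by (auto simp: klr_gens_def)
  have "fE js * p \<in> span (Suc l)"
  proof (rule span_mult[OF assms(2) fE_C[OF js]])
    fix T and m :: "'k free_klr" assume T: "rep K N T m" "inv_count T < l"
    show "fE js * m \<in> span (Suc l)"
      using span_rep[OF T(1), of "Suc l"] T(2)
      by (intro span_eqv[OF fE_wt[OF rep_wt[OF T(1)] js]]) (auto intro: span_I)
  qed
  then show ?thesis using GenE by simp
next
  case (GenY t)
  then have "fY t * p \<in> span (l - 1)" using assms by (intro good_span(1)[OF good_all]) (auto simp: klr_gens_def)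
  then show ?thesis using GenY by (auto intro: span_mono)
next
  case (GenPsi t)
  then show ?thesis using assms good_span(2)[OF good_all assms(2), of t] by (auto simp: klr_gens_def)
qed

lemma span_word: "set ls \<subseteq> klr_gens \<alpha> \<Longrightarrow> \<exists>l. Poly_Mapping.single (Word ls) a \<in> span l"
proof (induction ls)
  case Nil
  have "scal a * 1 + 0 \<in> span 1"
    by (intro span_add_rep[OF _ rep_top] span_I I_zero) (simp add: inv_top_word)
  then show ?case by (auto simp: zero_word_def)
next
  case (Cons g ls)
  then obtain l where "Poly_Mapping.single (Word ls) a \<in> span l" by auto
  from span_gen[OF _ this, of g] Cons.prems
  have "fgen g * Poly_Mapping.single (Word ls) a \<in> span (Suc l)" by auto
  then show ?case by (auto simp: fgen_def mult_single plus_word_def)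
qed

lemma span_all: "p \<in> C \<Longrightarrow> \<exists>l. p \<in> span l"
proof (induction p rule: free_algebra_induct)
  case zero
  show ?case using span_I[OF I_zero] by blast
next
  case (add p q)
  then obtain l l' where "p \<in> span l" "q \<in> span l'" by auto
  then show ?case using span_add[of p "max l l'" q] by (meson max.cobounded1 max.cobounded2 span_mono)
next
  case (single w a)
  then show ?case using span_word[of "letters w" a] by simp
qed

definition shuffle_words :: "bool list set" where "shuffle_words = {T. nF T = K \<and> nT T = N}"

definition canon :: "bool list \<Rightarrow> 'k free_klr" where "canon T = (SOME m. rep K N T m)"

lemma canon: "T \<in> shuffle_words \<Longrightarrow> rep K N T (canon T)"
  unfolding canon_def shuffle_words_def by (rule someI_ex) (auto intro: rep_exists)

lemma finite_shuffle_words: "finite shuffle_words"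
proof (rule finite_subset)
  show "shuffle_words \<subseteq> {T. set T \<subseteq> UNIV \<and> length T = K + N}"
    using nF_nT by (auto simp: shuffle_words_def)
qed (rule finite_lists_length_eq, simp)

lemma linear_combination:
  assumes "p \<in> C"
  obtains a where "p \<approx> (\<Sum>T\<in>shuffle_words. scal (a T) * canon T)"
proof -
  obtain l where "p \<in> span l" using span_all[OF assms] by blast
  then have "\<exists>a. p \<approx> (\<Sum>T\<in>shuffle_words. scal (a T) * canon T)"
  proof (induction rule: span.induct)
    case (span_I p)
    then show ?case by (intro exI[of _ "\<lambda>_. 0"]) (simp add: eqv_def)
  next
    case (span_add_rep p T m b)
    then obtain a where a: "p \<approx> (\<Sum>T\<in>shuffle_words. scal (a T) * canon T)" by blast
    have T: "T \<in> shuffle_words" using rep_counts[OF span_add_rep(2)] by (simp add: shuffle_words_def)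
    have "scal b * m + p \<approx> scal b * canon T + (\<Sum>T\<in>shuffle_words. scal (a T) * canon T)"
      using rep_unique[OF span_add_rep(2) canon[OF T]] a by (intro eqv_add eqv_mult scal_closed)
    also have "\<dots> = (\<Sum>U\<in>shuffle_words. scal (if U = T then b else 0) * canon U) + (\<Sum>T\<in>shuffle_words. scal (a T) * canon T)"
      using T finite_shuffle_words by (simp add: if_distrib[of "\<lambda>c. scal c * _"] cong: if_cong)
    also have "\<dots> = (\<Sum>U\<in>shuffle_words. scal ((if U = T then b else 0) + a U) * canon U)"
      by (simp add: single_add distrib_right sum.distrib)
    finally show ?case by (intro exI[of _ "\<lambda>U. (if U = T then b else 0) + a U"])
  qed
  then show ?thesis using that by blast
qed

end

section \<open>Garnir elements of a two-row partition\<close>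

lemma mod_eq_close:
  assumes "e = 0 \<or> \<bar>a - b\<bar> < int e"
  shows "a mod int e = b mod int e \<longleftrightarrow> a = b"
  using assms zdvd_imp_le[of "int e" "\<bar>a - b\<bar>"]
  by (cases "e = 0"; cases "a = b") (auto simp: mod_eq_dvd_iff)

lemma arrow_close:
  assumes "e = 0 \<or> \<bar>b - (a + 1)\<bar> < int e"
  shows "arrow e (a mod int e) (b mod int e) \<longleftrightarrow> b = a + 1"
proof -
  have "arrow e (a mod int e) (b mod int e) \<longleftrightarrow> b mod int e = (a + 1) mod int e"
    by (auto simp: arrow_def vertices_def mod_simps)
  then show ?thesis using mod_eq_close[OF assms] by simp
qed

text \<open>For d = 0 this is the ballot condition: no prefix has more True than False. For rows
  starting at i and i - 1 it means that the tokens never meet, which singles out the shuffles of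
  standard tableaux of shape (k, r).\<close>

fun below :: "int \<Rightarrow> bool list \<Rightarrow> bool" where
  "below d [] = (0 \<le> d)"
| "below d (b # T) = (0 \<le> d \<and> below (if b then d - 1 else d + 1) T)"

lemma below_append [simp]: "below d (u @ w) \<longleftrightarrow> below d u \<and> below (d + int (nF u) - int (nT u)) w"
proof (induction u arbitrary: d)
  case Nil
  then show ?case by (cases w) auto
next
  case (Cons b u)
  have "d + 1 + int (nF u) - int (nT u) = d + int (nF u) + 1 - int (nT u)"
    "d - 1 + int (nF u) - int (nT u) = d + int (nF u) - (1 + int (nT u))" by simp_all
  then show ?case using Cons by (simp add: algebra_simps)
qed

lemma below_nonneg: "below d T \<Longrightarrow> 0 \<le> d" by (cases T) auto

lemma below_replicate_F [simp]: "below d (replicate m False) \<longleftrightarrow> 0 \<le> d"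
proof (induction m arbitrary: d)
  case (Suc m)
  show ?case unfolding replicate_Suc below.simps Suc.IH by auto
qed simp

lemma below_replicate_T [simp]: "below d (replicate m True) \<longleftrightarrow> int m \<le> d"
proof (induction m arbitrary: d)
  case (Suc m)
  show ?case unfolding replicate_Suc below.simps Suc.IH by auto
qed simp

lemma below_lower: "below d (u @ True # False # w) \<Longrightarrow> below d (u @ False # True # w)"
  by auto

context two_row begin

definition letter :: "bool list \<Rightarrow> bool \<Rightarrow> int" where
  "letter u b = (if b then y + int (nT u) else x + int (nF u))"

lemma entry_seq:
  "entry (seq (u @ a # w)) (Suc (length u)) = letter u a mod int e"
  "entry (seq (u @ a # b # w)) (Suc (Suc (length u))) = letter (u @ [a]) b mod int e"
  "entry (seq (u @ a # b # c # w)) (Suc (Suc (Suc (length u)))) = letter (u @ [a, b]) c mod int e"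
  by (simp_all add: entry_def seq_def letter_def nth_append algebra_simps)

lemma rep_bounds: "rep K N (u @ w) (m :: 'k free_klr) \<Longrightarrow> nF u \<le> K \<and> nT u \<le> N"
  using rep_counts[of K N "u @ w" m] by auto

lemma braid_zero:
  assumes "rep K N (u @ a # b # c # w) (m :: 'k free_klr)" "letter u a mod int e \<noteq> letter (u @ [a, b]) c mod int e"
  shows "braid_term e (seq (u @ a # b # c # w)) (Suc (length u)) = 0"
  using assms by (simp add: braid_term_def entry_seq numeral_2_eq_2)

end

locale first_row_ideal = two_row e \<alpha> I k r i "i - 1"
  for e k r :: nat and i :: int and \<alpha> and I :: "'k::field free_klr set" +
  assumes r1: "1 \<le> r" and rk: "r \<le> k" and e_large: "e = 0 \<or> k + r + 5 \<le> e"
begin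

text \<open>All these letters lie between i - 1 and i + k. Comparing them up to a shift by one needs
  e > k + 2, which the bound on e grants with room to spare.\<close>

lemma letters_eq_iff:
  assumes "rep k r (u @ w) (m :: 'k free_klr)" "rep k r (u' @ w') (m :: 'k free_klr)"
  shows "letter u a mod int e = letter u' b mod int e \<longleftrightarrow> letter u a = letter u' b"
    "arrow e (letter u a mod int e) (letter u' b mod int e) \<longleftrightarrow> letter u' b = letter u a + 1"
  using e_large rep_bounds[OF assms(1)] rep_bounds[OF assms(2)]
  by (intro mod_eq_close arrow_close; auto simp: letter_def)+

text \<open>As the tokens never meet, the letters exchanged by a step differ and so do the outer
  letters of each braid that occurs. All correction terms vanish, and the generator can be carried
  down until it meets a relation of the top word.\<close>

lemma noncrossing:
  assumes "rep k r T m" "below 0 T"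
  shows "(\<forall>t. 1 \<le> t \<longrightarrow> t \<le> n \<longrightarrow> fY t * m \<in> I) \<and>
     (\<forall>u b w. T = u @ b # b # w \<longrightarrow> fPsi (Suc (length u)) * m \<in> I)"
  using assms
proof (induction "inv_count T" arbitrary: T m rule: less_induct)
  case less
  note T = less.prems
  have IH: "(\<forall>t. 1 \<le> t \<longrightarrow> t \<le> n \<longrightarrow> fY t * m' \<in> I) \<and>
     (\<forall>u b w. T' = u @ b # b # w \<longrightarrow> fPsi (Suc (length u)) * m' \<in> I)"
    if "rep k r T' m'" "below 0 T'" "inv_count T' < inv_count T" for T' m'
    using less.hyps that by blast
  have IHP: "fPsi (Suc (length v)) * m' \<in> I"
    if "rep k r T' m'" "below 0 T'" "inv_count T' < inv_count T" "T' = v @ c # c # z" for T' m' v c z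
    using IH[OF that(1-3)] that(4) by blast
  have PI: "fPsi t * p \<in> I" if "p \<in> I" "1 \<le> t" "t < n" for p t
    using that by (intro I_mult fPsi_C) auto
  show ?case
  proof (intro conjI allI impI)
    fix t assume t: "1 \<le> t" "t \<le> n"
    from T(1) show "fY t * m \<in> I"
    proof (cases rule: rep_cases)
      case top
      then show ?thesis using top_y[of t] t size_content by simp
    next
      case (step u w m')
      let ?T' = "u @ False # True # w" and ?s = "Suc (length u)"
      have s: "1 \<le> ?s" "?s < n" using rep_index[OF step(3)] by auto
      have Y: "fY t' * m' \<in> I" if "1 \<le> t'" "t' \<le> n" for t'
        using IH[OF step(3)] T(2) step(1) inv_count_swap[of u w] that by auto
      \<comment> \<open>T continues \<open>u\<close> with True, so the ballot condition leaves a
        False to spare after \<open>u\<close>. Hence the first row's letter is strictly larger than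
        the second row's.\<close>
      have "0 \<le> int (nF u) - int (nT u) - 1" using T(2) step(1) by (auto dest: below_nonneg)
      then have "letter u False \<noteq> letter (u @ [False]) True" by (simp add: letter_def)
      then have ne: "entry (seq ?T') ?s \<noteq> entry (seq ?T') (?s + 1)"
        using letters_eq_iff(1)[of u _ m' "u @ [False]"] step(3) by (simp add: entry_seq)
      note w = rep_wt[OF step(3)]
      consider "t = ?s" | "t = ?s + 1" | "t \<noteq> ?s" "t \<noteq> ?s + 1" by blast
      then show ?thesis
      proof cases
        case 1
        have "fPsi ?s * (fY (?s + 1) * m') \<approx> fY ?s * (fPsi ?s * m')"
          using psi_y[OF w s] ne by simp
        then show ?thesis using eqv_I'[OF _ PI[OF Y[of "?s + 1"] s]] s 1 step(2) by simp
      next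
        case 2
        have "fY (?s + 1) * (fPsi ?s * m') \<approx> fPsi ?s * (fY ?s * m')"
          using y_psi[OF w s] ne by simp
        then show ?thesis using eqv_I[OF _ PI[OF Y[of ?s] s]] s 2 step(2) by simp
      next
        case 3
        have "fPsi ?s * (fY t * m') \<approx> fY t * (fPsi ?s * m')"
          using 3 t s rep_C[OF step(3)] by (intro psi_y_far) auto
        then show ?thesis using eqv_I'[OF _ PI[OF Y[OF t] s]] step(2) by simp
      qed
    qed
  next
    fix u b w assume uT: "T = u @ b # b # w"
    let ?t = "Suc (length u)"
    have t: "1 \<le> ?t" "?t < n" using rep_index T(1) uT by blast+
    from T(1) show "fPsi ?t * m \<in> I"
    proof (cases rule: rep_cases)
      case top
      have "?t \<noteq> k"
      proof
        assume "?t = k"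
        then have "top_word k r ! length u \<noteq> top_word k r ! Suc (length u)"
          using t size_content by (simp add: top_word_def nth_append)
        then show False using top uT by (metis nth_append_length append.assoc append_Cons append_Nil length_append_singleton)
      qed
      then show ?thesis using top_psi[of ?t] top t size_content by simp
    next
      case (step u' w' m')
      let ?s = "Suc (length u')" and ?T' = "u' @ False # True # w'"
      have s: "1 \<le> ?s" "?s < n" using rep_index[OF step(3)] by auto
      have l: "inv_count T = Suc (inv_count ?T')" using step inv_count_swap by simp
      have b': "below 0 ?T'" using T(2) step(1) below_lower by blast
      have far: "fPsi ?t * m \<in> I" if "?t + 1 < ?s \<or> ?s + 1 < ?t" "fPsi ?t * m' \<in> I"
      proof -
        have "fPsi ?t * (fPsi ?s * m') \<approx> fPsi ?s * (fPsi ?t * m')"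
          using that t s rep_C[OF step(3)] by (intro psi_psi_far) auto
        then show ?thesis using eqv_I[OF _ PI[OF that(2) s]] step(2) by simp
      qed
      from step(1)[unfolded uT] show ?thesis
      proof (cases rule: pair_split_cases)
        case (2 v)
        then have "?T' = u @ b # b # (v @ False # True # w')" by simp
        then have "fPsi ?t * m' \<in> I" using l by (intro IHP[OF step(3) b']) auto
        then show ?thesis using 2 by (intro far) auto
      next
        case (3 v)
        then have "?T' = (u' @ False # True # v) @ b # b # w" by simp
        then have "fPsi ?t * m' \<in> I"
          using l 3 IHP[OF step(3) b', of "u' @ False # True # v" b w] by simp
        then show ?thesis using 3 by (intro far) auto
      next
        case 4
        let ?T'' = "u @ False # True # True # w'"
        have T': "?T' = u @ True # False # True # w'" using 4 by simp
        then have "rep k r (u @ True # False # True # w') m'" using step(3) by simp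
        then obtain m'' where m'': "rep k r ?T'' m''" "m' \<approx> fPsi ?t * m''" by (rule rep_descent)
        have s': "?s = ?t + 1" using 4 by simp
        have l2: "inv_count ?T' = Suc (inv_count ?T'')" using T' inv_count_swap by simp
        have b'': "below 0 ?T''" using b' T' below_lower[of 0 u "True # w'"] by simp
        have "0 \<le> int (nF u) - int (nT u) - 1" using b'' by (auto dest: below_nonneg)
        then have "letter u False \<noteq> letter (u @ [False, True]) True" by (simp add: letter_def)
        then have B: "braid_term e (seq ?T'') ?t = 0" using m''(1)
            letters_eq_iff(1)[of u _ m'' "u @ [False, True]"] by (intro braid_zero) auto
        have "fPsi ?t * (fPsi (?t + 1) * m') \<approx> fPsi ?t * (fPsi (?t + 1) * (fPsi ?t * m''))"
          using m''(2) t s s' by (intro eqv_mult fPsi_C) auto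
        also have "\<dots> \<approx> fPsi (?t + 1) * (fPsi ?t * (fPsi (?t + 1) * m''))"
          using psi_braid[OF rep_wt[OF m''(1)], of ?t] t s s' by (simp add: B)
        finally have E: "fPsi ?t * m \<approx> fPsi (?t + 1) * (fPsi ?t * (fPsi (?t + 1) * m''))"
          using step(2) s' by simp
        have "inv_count ?T'' < inv_count T" using l l2 by linarith
        moreover have "?T'' = (u @ [False]) @ True # True # w'" by simp
        ultimately have "fPsi (Suc (length (u @ [False]))) * m'' \<in> I" by (rule IHP[OF m''(1) b''])
        then have X: "fPsi (?t + 1) * m'' \<in> I" by simp
        have "fPsi (?t + 1) * (fPsi ?t * (fPsi (?t + 1) * m'')) \<in> I"
          using t s s' by (intro PI[OF PI[OF X]]) auto
        then show ?thesis by (rule eqv_I[OF E])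
      next
        case 5
        let ?T'' = "u' @ False # False # True # w"
        have w: "w' = False # w" "\<not> b" "u = u' @ [True]" using 5 by auto
        have T': "?T' = (u' @ [False]) @ True # False # w" using w by simp
        then have "rep k r ((u' @ [False]) @ True # False # w) m'" using step(3) by simp
        then obtain m'' where m'': "rep k r ((u' @ [False]) @ False # True # w) m''"
          "m' \<approx> fPsi (Suc (length (u' @ [False]))) * m''" by (rule rep_descent)
        have r'': "rep k r ?T'' m''" using m''(1) by simp
        have t': "?t = ?s + 1" using w by simp
        have l2: "inv_count ?T' = Suc (inv_count ?T'')" using inv_count_swap[of "u' @ [False]" w] T' by simp
        have b'': "below 0 ?T''" using b' T' below_lower[of 0 "u' @ [False]" w] by simp
        have "0 \<le> int (nF u') - int (nT u') - 1" using T(2) step(1) by (auto dest: below_nonneg)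
        then have "letter u' False \<noteq> letter (u' @ [False, False]) True" by (simp add: letter_def)
        then have B: "braid_term e (seq ?T'') ?s = 0" using r''
            letters_eq_iff(1)[of u' _ m'' "u' @ [False, False]"] by (intro braid_zero) auto
        have "fPsi ?t * (fPsi ?s * m') \<approx> fPsi (?s + 1) * (fPsi ?s * (fPsi (?s + 1) * m''))"
          using m''(2) t s t' w by (auto intro!: eqv_mult fPsi_C)
        also have "\<dots> \<approx> fPsi ?s * (fPsi (?s + 1) * (fPsi ?s * m''))"
          using eqv_sym[OF psi_braid[OF rep_wt[OF r''], of ?s]] t s t' by (simp add: B)
        finally have E: "fPsi ?t * m \<approx> fPsi ?s * (fPsi (?s + 1) * (fPsi ?s * m''))" using step(2) by simp
        have "inv_count ?T'' < inv_count T" using l l2 by linarith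
        then have X: "fPsi ?s * m'' \<in> I" by (rule IHP[OF r'' b'']) (rule refl)
        have "fPsi ?s * (fPsi (?s + 1) * (fPsi ?s * m'')) \<in> I" using t s t' by (intro PI[OF PI[OF X]]) auto
        then show ?thesis by (rule eqv_I[OF E])
      qed auto
    qed
  qed
qed

end

context first_row_ideal begin

text \<open>The Garnir tableau of B_1 has 1 at the start of the second row, followed by the whole
  first row. The residues of these k + 1 letters run from i - 1 to i + k - 1, as along the first row
  of \<lambda>_1.\<close>

definition crossing_word :: "bool list" where
  "crossing_word = True # replicate k False @ replicate (r - 1) True"

lemma I_psi: "p \<in> I \<Longrightarrow> 1 \<le> t \<Longrightarrow> t < n \<Longrightarrow> fPsi t * p \<in> I"
  by (intro I_mult fPsi_C) auto

text \<open>U is psi_1 m with m noncrossing. Most generators pass psi_1 and kill m. The others meet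
  psi_1^2 = y_1 - y_2, or, for t = 2, a braid relation without correction. The excluded place k + 1
  is where the first row of \<lambda>_1 ends.\<close>

lemma crossing_relations:
  assumes "rep k r crossing_word U"
  shows "1 \<le> t \<Longrightarrow> t \<le> n \<Longrightarrow> fY t * U \<in> I"
    and "1 \<le> t \<Longrightarrow> t < n \<Longrightarrow> t \<noteq> k + 1 \<Longrightarrow> fPsi t * U \<in> I"
proof -
  define w where "w = replicate (k - 1) False @ replicate (r - 1) True"
  have "replicate k False = False # replicate (k - 1) False"
    using r1 rk by (simp flip: replicate_Suc)
  then have cw: "crossing_word = [] @ True # False # w"
    unfolding crossing_word_def w_def by simp
  obtain m where m: "rep k r ([] @ False # True # w) m" "U \<approx> fPsi 1 * m"
    using rep_descent[of "[]" w U] assms unfolding cw by auto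
  let ?T = "False # True # w"
  have rm: "rep k r ?T m" using m(1) by simp
  have b: "below 0 ?T" using r1 rk by (auto simp: w_def)
  have n: "1 < n" using rk r1 size_content by simp
  note w = rep_wt[OF rm]
  have Y: "fY t * m \<in> I" if "1 \<le> t" "t \<le> n" for t using noncrossing[OF rm b] that by blast
  have P: "fPsi (Suc (length u)) * m \<in> I" if "?T = u @ c # c # z" for u c z
    using noncrossing[OF rm b] that by blast
  have e1: "entry (seq ?T) 1 = letter [] False mod int e" using entry_seq(1)[of "[]" False "True # w"] by simp
  have e2: "entry (seq ?T) 2 = letter [False] True mod int e" using entry_seq(2)[of "[]" False True w]
    by (simp add: numeral_2_eq_2)
  have L: "letter [] False = i" "letter [False] True = i - 1" by (simp_all add: letter_def)
  have ne: "entry (seq ?T) 1 \<noteq> entry (seq ?T) 2" "\<not> arrow e (entry (seq ?T) 1) (entry (seq ?T) 2)"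
    "arrow e (entry (seq ?T) 2) (entry (seq ?T) 1)"
    unfolding e1 e2 L
    using e_large mod_eq_close[of e i "i - 1"] arrow_close[of e "i - 1" i] arrow_close[of e i "i - 1"]
    by (simp_all, auto)
  { assume t: "1 \<le> t" "t \<le> n"
    have "fY t * (fPsi 1 * m) \<in> I"
    proof -
      consider "t = 1" | "t = 1 + 1" | "t \<noteq> 1" "t \<noteq> 1 + 1" by blast
      then show ?thesis
      proof cases
        case 1
        have "fPsi 1 * (fY (1 + 1) * m) \<approx> fY 1 * (fPsi 1 * m)"
          using psi_y[OF w, of 1] n ne(1) by (simp add: numeral_2_eq_2)
        then show ?thesis unfolding 1 using I_psi[OF Y[of "1 + 1"], of 1] n eqv_I' by simp
      next
        case 2
        have "fY (1 + 1) * (fPsi 1 * m) \<approx> fPsi 1 * (fY 1 * m)"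
          using y_psi[OF w, of 1] n ne(1) by (simp add: numeral_2_eq_2)
        then show ?thesis unfolding 2 using I_psi[OF Y[of 1], of 1] n eqv_I by simp
      next
        case 3
        have "fPsi 1 * (fY t * m) \<approx> fY t * (fPsi 1 * m)"
          using 3 t n rep_C[OF rm] by (intro psi_y_far) auto
        then show ?thesis using I_psi[OF Y[OF t], of 1] n eqv_I' by simp
      qed
    qed
    then show "fY t * U \<in> I" using eqv_I[OF eqv_mult[OF fY_C m(2)]] t by blast }
  { assume t: "1 \<le> t" "t < n" "t \<noteq> k + 1"
    have "fPsi t * (fPsi 1 * m) \<in> I"
    proof -
      consider "t = 1" | "t = 2" | "3 \<le> t" using t by linarith
      then show ?thesis
      proof cases
        case 1
        have "fPsi 1 * (fPsi 1 * m) \<approx> quad_term e (seq ?T) 1 * m" using psi_psi[OF w, of 1] n by simp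
        also have "quad_term e (seq ?T) 1 = fY 1 - fY 2" using ne by (simp add: quad_term_def numeral_2_eq_2)
        finally show ?thesis unfolding 1 using Y[of 1] Y[of 2] n I_diff eqv_I by (simp add: left_diff_distrib)
      next
        case 2
        \<comment> \<open>For k = 1 the place 2 is the excluded place k + 1.\<close>
        then have "2 \<le> k" using t rk r1 by linarith
        then obtain k' where k': "k = Suc (Suc k')" by (metis One_nat_def Suc_1 Suc_le_D Suc_le_mono)
        define z where "z = replicate k' False @ replicate (r - 1) True"
        have "rep k r ([False] @ True # False # z) m" using rm by (simp add: w_def k' z_def)
        then obtain m' where m': "rep k r ([False] @ False # True # z) m'" "m \<approx> fPsi (Suc (length [False])) * m'"
          by (rule rep_descent)
        let ?T' = "[] @ False # False # True # z"
        have r': "rep k r ?T' m'" using m'(1) by simp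
        have b': "below 0 ?T'" using r1 rk k' by (auto simp: z_def)
        have "letter [] False \<noteq> letter ([] @ [False, False]) True" by (simp add: letter_def)
        then have B: "braid_term e (seq ?T') 1 = 0"
          using r' letters_eq_iff(1)[of "[]" _ m' "[] @ [False, False]"] braid_zero[of "[]" False False True z m']
          by auto
        have "fPsi (1 + 1) * (fPsi 1 * m) \<approx> fPsi (1 + 1) * (fPsi 1 * (fPsi (1 + 1) * m'))"
          using m'(2) n 2 t by (auto intro!: eqv_mult fPsi_C simp: numeral_2_eq_2)
        also have "\<dots> \<approx> fPsi 1 * (fPsi (1 + 1) * (fPsi 1 * m'))"
          using eqv_sym[OF psi_braid[OF rep_wt[OF r'], of 1, unfolded B]] n 2 t by (simp add: numeral_2_eq_2)
        finally have E: "fPsi t * (fPsi 1 * m) \<approx> fPsi 1 * (fPsi (1 + 1) * (fPsi 1 * m'))"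
          using 2 by (simp add: numeral_2_eq_2)
        have X: "fPsi 1 * m' \<in> I" using noncrossing[OF r' b'] by fastforce
        have "fPsi 1 * (fPsi (1 + 1) * (fPsi 1 * m')) \<in> I" using n 2 t by (intro I_psi[OF I_psi[OF X]]) auto
        then show ?thesis by (rule eqv_I[OF E])
      next
        case 3
        have "t < length ?T" using rep_length[OF rm] t size_content by simp
        then obtain u a c z where s: "?T = u @ a # c # z" "t = Suc (length u)" using split_at_pair[of t ?T] t by auto
        have "a = ?T ! length u" "c = ?T ! Suc (length u)" unfolding s(1) by (simp_all add: nth_append)
        moreover have "?T ! length u = w ! (length u - 2)" "?T ! Suc (length u) = w ! (length u - 1)"
          using s(2) 3 by (auto simp: nth_Cons' numeral_2_eq_2)
        moreover have "w ! (length u - 2) = w ! (length u - 1)"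
          using s(2) 3 t rk r1 size_content by (auto simp: w_def nth_append)
        ultimately have "a = c" by simp
        then have "fPsi t * m \<in> I" using P s by simp
        moreover have "fPsi t * (fPsi 1 * m) \<approx> fPsi 1 * (fPsi t * m)"
          using 3 t n rep_C[OF rm] by (intro psi_psi_far) auto
        ultimately show ?thesis using I_psi[of "fPsi t * m" 1] n eqv_I by simp
      qed
    qed
    then show "fPsi t * U \<in> I" using eqv_I[OF eqv_mult[OF fPsi_C m(2)]] t by blast }
qed

definition multiples :: "'k free_klr \<Rightarrow> 'k free_klr set" where
  "multiples U = {p \<in> C. \<exists>q \<in> C. p \<approx> q * U}"

lemma multiples_mult: "p \<in> multiples U \<Longrightarrow> g \<in> C \<Longrightarrow> g * p \<in> multiples U"
proof -
  assume "p \<in> multiples U" "g \<in> C"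
  then obtain q where q: "p \<in> C" "q \<in> C" "p \<approx> q * U" by (auto simp: multiples_def)
  then have "g * p \<approx> g * q * U" using eqv_mult[OF \<open>g \<in> C\<close> q(3)] by (simp add: mult.assoc)
  then show ?thesis using q \<open>g \<in> C\<close> by (auto simp: multiples_def intro!: free_algebra_mult_closed)
qed

lemma multiples_eqv: "p \<approx> q \<Longrightarrow> p \<in> C \<Longrightarrow> q \<in> multiples U \<Longrightarrow> p \<in> multiples U"
  using eqv_trans by (auto simp: multiples_def)

lemma multiples_uminus: "p \<in> multiples U \<Longrightarrow> - p \<in> multiples U"
proof -
  assume p: "p \<in> multiples U"
  have "- 1 \<in> C" by (intro free_algebra_uminus free_algebra_one)
  from multiples_mult[OF p this] show ?thesis by simp
qed

lemma raise_true:
  "rep k r (u @ replicate c False @ True # w) (m :: 'k free_klr) \<Longrightarrow>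
   \<exists>q \<in> C. rep k r (u @ True # replicate c False @ w) (q * m)"
proof (induction c arbitrary: w m)
  case 0
  then show ?case using free_algebra_one by (intro bexI[of _ 1]) auto
next
  case (Suc c)
  have "rep k r ((u @ replicate c False) @ False # True # w) m"
    using Suc.prems by (simp add: replicate_app_Cons_same)
  from rep_step[OF this] have R: "rep k r (u @ replicate c False @ True # False # w) (fPsi (Suc (length (u @ replicate c False))) * m)"
    by simp
  then obtain q where q: "q \<in> C"
    "rep k r (u @ True # replicate c False @ False # w) (q * (fPsi (Suc (length (u @ replicate c False))) * m))"
    using Suc.IH by blast
  have "fPsi (Suc (length (u @ replicate c False))) \<in> C"
    using rep_index[of "u @ replicate c False" True False w] R by (intro fPsi_C) auto
  then show ?case using q
    by (intro bexI[of _ "q * fPsi (Suc (length (u @ replicate c False)))"])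
      (auto simp: mult.assoc replicate_app_Cons_same intro!: free_algebra_mult_closed)
qed

text \<open>The letter at position p is the row that contains p in the Garnir tableau of the node
  (1, 1, b).\<close>

definition garnir_word :: "nat \<Rightarrow> bool list" where
  "garnir_word b = replicate (b - 1) False @ replicate b True @ replicate (k + 1 - b) False @ replicate (r - b) True"

text \<open>
  \<open>slide b j\<close> is \<open>garnir_word b\<close> with the last letter in front of the rising block moved to the
  right past \<open>j\<close> letters, whose residues are far from its own.
\<close>

definition slide :: "nat \<Rightarrow> nat \<Rightarrow> bool list" where
  "slide b j = replicate (b - 2) False @ replicate j True @ False # replicate (b - 2 - j) True @
     True # True # False # replicate (k - b) False @ replicate (r - b) True"

lemma slide_0: "2 \<le> b \<Longrightarrow> b \<le> r \<Longrightarrow> slide b 0 = garnir_word b"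
proof -
  assume b: "2 \<le> b" "b \<le> r"
  then obtain c d where c: "b = Suc (Suc c)" "k = b + d" using rk by (metis One_nat_def Suc_1 Suc_le_D Suc_le_mono le_add_diff_inverse order_trans)
  show ?thesis unfolding slide_def garnir_word_def by (simp add: c replicate_app_Cons_same Suc_diff_le)
qed

lemma slide_pair:
  assumes "j < b - 2"
  shows "slide b j = (replicate (b - 2) False @ replicate j True) @ False # True # (replicate (b - 3 - j) True @
     True # True # False # replicate (k - b) False @ replicate (r - b) True)"
    "slide b (Suc j) = (replicate (b - 2) False @ replicate j True) @ True # False # (replicate (b - 3 - j) True @
     True # True # False # replicate (k - b) False @ replicate (r - b) True)"
proof -
  have "b = Suc (Suc (Suc (j + (b - 3 - j))))" using assms by simp
  then obtain d where "b = Suc (Suc (Suc (j + d)))" by blast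
  then show "slide b j = (replicate (b - 2) False @ replicate j True) @ False # True # (replicate (b - 3 - j) True @
     True # True # False # replicate (k - b) False @ replicate (r - b) True)"
    "slide b (Suc j) = (replicate (b - 2) False @ replicate j True) @ True # False # (replicate (b - 3 - j) True @
     True # True # False # replicate (k - b) False @ replicate (r - b) True)"
    by (simp_all add: slide_def replicate_app_Cons_same)
qed

text \<open>The place 2b - 2 points at the last two letters of the rising block. For j = 0, undoing
  two steps leaves a noncrossing word with False True True there, and a braid relation without
  correction moves psi onto its equal pair. The slides for larger j happen far from this place and
  commute with psi.\<close>

lemma slide_psi:
  assumes b: "2 \<le> b" "b \<le> r" and "j \<le> b - 2" "rep k r (slide b j) m"
  shows "fPsi (2 * b - 2) * m \<in> I"
  using assms(3,4)
proof (induction j arbitrary: m)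
  case 0
  define u where "u = replicate (b - 1) False @ replicate (b - 2) True"
  define w where "w = replicate (k - b) False @ replicate (r - b) True"
  obtain c where c: "b = Suc (Suc c)" using b by (metis One_nat_def Suc_1 Suc_le_D Suc_le_mono)
  have s: "slide b 0 = u @ True # True # False # w"
    by (simp add: slide_def u_def w_def c replicate_app_Cons_same)
  have lu: "Suc (length u) = 2 * b - 2" by (simp add: u_def c)
  let ?t = "Suc (length u)"
  have "rep k r ((u @ [True]) @ True # False # w) m" using 0 s by simp
  then obtain m1 where m1: "rep k r ((u @ [True]) @ False # True # w) m1" "m \<approx> fPsi (Suc (length (u @ [True]))) * m1"
    by (rule rep_descent)
  then have "rep k r (u @ True # False # True # w) m1" by simp
  then obtain m2 where m2: "rep k r (u @ False # True # True # w) m2" "m1 \<approx> fPsi ?t * m2" by (rule rep_descent)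
  have t: "1 \<le> ?t" "?t + 1 < n" using rep_length[OF m2(1)] size_content by auto
  let ?T = "u @ False # True # True # w"
  have "letter u False \<noteq> letter (u @ [False, True]) True" by (simp add: letter_def u_def c)
  then have B: "braid_term e (seq ?T) ?t = 0" using m2(1)
      letters_eq_iff(1)[of u _ m2 "u @ [False, True]"] by (intro braid_zero) auto
  have "m \<approx> fPsi (?t + 1) * m1" using m1(2) by simp
  also have "\<dots> \<approx> fPsi (?t + 1) * (fPsi ?t * m2)" using m2(2) t by (intro eqv_mult fPsi_C) auto
  finally have "fPsi ?t * m \<approx> fPsi ?t * (fPsi (?t + 1) * (fPsi ?t * m2))" using t by (intro eqv_mult fPsi_C) auto
  also have "\<dots> \<approx> fPsi (?t + 1) * (fPsi ?t * (fPsi (?t + 1) * m2))"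
    using psi_braid[OF rep_wt[OF m2(1)], of ?t] t by (simp add: B)
  finally have E: "fPsi ?t * m \<approx> fPsi (?t + 1) * (fPsi ?t * (fPsi (?t + 1) * m2))" .
  have bl: "below 0 ?T" using b rk by (auto simp: u_def w_def c)
  have "?T = (u @ [False]) @ True # True # w" by simp
  then have X: "fPsi (Suc (length (u @ [False]))) * m2 \<in> I" using noncrossing[OF m2(1) bl] by blast
  have "fPsi (?t + 1) * (fPsi ?t * (fPsi (?t + 1) * m2)) \<in> I"
    using t I_psi[OF I_psi[OF X], of ?t "?t + 1"] by simp
  then show ?case using eqv_I[OF E] lu by simp
next
  case (Suc j)
  define u where "u = replicate (b - 2) False @ replicate j True"
  define w where "w = replicate (b - 3 - j) True @ True # True # False # replicate (k - b) False @ replicate (r - b) True"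
  have s: "slide b j = u @ False # True # w" "slide b (Suc j) = u @ True # False # w"
    unfolding u_def w_def using Suc.prems(1) by (intro slide_pair; simp)+
  obtain m' where m': "rep k r (u @ False # True # w) m'" "m \<approx> fPsi (Suc (length u)) * m'"
    using rep_descent Suc.prems(2) s(2) by metis
  have I: "fPsi (2 * b - 2) * m' \<in> I" using Suc.IH[of m'] Suc.prems(1) m'(1) s(1) by simp
  have t: "Suc (length u) + 1 < 2 * b - 2" "2 * b - 2 < n" 
    using Suc.prems(1) b rk size_content by (auto simp: u_def)
  have "fPsi (2 * b - 2) * m \<approx> fPsi (2 * b - 2) * (fPsi (Suc (length u)) * m')"
    using m'(2) t b by (intro eqv_mult fPsi_C) auto
  also have "\<dots> \<approx> fPsi (Suc (length u)) * (fPsi (2 * b - 2) * m')"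
    using t b rep_C[OF m'(1)] by (intro psi_psi_far) auto
  finally show ?case using I_psi[OF I, of "Suc (length u)"] t eqv_I by simp
qed

text \<open>Induction on b. For j = b - 2 the letters at the slid False are i + b - 2, i + b - 3, i
  + b - 2, so the braid relation has the correction -1; its other side contains psi on an equal pair
  and vanishes by \<open>slide_psi\<close>. This writes m as psi's applied to m that pass through a
  shuffle reachable from \<open>garnir_word (b - 1)\<close>. For smaller j the exchanged residues
  are far apart, psi^2 is 1, and the slide can be undone.\<close>

lemma garnir_multiples:
  assumes U: "rep k r crossing_word U"
  shows "1 \<le> b \<Longrightarrow> b \<le> r \<Longrightarrow> rep k r (garnir_word b) m \<Longrightarrow> m \<in> multiples U"
proof (induction b arbitrary: m)
  case (Suc b')
  show ?case
  proof (cases "b' = 0")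
    case True
    then have "garnir_word (Suc b') = crossing_word" by (simp add: garnir_word_def crossing_word_def)
    then have "m \<approx> 1 * U" using rep_unique[OF _ U] Suc.prems by simp
    moreover have "1 \<in> C" by (rule free_algebra_one)
    ultimately show ?thesis using rep_C[OF Suc.prems(3)] unfolding multiples_def by blast
  next
    case False
    define b where "b = Suc b'"
    have b: "2 \<le> b" "b \<le> r" using False Suc.prems b_def by auto
    obtain c where c: "b = Suc (Suc c)" using b by (metis One_nat_def Suc_1 Suc_le_D Suc_le_mono)
    \<comment> \<open>The induction runs downward: from j = b - 2, where False stands next to the
      last two letters of the block, to j = 0, the Garnir word itself.\<close>
    have "j \<le> b - 2 \<Longrightarrow> rep k r (slide b j) m \<Longrightarrow> m \<in> multiples U" for j and m :: "'k free_klr"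
    proof (induction "b - 2 - j" arbitrary: j m)
      case 0
      then have j: "j = b - 2" by simp
      define u where "u = replicate (b - 2) False @ replicate (b - 2) True"
      define w where "w = False # replicate (k - b) False @ replicate (r - b) True"
      let ?T = "u @ False # True # True # w" and ?t = "Suc (length u)"
      have R: "rep k r ?T m" using 0(3) by (simp add: slide_def j u_def w_def)
      have lt: "?t + 1 = 2 * b - 2" by (simp add: u_def c)
      have t: "1 \<le> ?t" "?t + 1 < n" using rep_length[OF R] size_content by auto
      have P: "fPsi (?t + 1) * m \<in> I" using slide_psi[OF b] 0 lt by metis
      have W1: "rep k r (u @ True # False # True # w) (fPsi ?t * m)" using R by (rule rep_step)
      have "rep k r ((u @ [True]) @ False # True # w) (fPsi ?t * m)" using W1 by simp
      from rep_step[OF this] have W: "rep k r (u @ True # True # False # w) (fPsi (?t + 1) * (fPsi ?t * m))" by simp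
      \<comment> \<open>Raising the first True of the last block past the k + 2 - b letters False in
        front of it turns \<open>garnir_word b'\<close> into the word reached by the two
        psi's.\<close>
      have gw: "garnir_word b' = (replicate (b - 2) False @ replicate (b - 1) True) @ replicate (k + 2 - b) False @ True # replicate (r - b) True"
        using b Suc.prems(2) rk by (simp add: garnir_word_def b_def Suc_diff_Suc[symmetric] flip: replicate_Suc)
      have "nF (garnir_word b') = k" "nT (garnir_word b') = r"
        using b Suc.prems(2) rk False by (auto simp: garnir_word_def b_def)
      then obtain m0 :: "'k free_klr" where m0: "rep k r (garnir_word b') m0" using rep_exists by blast
      then have "m0 \<in> multiples U" using Suc.IH False Suc.prems by simp
      moreover obtain q where q: "q \<in> C" "rep k r ((replicate (b - 2) False @ replicate (b - 1) True) @ True # replicate (k + 2 - b) False @ replicate (r - b) True) (q * m0)"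
        using raise_true m0 gw by metis
      moreover have "(replicate (b - 2) False @ replicate (b - 1) True) @ True # replicate (k + 2 - b) False @ replicate (r - b) True = u @ True # True # False # w"
      proof -
        have "k + 2 - b = Suc (Suc (k - b))" using b rk by simp
        moreover have "b - 1 = Suc (b - 2)" using b by simp
        ultimately show ?thesis by (simp only: u_def w_def replicate_Suc append_assoc append_Cons append_Nil replicate_app_Cons_same)
      qed
      ultimately have W': "fPsi (?t + 1) * (fPsi ?t * m) \<in> multiples U"
        using multiples_eqv[OF rep_unique[OF W] rep_C[OF W]] multiples_mult by metis
      have L: "letter (u @ [False, True]) True = letter u False" "letter (u @ [False]) True = letter u False - 1"
        by (simp_all add: letter_def u_def c)
      have R1: "rep k r ((u @ [False]) @ True # True # w) m" using R by simp
      have "arrow e (letter (u @ [False]) True mod int e) (letter u False mod int e)"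
        unfolding letters_eq_iff(2)[OF R1 R, of True False] using L(2) by simp
      moreover have "\<not> arrow e (letter u False mod int e) (letter (u @ [False]) True mod int e)"
        unfolding letters_eq_iff(2)[OF R R1, of False True] using L(2) by simp
      ultimately have Bt: "braid_term e (seq ?T) ?t = - 1"
        by (simp add: braid_term_def entry_seq numeral_2_eq_2 L(1) split del: if_split)
      have "fPsi ?t * (fPsi (?t + 1) * (fPsi ?t * m)) \<approx> fPsi (?t + 1) * (fPsi ?t * (fPsi (?t + 1) * m)) + - m"
        using psi_braid[OF rep_wt[OF R], of ?t] t by (simp add: Bt)
      moreover have "fPsi (?t + 1) * (fPsi ?t * (fPsi (?t + 1) * m)) \<in> I" using t by (intro I_psi[OF I_psi[OF P]]) auto
      ultimately have "fPsi ?t * (fPsi (?t + 1) * (fPsi ?t * m)) + m \<in> I"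
        using I_add by (fastforce simp: eqv_def)
      then have "m \<approx> - (fPsi ?t * (fPsi (?t + 1) * (fPsi ?t * m)))" by (simp add: eqv_def algebra_simps)
      moreover have "- (fPsi ?t * (fPsi (?t + 1) * (fPsi ?t * m))) \<in> multiples U"
        using t by (intro multiples_uminus multiples_mult[OF W'] fPsi_C) auto
      ultimately show ?case using multiples_eqv rep_C[OF R] by blast
    next
      case (Suc d)
      then have j: "j < b - 2" by simp
      define u where "u = replicate (b - 2) False @ replicate j True"
      define w where "w = replicate (b - 3 - j) True @ True # True # False # replicate (k - b) False @ replicate (r - b) True"
      have s: "slide b j = u @ False # True # w" "slide b (Suc j) = u @ True # False # w"
        unfolding u_def w_def using j by (intro slide_pair; simp)+
      let ?t = "Suc (length u)" and ?T = "u @ False # True # w"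
      have R: "rep k r ?T m" using Suc.prems s by simp
      have t: "1 \<le> ?t" "?t < n" using rep_length[OF R] size_content by auto
      have R': "rep k r (slide b (Suc j)) (fPsi ?t * m)" unfolding s(2) using R by (rule rep_step)
      have M0: "fPsi ?t * m \<in> multiples U" using Suc.hyps(2) j R' by (intro Suc.hyps(1)) auto
      have M: "fPsi ?t * (fPsi ?t * m) \<in> multiples U" using t by (intro multiples_mult[OF M0] fPsi_C) auto
      have "letter u False \<noteq> letter (u @ [False]) True" "letter (u @ [False]) True \<noteq> letter u False + 1"
        "letter u False \<noteq> letter (u @ [False]) True + 1"
        using j by (auto simp: letter_def u_def)
      then have Q: "quad_term e (seq ?T) ?t = 1"
        using letters_eq_iff[of u _ m "u @ [False]"] letters_eq_iff[of "u @ [False]" _ m u] R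
        by (simp add: quad_term_def entry_seq)
      have "fPsi ?t * (fPsi ?t * m) \<approx> m" using psi_psi[OF rep_wt[OF R] t] by (simp add: Q)
      then show ?case using multiples_eqv[OF eqv_sym rep_C[OF R] M] by blast
    qed
    from this[of 0 m] show ?thesis using slide_0[OF b] Suc.prems b_def by simp
  qed
qed simp

end

section \<open>Independence of the shuffles\<close>

text \<open>A state forgets to which row a token belongs. This is the state in which the first row's
  token is at x and the second row's at y.\<close>

definition tok :: "int \<Rightarrow> int \<Rightarrow> int \<times> int" where "tok x y = (max x y, min x y)"

lemma step_tok [simp]: "step (tok x y) x = tok (x + 1) y" "step (tok x y) y = tok x (y + 1)"
  by (auto simp: tok_def max_def min_def)

lemma run_tok [simp]: "run (tok x y) (row_res x y u) = tok (x + int (nF u)) (y + int (nT u))"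
  by (induction u arbitrary: x y) (auto simp: algebra_simps simp del: step.simps)

lemma ok_tok [simp]: "ok (tok x y) (row_res x y u)"
proof (induction u arbitrary: x y)
  case (Cons b u)
  then show ?case by (auto simp del: step.simps) (auto simp: tok_def)
qed simp

lemma collision_tok: "collision (tok x y) = (if x = y then {x} else {})"
  by (auto simp: collision_def tok_def max_def min_def)

text \<open>
  The edges that the second token crosses while it is ahead of the first or level with it.
\<close>

fun bel :: "int \<Rightarrow> int \<Rightarrow> bool list \<Rightarrow> int set" where
  "bel x y [] = {}"
| "bel x y (b # T) = (if b then (if x \<le> y then {y} else {}) \<union> bel x (y + 1) T else bel (x + 1) y T)"

lemma bel_append [simp]:
  "bel x y (u @ w) = bel x y u \<union> bel (x + int (nF u)) (y + int (nT u)) w"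
  by (induction u arbitrary: x y) (auto simp: algebra_simps)

lemma bel_bounds: "c \<in> bel x y T \<Longrightarrow> x \<le> c \<and> y \<le> c \<and> c < y + int (nT T)"
  by (induction T arbitrary: x y) (fastforce split: if_splits)+

definition pt :: "int list \<Rightarrow> (int set \<Rightarrow> 'k::field) \<Rightarrow> int list \<Rightarrow> int set \<Rightarrow> 'k" where
  "pt J g = (\<lambda>J'. if J' = J then g else 0)"

lemma pt_same [simp]: "pt J g J = g" by (simp add: pt_def)
lemma pt_other: "J' \<noteq> J \<Longrightarrow> pt J g J' = 0" by (simp add: pt_def)

context two_tokens begin

lemma opP_pt: "opP (Suc (length u)) (pt (u @ a # b # w) g) = pt (u @ b # a # w) (cross (run s0 u) a b g)"
proof
  fix J
  show "opP (Suc (length u)) (pt (u @ a # b # w) g) J = pt (u @ b # a # w) (cross (run s0 u) a b g) J"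
  proof (cases "J = u @ b # a # w")
    case True
    then show ?thesis by (simp add: opP_at)
  next
    case False
    have "swap_entries (Suc (length u)) J \<noteq> u @ a # b # w"
    proof
      assume J: "swap_entries (Suc (length u)) J = u @ a # b # w"
      then have "length J = length (u @ a # b # w)" by (metis length_swap_entries)
      then have "swap_entries (Suc (length u)) (swap_entries (Suc (length u)) J) = J" by (intro swap_swap) auto
      then show False using J False by simp
    qed
    then show ?thesis using False by (simp add: opP_def pt_other)
  qed
qed

definition edges :: "int set" where "edges = {i - 1..<i + int k}"

lemma mulx_chain:
  assumes f: "f \<in> space" and "i - 1 \<le> d" "d \<le> a" "a < i + int k"
    and "\<And>c. d < c \<Longrightarrow> c \<le> a \<Longrightarrow> c \<notin> touch s0 J"
  shows "mulx d (f J) = mulx a (f J)"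
  using assms(3,4,5)
proof (induction a rule: int_ge_induct)
  case (step a)
  then have "mulx d (f J) = mulx a (f J)" by simp
  also have "\<dots> = mulx (a + 1) (f J)" using step assms(2) by (intro space_touch[OF f]) auto
  finally show ?case .
qed simp

lemma s0_tok: "s0 = tok (i - 1) i" "s0 = tok i (i - 1)" by (simp_all add: tok_def)

abbreviation res1 :: "bool list \<Rightarrow> int list" where "res1 \<equiv> row_res (i - 1) i"
abbreviation bel1 :: "bool list \<Rightarrow> int set" where "bel1 \<equiv> bel (i - 1) i"

lemma run_res1: "run s0 (res1 u) = tok (i - 1 + int (nF u)) (i + int (nT u))"
  unfolding s0_tok(1) by simp

lemma ok_res1: "ok s0 (res1 u)"
  unfolding s0_tok(1) by simp

lemma touch_res1_bound: "c \<in> touch s0 (res1 u) \<Longrightarrow> c \<le> i - 1 + int (nF u) \<and> c \<le> i + int (nT u)"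
  using touch_bounds[OF ok_res1[of u], of c] unfolding run_res1 by (auto simp: tok_def)

lemma touch_tok_bound: "c \<in> touch (tok x y) (row_res x y w) \<Longrightarrow> x \<le> c \<and> y \<le> c"
  using touch_bounds[OF ok_tok[of x y w], of c] by (auto simp: tok_def)

lemma touch_res1_snoc:
  "touch s0 (res1 (u @ [b])) = touch s0 (res1 u) \<union> collision (run s0 (res1 (u @ [b])))"
  using collision_run[of s0 "res1 u"] by auto

text \<open>
  While the second token is strictly ahead, it left the last meeting point first, so the edge
  starting there lies below.
\<close>

lemma last_touch:
  assumes "i - 1 + int (nF u) < i + int (nT u)"
  shows "(\<exists>d \<le> i - 1 + int (nF u). d \<in> touch s0 (res1 u) \<and> d \<in> bel1 u \<and>
            (\<forall>c. d < c \<longrightarrow> c \<le> i - 1 + int (nF u) \<longrightarrow> c \<notin> touch s0 (res1 u))) \<or>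
         (\<forall>c \<le> i - 1 + int (nF u). c \<notin> touch s0 (res1 u))"
  using assms
proof (induction u rule: rev_induct)
  case Nil
  then show ?case by (simp add: collision_def)
next
  case (snoc b u)
  let ?x = "i - 1 + int (nF u)" and ?y = "i + int (nT u)"
  have t: "touch s0 (res1 (u @ [b])) = touch s0 (res1 u)"
    using snoc.prems unfolding touch_res1_snoc run_res1 by (cases b) (auto simp: collision_tok)
  show ?case
  proof (cases b)
    case True
    show ?thesis
    proof (cases "?x < ?y")
      case True
      then show ?thesis using snoc.IH unfolding t using \<open>b\<close> by auto
    next
      case False
      then have "?x = ?y" using snoc.prems \<open>b\<close> by simp
      then have "?x \<in> collision (run s0 (res1 u))" "?x \<in> bel1 (u @ [b])" using \<open>b\<close>
        unfolding run_res1 by (auto simp: collision_tok)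
      then have "?x \<in> touch s0 (res1 (u @ [b])) \<and> ?x \<in> bel1 (u @ [b])" using collision_run[of s0 "res1 u"] t by auto
      then show ?thesis using \<open>b\<close> by (intro disjI1 exI[of _ ?x]) auto
    qed
  next
    case False
    then have "?x < ?y" using snoc.prems by simp
    have n: "?x + 1 \<notin> touch s0 (res1 u)" using touch_res1_bound[of "?x + 1" u] by fastforce
    have e: "bel1 (u @ [b]) = bel1 u" "i - 1 + int (nF (u @ [b])) = ?x + 1" using False by auto
    from snoc.IH[OF \<open>?x < ?y\<close>] show ?thesis
    proof (elim disjE exE conjE)
      fix d assume d: "d \<le> ?x" "d \<in> touch s0 (res1 u)" "d \<in> bel1 u"
        "\<forall>c. d < c \<longrightarrow> c \<le> ?x \<longrightarrow> c \<notin> touch s0 (res1 u)"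
      have "c \<notin> touch s0 (res1 u)" if "d < c" "c \<le> ?x + 1" for c
        using that d(4) n by (cases "c = ?x + 1") auto
      then show ?thesis unfolding t e using d by (intro disjI1 exI[of _ d]) auto
    next
      assume d: "\<forall>c \<le> ?x. c \<notin> touch s0 (res1 u)"
      have "c \<notin> touch s0 (res1 u)" if "c \<le> ?x + 1" for c
        using that d n by (cases "c = ?x + 1") auto
      then show ?thesis unfolding t e by blast
    qed
  qed
qed

text \<open>
  The leading monomial omits the edges which start at a meeting point that the second token leaves
  first.
\<close>

definition leading :: "bool list \<Rightarrow> (int set \<Rightarrow> 'k::field) \<Rightarrow> bool" where
  "leading T g \<longleftrightarrow> pt (res1 T) g \<in> space \<and> (\<forall>c \<in> edges. c \<notin> bel1 T \<longrightarrow> mulx c g = 0) \<and>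
     g (edges - (bel1 T \<inter> touch s0 (res1 T))) \<noteq> 0"

lemma mulx_eq_0D: "mulx c g = 0 \<Longrightarrow> c \<notin> Y \<Longrightarrow> g Y = 0"
proof -
  assume "mulx c g = 0" "c \<notin> Y"
  then have "mulx c g (insert c Y) = 0" by simp
  then show "g Y = 0" using \<open>c \<notin> Y\<close> by (simp add: mulx_def)
qed

lemma mulx_eq_mulxD: "mulx c g = mulx d g \<Longrightarrow> c \<noteq> d \<Longrightarrow> c \<notin> Y \<Longrightarrow> d \<notin> Y \<Longrightarrow> g Y = 0"
proof -
  assume "mulx c g = mulx d g" and Y: "c \<noteq> d" "c \<notin> Y" "d \<notin> Y"
  then have "mulx c g (insert c Y) = mulx d g (insert c Y)" by simp
  then show "g Y = 0" using Y by (simp add: mulx_def)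
qed

text \<open>The step has to change the leading monomial exactly as it changes the set of meeting
  points that the second token leaves first. The cases follow those of \<open>cross\<close>.\<close>

lemma leading_step:
  assumes L: "leading (u @ False # True # w) g"
    and cnt: "nF (u @ False # True # w) = k + 1" "nT (u @ False # True # w) = r - 1"
  shows "leading (u @ True # False # w)
      (cross (run s0 (res1 u)) (i - 1 + int (nF u)) (i + int (nT u)) g)"
proof -
  define a where "a = i - 1 + int (nF u)"
  define b where "b = i + int (nT u)"
  let ?T = "u @ False # True # w" and ?T' = "u @ True # False # w"
  let ?S = "run s0 (res1 u)" and ?Jw = "row_res (a + 1) (b + 1) w"
  have S: "?S = tok a b" unfolding a_def b_def by (rule run_res1)
  have J: "res1 ?T = res1 u @ a # b # ?Jw" "res1 ?T' = res1 u @ b # a # ?Jw"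
    by (auto simp: a_def b_def algebra_simps)
  have sp: "pt (res1 ?T) g \<in> space" and ab: "\<And>c. c \<in> edges \<Longrightarrow> c \<notin> bel1 ?T \<Longrightarrow> mulx c g = 0"
    and lead: "g (edges - (bel1 ?T \<inter> touch s0 (res1 ?T))) \<noteq> 0"
    using L by (auto simp: leading_def simp del: row_res_append bel_append)
  have ln: "Suc (length u) < k + r" using cnt nF_nT[of ?T] r1 by simp
  have "opP (Suc (length u)) (pt (res1 ?T) g) \<in> space" using sp ln by (intro space_opP) auto
  then have sp': "pt (res1 ?T') (cross ?S a b g) \<in> space" 
    using opP_pt[of "res1 u" a b ?Jw g] unfolding J by simp
  have win: "i - 1 \<le> a" "a < i + int k" "i \<le> b" "b < i + int k" using cnt rk r1 by (auto simp: a_def b_def)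
  have B: "bel1 ?T = bel1 u \<union> (if a + 1 \<le> b then {b} else {}) \<union> bel (a + 1) (b + 1) w"
    "bel1 ?T' = bel1 u \<union> (if a \<le> b then {b} else {}) \<union> bel (a + 1) (b + 1) w"
    by (auto simp: a_def b_def algebra_simps)
  have Tt: "touch s0 (res1 ?T) = touch s0 (res1 u) \<union> (if a + 1 = b then {b} else {}) \<union> touch (tok (a + 1) (b + 1)) ?Jw"
    unfolding J touch_pair S by (simp add: collision_tok)
  have Tt': "touch s0 (res1 ?T') = touch s0 (res1 u) \<union> (if a = b + 1 then {a} else {}) \<union> touch (tok (a + 1) (b + 1)) ?Jw"
    unfolding J touch_pair S by (simp add: collision_tok)
  have bu: "\<And>c. c \<in> bel1 u \<Longrightarrow> c < b" and bw: "\<And>c. c \<in> bel (a + 1) (b + 1) w \<Longrightarrow> a < c \<and> b < c"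
    using bel_bounds[of _ "i - 1" i u] bel_bounds[of _ "a + 1" "b + 1" w] by (fastforce simp: b_def)+
  have tu: "\<And>c. c \<in> touch s0 (res1 u) \<Longrightarrow> c \<le> a \<and> c \<le> b" unfolding a_def b_def by (rule touch_res1_bound)
  have tw: "\<And>c. c \<in> touch (tok (a + 1) (b + 1)) ?Jw \<Longrightarrow> a < c \<and> b < c" using touch_tok_bound by fastforce
  let ?M = "bel1 ?T \<inter> touch s0 (res1 ?T)" and ?M' = "bel1 ?T' \<inter> touch s0 (res1 ?T')"
  have ab': "mulx c (cross ?S a b g) = 0" if c: "c \<in> edges" "c \<notin> bel1 ?T'" for c
  proof -
    have "mulx c g = 0" using c by (intro ab) (auto simp: B simp del: bel_append split: if_splits)
    moreover have "a \<noteq> b \<or> c \<noteq> a" using c by (auto simp: B simp del: bel_append)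
    ultimately show ?thesis by (simp add: cross_mulx[symmetric])
  qed
  consider "a = b" | "a = b + 1" | "b = a + 1" | "a \<noteq> b" "a \<noteq> b + 1" "b \<noteq> a + 1" by blast
  then have "cross ?S a b g (edges - ?M') \<noteq> 0"
  proof cases
    case 1
    \<comment> \<open>Both tokens stand at a. After the step the second one leaves first, so x_a
      must drop out of the leading monomial, which is what differentiation does.\<close>
    have nb: "a \<notin> bel1 ?T" using bu[of a] bw[of a] 1 by (auto simp: B simp del: bel_append)
    have "a \<in> collision ?S" unfolding S by (simp add: collision_tok 1)
    then have "a \<in> touch s0 (res1 u)" using collision_run by blast
    then have "?M' = insert a ?M" using 1 unfolding Tt Tt' B by auto
    then have "insert a (edges - ?M') = edges - ?M" "a \<notin> edges - ?M'" using nb win by (auto simp: edges_def)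
    then show ?thesis using lead 1 by (simp add: cross_def dx_def)
  next
    case 2
    \<comment> \<open>The step creates a meeting at a, but the first token leaves it first, so the
      monomial stays and only the sign changes.\<close>
    have "a \<notin> bel1 ?T'" using bu[of a] bw[of a] 2 by (auto simp: B simp del: bel_append)
    then have "?M' = ?M" using 2 unfolding Tt Tt' B by auto
    then show ?thesis using lead 2 by (simp add: cross_def)
  next
    case 3
    \<comment> \<open>The meeting at b disappears, so x_b must enter the leading monomial. It comes
      from the summand x_b g, and it remains to see that x_a g does not interfere.\<close>
    have nt: "b \<notin> touch s0 (res1 ?T')" using tu[of b] tw[of b] 3 unfolding Tt' by (auto split: if_splits)
    have "b \<in> bel1 ?T" unfolding B using 3 by simp
    then have M: "?M = insert b ?M'" "b \<notin> ?M'" using 3 nt unfolding Tt Tt' B by auto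
    have b: "mulx b g (edges - ?M') = g (edges - ?M)"
    proof -
      have "b \<in> edges - ?M'" using M win by (auto simp: edges_def)
      moreover have "edges - ?M' - {b} = edges - ?M" using M(1) by blast
      ultimately show ?thesis by (simp add: mulx_def)
    qed
    have chain: "mulx d g = mulx a g" if d: "i - 1 \<le> d" "d \<le> a" "\<forall>c. d < c \<longrightarrow> c \<le> a \<longrightarrow> c \<notin> touch s0 (res1 u)" for d
    proof -
      have "c \<notin> touch s0 (res1 ?T)" if "d < c" "c \<le> a" for c
        using d(3) that tw[of c] 3 unfolding Tt by auto
      then show ?thesis using mulx_chain[OF sp d(1,2) win(2), of "res1 ?T"] by simp
    qed
    \<comment> \<open>Along edges without meetings x_a g = x_d g for the last meeting point d. As
      x_d is missing from the new leading monomial, so is the contribution of x_a g. If there was no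
      meeting, d = i - 1 serves, and x_{i-1} g = 0.\<close>
    have a: "mulx a g (edges - ?M') = 0"
    proof (cases "a \<in> edges - ?M'")
      case True
      have "a < b" using 3 by simp
      from last_touch[of u, folded a_def b_def, OF this] show ?thesis
      proof (elim disjE exE conjE)
        fix d assume d: "d \<le> a" "d \<in> touch s0 (res1 u)" "d \<in> bel1 u"
          "\<forall>c. d < c \<longrightarrow> c \<le> a \<longrightarrow> c \<notin> touch s0 (res1 u)"
        have dM: "d \<in> ?M'" using d unfolding B Tt' by simp
        then have ne: "d \<noteq> a" using True by auto
        have "i - 1 \<le> d" using bel_bounds[OF d(3)] by simp
        then have "g (edges - ?M' - {a}) = 0"
          using dM by (intro mulx_eq_mulxD[OF chain[OF _ d(1,4)] ne]) auto
        then show ?thesis by (simp add: mulx_def)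
      next
        assume "\<forall>c \<le> a. c \<notin> touch s0 (res1 u)"
        then have "mulx (i - 1) g = mulx a g" using win by (intro chain) auto
        moreover have "mulx (i - 1) g = 0"
          using bel_bounds[of "i - 1" "i - 1" i ?T] by (intro ab) (auto simp: edges_def simp del: bel_append)
        ultimately show ?thesis by simp
      qed
    next
      case False
      then show ?thesis by (simp only: mulx_def if_False)
    qed
    have "cross ?S a b g = mulx a g + mulx b g"
      using 3 unfolding S by (simp add: cross_def tok_def)
    then show ?thesis using a b lead by simp
  next
    case 4
    then have "?M' = ?M" unfolding Tt Tt' B by auto
    then show ?thesis using lead 4 by (simp add: cross_def)
  qed
  then show ?thesis using sp' ab' unfolding a_def[symmetric] b_def[symmetric]
    by (simp add: leading_def del: row_res_append bel_append)
qed

lemma act_rep_leading: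
  assumes "rep (k + 1) (r - 1) T m" "leading (top_word (k + 1) (r - 1)) g0"
  shows "\<exists>g. act m (pt (res1 (top_word (k + 1) (r - 1))) g0) = pt (res1 T) g \<and> leading T g"
  using assms(1)
proof (induction rule: rep.induct)
  case rep_top
  then show ?case using assms(2) by auto
next
  case (rep_step u w m)
  let ?w0 = "pt (res1 (top_word (k + 1) (r - 1))) g0"
  obtain g where g: "act m ?w0 = pt (res1 (u @ False # True # w)) g" "leading (u @ False # True # w) g"
    using rep_step by blast
  let ?g = "cross (run s0 (res1 u)) (i - 1 + int (nF u)) (i + int (nT u)) g"
  have "act (fPsi (Suc (length u)) * m) ?w0 = opP (Suc (length u)) (pt (res1 (u @ False # True # w)) g)"
    by (simp only: act_mult act_fgen genop.simps g(1))
  also have "\<dots> = pt (res1 (u @ True # False # w)) ?g"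
    using opP_pt[of "res1 u" "i - 1 + int (nF u)" "i + int (nT u)"
        "row_res (i + int (nF u)) (i + int (nT u) + 1) w" g]
    by (simp add: algebra_simps)
  finally have "act (fPsi (Suc (length u)) * m) ?w0 = pt (res1 (u @ True # False # w)) ?g" .
  moreover have "leading (u @ True # False # w) ?g"
    using g(2) rep_counts[OF rep_step(1)] by (intro leading_step) auto
  ultimately show ?case by blast
qed

text \<open>Shuffles with equal residue sequences first differ where both tokens stand at one point
  c. In the larger one the second token leaves first, so its leading monomial lacks x_c. In the
  smaller one edge c is outside \<open>bel1\<close>, hence x_c g' = 0 and every monomial of g'
  contains x_c.\<close>

lemma leading_triangular:
  assumes T: "nF T = k + 1" "nT T = r - 1" and T': "nF T' = k + 1" "nT T' = r - 1"
    and L: "leading T' g'" and lt: "T' < T"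
  shows "pt (res1 T') g' (res1 T) (edges - (bel1 T \<inter> touch s0 (res1 T))) = 0"
proof (cases "res1 T = res1 T'")
  case False
  then show ?thesis by (simp add: pt_other)
next
  case True
  have "length T = length T'" using T T' nF_nT[of T] nF_nT[of T'] by simp
  then obtain p v w where p: "T' = p @ False # v" "T = p @ True # w"
    using lt by (auto simp: list_less_def lexord_def)
  let ?c = "i + int (nT p)"
  have eq: "i - 1 + int (nF p) = ?c" using True unfolding p by simp
  have "?c \<in> collision (run s0 (res1 p))" unfolding run_res1 by (simp add: collision_tok eq)
  then have "?c \<in> touch s0 (res1 T)" unfolding p using collision_run[of s0 "res1 p"] by auto
  moreover have "?c \<in> bel1 T" unfolding p using eq by simp
  moreover have "?c \<notin> bel1 T'" unfolding p
    using bel_bounds[of ?c "i - 1" i p] bel_bounds[of ?c "i + int (nF p)" ?c v] eq by auto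
  moreover have "?c \<in> edges" using T unfolding p edges_def using r1 rk by auto
  ultimately have "mulx ?c g' = 0" "?c \<notin> edges - (bel1 T \<inter> touch s0 (res1 T))"
    using L unfolding leading_def by auto
  then have "g' (edges - (bel1 T \<inter> touch s0 (res1 T))) = 0" by (rule mulx_eq_0D)
  then show ?thesis using True by simp
qed

text \<open>The combination is evaluated at the leading monomial of the lexicographically largest
  shuffle with a nonzero coefficient, where no other term survives.\<close>

lemma leading_independent:
  fixes G :: "bool list \<Rightarrow> int set \<Rightarrow> 'k::field"
  assumes fin: "finite A" and A: "\<And>T. T \<in> A \<Longrightarrow> nF T = k + 1 \<and> nT T = r - 1 \<and> leading T (G T)"
    and sum: "(\<Sum>T\<in>A. scl (a T) (pt (res1 T) (G T))) = 0" and T: "T \<in> A"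
  shows "a T = 0"
proof (rule ccontr)
  assume "a T \<noteq> 0"
  let ?Z = "{T \<in> A. a T \<noteq> 0}"
  have Z: "finite ?Z" "?Z \<noteq> {}" using fin T \<open>a T \<noteq> 0\<close> by auto
  define M where "M = Max ?Z"
  have M: "M \<in> A" "a M \<noteq> 0" using Max_in[OF Z] by (auto simp: M_def)
  let ?Y = "edges - (bel1 M \<inter> touch s0 (res1 M))"
  have "0 = (\<Sum>T\<in>A. scl (a T) (pt (res1 T) (G T))) (res1 M) ?Y" unfolding sum by simp
  also have "\<dots> = (\<Sum>T\<in>A. a T * pt (res1 T) (G T) (res1 M) ?Y)" by (simp add: sum_apply scl_def)
  also have "\<dots> = (\<Sum>T\<in>{M}. a T * pt (res1 T) (G T) (res1 M) ?Y)"
  proof (rule sum.mono_neutral_right[OF fin])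
    show "\<forall>T\<in>A - {M}. a T * pt (res1 T) (G T) (res1 M) ?Y = 0"
    proof
      fix T assume T: "T \<in> A - {M}"
      show "a T * pt (res1 T) (G T) (res1 M) ?Y = 0"
      proof (cases "a T = 0")
        case False
        then have "T < M" using T Max_ge[OF Z(1), of T] by (auto simp: M_def)
        then show ?thesis using leading_triangular[of M T "G T"] A[of M] A[of T] M T by simp
      qed simp
    qed
  qed (use M in simp)
  also have "\<dots> = a M * G M ?Y" by simp
  finally show False using M A[of M] by (auto simp: leading_def)
qed

section \<open>The images of the generator and of the first Garnir element\<close>

definition full :: "int set \<Rightarrow> 'k::field" where "full = (\<lambda>Y. if Y = edges then 1 else 0)"

lemma mulx_full: "c \<in> edges \<Longrightarrow> mulx c full = 0"
  by (auto simp: mulx_def full_def fun_eq_iff)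

abbreviation res0 :: "bool list \<Rightarrow> int list" where "res0 \<equiv> row_res i (i - 1)"

lemma run_res0: "run s0 (res0 u) = tok (i + int (nF u)) (i - 1 + int (nT u))"
  unfolding s0_tok(2) by simp

lemma res0_words: "nF T = k \<Longrightarrow> nT T = r \<Longrightarrow> res0 T \<in> words"
  unfolding words_def mem_Collect_eq run_res0 using rk by (auto simp: s0_tok(2)) (auto simp: tok_def)

lemma pt_full_space: "J \<in> words \<Longrightarrow> pt J g \<in> space" if "\<And>c. c \<in> edges \<Longrightarrow> mulx c g = 0"
  using that by (auto simp: space_def pt_def edges_def)

definition w0 :: "int list \<Rightarrow> int set \<Rightarrow> 'k::field" where "w0 = pt (res0 (top_word k r)) full"

lemma w0_space: "w0 \<in> space"
  unfolding w0_def by (intro pt_full_space res0_words) (auto simp: mulx_full)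

lemma w0_opY:
  assumes "1 \<le> t" "t \<le> k + r"
  shows "opY t w0 = 0"
proof (rule space_eqI)
  show "opY t w0 \<in> space" by (intro space_opY w0_space)
  fix J assume "J \<in> words"
  then obtain u a w where J: "J = u @ a # w" "t = Suc (length u)" using words_letterE assms by metis
  have "a \<in> edges" using window[of u a w] \<open>J \<in> words\<close> J by (auto simp: edges_def)
  then have M: "mulx a (w0 J) = 0" by (auto simp: w0_def pt_def mulx_full)
  show "opY t w0 J = 0 J" unfolding J opY_at M[unfolded J] by simp
qed simp

text \<open>An ascent c, c + 1 is sent to 0 unless the state is (c + 1, c). In the top word this
  state does not occur within a row: in the first row the leading token moves, and in the second row
  the moving token is more than one edge behind.\<close>

lemma w0_opP:
  assumes "1 \<le> t" "t < k + r" "t \<noteq> k"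
  shows "opP t w0 = (0 :: int list \<Rightarrow> int set \<Rightarrow> 'k::field)"
proof -
  let ?T = "top_word k r"
  have "t < length ?T" using assms by (simp add: top_word_def)
  then obtain u a b w where T: "?T = u @ a # b # w" and t: "t = Suc (length u)"
    using split_at_pair[of t ?T] assms by auto
  have "a = ?T ! length u" "b = ?T ! Suc (length u)" unfolding T by (simp_all add: nth_append)
  then have ab: "a = b" "a \<longleftrightarrow> k \<le> length u" using t assms by (auto simp: top_word_def nth_append)
  have u: "u = take (length u) ?T" unfolding T by simp
  have cnt: "a \<Longrightarrow> nF u = k" "\<not> a \<Longrightarrow> nT u = 0"
    using ab(2) by (subst u, simp add: top_word_def)+
  let ?p = "i + int (nF u)" and ?q = "i - 1 + int (nT u)"
  have tot: "nF u + nT u + 2 \<le> k + r" using nF_nT[of u] t assms by simp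
  define c where "c = (if a then ?q else ?p)"
  have J: "res0 ?T = res0 u @ c # (c + 1) # row_res (if a then ?p else ?p + 2) (if a then ?q + 2 else ?q) w"
    unfolding T using ab(1) by (auto simp: c_def algebra_simps)
  have "cross (tok ?p ?q) c (c + 1) (full :: int set \<Rightarrow> 'k) = 0"
    using cnt tot rk by (cases a) (auto simp: cross_def tok_def c_def max_def min_def)
  then show ?thesis unfolding w0_def J t length_row_res[of i "i - 1" u, symmetric] opP_pt run_res0
    by (auto simp: pt_def fun_eq_iff)
qed

text \<open>The words on the way from the top word to the crossing word: the first letter of the
  second row has been moved left until j letters precede it.\<close>

definition descending :: "nat \<Rightarrow> bool list" where
  "descending j = replicate j False @ True # replicate (k - j) False @ replicate (r - 1) True"

text \<open>The letter i - 1 passes i + k - 1, ..., i in turn. Only the last exchange is between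
  neighbouring residues, and it contributes the sign.\<close>

lemma act_descending:
  "j \<le> k \<Longrightarrow> \<exists>m :: 'k::field free_klr. rep k r (descending j) m \<and>
     act m w0 = pt (res0 (descending j)) (if j = 0 then - full else full)"
proof (induction rule: inc_induct)
  case base
  have "descending k = top_word k r" using r1 by (simp add: descending_def top_word_def flip: replicate_Suc)
  then show ?case using rk r1 by (intro exI[of _ 1]) (auto simp: rep_top w0_def)
next
  case (step j)
  then obtain m :: "'k free_klr" where m: "rep k r (descending (Suc j)) m"
    "act m w0 = pt (res0 (descending (Suc j))) full" by auto
  define u where "u = replicate j False"
  define w where "w = replicate (k - Suc j) False @ replicate (r - 1) True"
  have "replicate (k - j) False = False # replicate (k - Suc j) False"
    using step.hyps by (simp add: Suc_diff_Suc flip: replicate_Suc)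
  then have d: "descending (Suc j) = u @ False # True # w" "descending j = u @ True # False # w"
    by (simp_all add: descending_def u_def w_def replicate_app_Cons_same)
  let ?a = "i + int j" and ?b = "i - 1"
  have J: "res0 (descending (Suc j)) = res0 u @ ?a # ?b # row_res (?a + 1) i w"
    "res0 (descending j) = res0 u @ ?b # ?a # row_res (?a + 1) i w"
    unfolding d by (auto simp: u_def)
  have "act (fPsi (Suc (length u)) * m) w0 = opP (Suc (length (res0 u))) (pt (res0 u @ ?a # ?b # row_res (?a + 1) i w) full)"
    by (simp only: act_mult act_fgen genop.simps m(2) J length_row_res)
  also have "\<dots> = pt (res0 (descending j)) (cross (run s0 (res0 u)) ?a ?b full)" unfolding opP_pt J ..
  also have "cross (run s0 (res0 u)) ?a ?b full = (if j = 0 then - full else full :: int set \<Rightarrow> 'k)"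
    by (auto simp: cross_def)
  finally show ?case using rep_step[of k r u w m] m(1) d by metis
qed

lemma leading_top: "leading (top_word (k + 1) (r - 1)) (- full :: int set \<Rightarrow> 'k::field)"
proof -
  let ?T = "top_word (k + 1) (r - 1)"
  have J: "res1 ?T \<in> words"
    unfolding words_def mem_Collect_eq run_res1 using rk r1 by (auto simp: s0_tok(1)) (auto simp: tok_def)
  have bF: "bel x y (replicate j False) = {}" for x y j by (induction j arbitrary: x) auto
  have bT: "bel x y (replicate j True) = {}" if "y + int j \<le> x" for x y j using that by (induction j arbitrary: y) auto
  have "bel1 ?T = {}" using bF bT[of "i" "r - 1" "i + int k"] rk by (simp add: top_word_def)
  moreover have "(- full) edges \<noteq> (0 :: 'k)" by (simp add: full_def)
  moreover have "pt (res1 ?T) (- full) \<in> (space :: (int list \<Rightarrow> int set \<Rightarrow> 'k) set)"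
    using J by (intro pt_full_space) (simp add: mulx_full)
  ultimately show ?thesis unfolding leading_def by (simp add: mulx_full)
qed

text \<open>Here the two shapes meet: the word to which U carries v is the initial word of
  \<lambda>_1, so U v can play the part of the generator of M^{\<lambda>_1}.\<close>

lemma crossing_res: "res0 (descending 0) = res1 (top_word (k + 1) (r - 1))"
  by (simp add: descending_def top_word_def)

end

section \<open>Modules presented by left ideals\<close>

lemma klr_class_surj: "X \<in> carrier (klr e \<alpha>) \<Longrightarrow> \<exists>p \<in> carrier (free_algebra (klr_gens \<alpha>)). X = klr_class e \<alpha> p"
  by (auto simp: klr_class_def klr_def FactRing_def A_RCOSETS_def RCOSETS_def a_r_coset_def)

lemma klr_class_add:
  assumes "p \<in> carrier (free_algebra (klr_gens \<alpha>))" "q \<in> carrier (free_algebra (klr_gens \<alpha>))"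
  shows "klr_class e \<alpha> (p + q) = klr_class e \<alpha> p \<oplus>\<^bsub>klr e \<alpha>\<^esub> klr_class e \<alpha> q"
proof -
  interpret ideal "klr_ideal e \<alpha>" "free_algebra (klr_gens \<alpha>) :: 'a free_klr ring" by (rule ideal_klr_ideal)
  show ?thesis using a_rcos_sum[OF assms]
    by (simp add: klr_def klr_class_def FactRing_def) (simp add: free_algebra_def)
qed

lemma klr_class_one: "klr_class e \<alpha> 1 = \<one>\<^bsub>klr e \<alpha>\<^esub>"
  by (simp add: klr_def klr_class_def FactRing_def) (simp add: free_algebra_def)

lemma klr_class_eq_iff:
  assumes "p \<in> carrier (free_algebra (klr_gens \<alpha>))" "q \<in> carrier (free_algebra (klr_gens \<alpha>))"
  shows "klr_class e \<alpha> p = klr_class e \<alpha> q \<longleftrightarrow> p - q \<in> klr_ideal e \<alpha>"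
proof -
  let ?A = "free_algebra (klr_gens \<alpha>) :: 'a free_klr ring"
  interpret A: ring ?A by (rule ring_free_algebra)
  interpret ideal "klr_ideal e \<alpha>" ?A by (rule ideal_klr_ideal)
  have "q \<oplus>\<^bsub>?A\<^esub> (- q) = \<zero>\<^bsub>?A\<^esub>" "- q \<in> carrier ?A"
    using free_algebra_uminus[OF assms(2)] by (simp_all add: free_algebra_def)
  then have "\<ominus>\<^bsub>?A\<^esub> q = - q" using assms A.add.inv_equality A.a_comm by metis
  then have m: "p \<ominus>\<^bsub>?A\<^esub> q = p - q" using assms by (simp add: a_minus_def) (simp add: free_algebra_def)
  have "p \<in> klr_ideal e \<alpha> +>\<^bsub>?A\<^esub> q \<longleftrightarrow> p - q \<in> klr_ideal e \<alpha>"
    using a_rcos_module[OF assms(2,1)] m by (simp add: a_minus_def)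
  moreover have "klr_class e \<alpha> p = klr_class e \<alpha> q \<longleftrightarrow> p \<in> klr_ideal e \<alpha> +>\<^bsub>?A\<^esub> q"
    unfolding klr_class_def using assms a_repr_independence' a_rcos_self by metis
  ultimately show ?thesis by simp
qed

lemma klr_class_zero: "klr_class e \<alpha> 0 = \<zero>\<^bsub>klr e \<alpha>\<^esub>"
proof -
  interpret ring "klr e \<alpha> :: 'a klr_elt ring" by (rule ring_klr)
  have "klr_class e \<alpha> (0 :: 'a free_klr) \<oplus>\<^bsub>klr e \<alpha>\<^esub> klr_class e \<alpha> 0 = klr_class e \<alpha> 0"
    using klr_class_add[OF free_algebra_zero free_algebra_zero, where e = e and \<alpha> = \<alpha>, symmetric] by (simp only: add_0_left)
  then show ?thesis
    using klr_class_closed[OF free_algebra_zero, of e \<alpha>] by (metis add.r_cancel_one)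
qed

lemma klr_class_diff:
  assumes "p \<in> carrier (free_algebra (klr_gens \<alpha>))" "q \<in> carrier (free_algebra (klr_gens \<alpha>))"
  shows "klr_class e \<alpha> (p - q) = klr_class e \<alpha> p \<ominus>\<^bsub>klr e \<alpha>\<^esub> klr_class e \<alpha> q"
proof -
  interpret ring "klr e \<alpha> :: 'a klr_elt ring" by (rule ring_klr)
  have "klr_class e \<alpha> p = klr_class e \<alpha> (p - q) \<oplus>\<^bsub>klr e \<alpha>\<^esub> klr_class e \<alpha> q"
    using klr_class_add[of "p - q" \<alpha> q e] assms by (simp add: free_algebra_diff)
  then show ?thesis
    using klr_class_closed[of p \<alpha> e] klr_class_closed[of q \<alpha> e] klr_class_closed[of "p - q" \<alpha> e] assms
    by (simp add: free_algebra_diff a_minus_def a_assoc r_neg)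
qed

context left_module
begin

lemma smult_zero_right: "a \<in> carrier R \<Longrightarrow> a \<odot>\<^bsub>M\<^esub> \<zero>\<^bsub>M\<^esub> = \<zero>\<^bsub>M\<^esub>"
  by (metis M.add.r_cancel_one M.l_zero M.zero_closed smult_closed smult_r_distr)

lemma smult_zero_left: "x \<in> carrier M \<Longrightarrow> \<zero>\<^bsub>R\<^esub> \<odot>\<^bsub>M\<^esub> x = \<zero>\<^bsub>M\<^esub>"
  by (metis M.add.r_cancel_one R.l_zero R.zero_closed smult_closed smult_l_distr)

lemma smult_minus_left: "a \<in> carrier R \<Longrightarrow> x \<in> carrier M \<Longrightarrow> (\<ominus>\<^bsub>R\<^esub> a) \<odot>\<^bsub>M\<^esub> x = \<ominus>\<^bsub>M\<^esub> (a \<odot>\<^bsub>M\<^esub> x)"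
  by (metis M.add.inv_equality R.add.inv_closed R.l_neg smult_closed smult_l_distr smult_zero_left)

lemma abelian_subgroup_submodule: "submodule N R M \<Longrightarrow> abelian_subgroup N M"
  by (rule abelian_subgroupI3[OF _ M.abelian_group_axioms]) (simp add: additive_subgroup_def submodule_def)

lemma quot_carrier: "X \<in> carrier (quot_module M N) \<longleftrightarrow> (\<exists>x\<in>carrier M. X = N +>\<^bsub>M\<^esub> x)"
  by (auto simp: quot_module_def A_RCOSETS_def RCOSETS_def a_r_coset_def)

lemma quot_smult:
  assumes N: "submodule N R M" and a: "a \<in> carrier R" and x: "x \<in> carrier M"
  shows "a \<odot>\<^bsub>quot_module M N\<^esub> (N +>\<^bsub>M\<^esub> x) = N +>\<^bsub>M\<^esub> (a \<odot>\<^bsub>M\<^esub> x)"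
proof -
  interpret N: abelian_subgroup N M by (rule abelian_subgroup_submodule[OF N])
  have "N +>\<^bsub>M\<^esub> (a \<odot>\<^bsub>M\<^esub> y) = N +>\<^bsub>M\<^esub> (a \<odot>\<^bsub>M\<^esub> x)" if "y \<in> N +>\<^bsub>M\<^esub> x" for y
  proof -
    from that obtain h where h: "h \<in> N" "y = h \<oplus>\<^bsub>M\<^esub> x" by (auto simp: a_r_coset_def')
    have "h \<in> carrier M" using h N.a_subset by blast
    then have "a \<odot>\<^bsub>M\<^esub> y = a \<odot>\<^bsub>M\<^esub> h \<oplus>\<^bsub>M\<^esub> a \<odot>\<^bsub>M\<^esub> x" using h a x by (simp add: smult_r_distr)
    moreover have "a \<odot>\<^bsub>M\<^esub> h \<in> N" using h a N by (simp add: submodule_def submodule_axioms_def)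
    ultimately have "a \<odot>\<^bsub>M\<^esub> y \<in> N +>\<^bsub>M\<^esub> (a \<odot>\<^bsub>M\<^esub> x)" by (auto simp: a_r_coset_def')
    then show ?thesis using N.a_repr_independence' smult_closed a x by metis
  qed
  moreover have "x \<in> N +>\<^bsub>M\<^esub> x" using N.a_rcos_self x by blast
  ultimately have "(\<Union>y\<in>N +>\<^bsub>M\<^esub> x. N +>\<^bsub>M\<^esub> (a \<odot>\<^bsub>M\<^esub> y)) = N +>\<^bsub>M\<^esub> (a \<odot>\<^bsub>M\<^esub> x)" by blast
  then show ?thesis by (simp add: quot_module_def)
qed

lemma quot_add:
  assumes N: "submodule N R M" and "x \<in> carrier M" "y \<in> carrier M"
  shows "(N +>\<^bsub>M\<^esub> x) \<oplus>\<^bsub>quot_module M N\<^esub> (N +>\<^bsub>M\<^esub> y) = N +>\<^bsub>M\<^esub> (x \<oplus>\<^bsub>M\<^esub> y)"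
  using abelian_subgroup.a_rcos_sum[OF abelian_subgroup_submodule[OF N] assms(2,3)] by (simp add: quot_module_def)

lemma quot_zero: "\<zero>\<^bsub>quot_module M N\<^esub> = N" by (simp add: quot_module_def)

lemma quot_eq_zero:
  assumes N: "submodule N R M" and x: "x \<in> carrier M"
  shows "N +>\<^bsub>M\<^esub> x = N \<longleftrightarrow> x \<in> N"
proof -
  interpret N: abelian_subgroup N M by (rule abelian_subgroup_submodule[OF N])
  show ?thesis using N.a_rcos_self[OF x] N.a_rcos_const by metis
qed

lemma gen_submodule_subset: "S \<subseteq> gen_submodule R M S"
  by (auto simp: gen_submodule_def)

lemma gen_submodule_least: "submodule N R M \<Longrightarrow> S \<subseteq> N \<Longrightarrow> gen_submodule R M S \<subseteq> N"
  by (auto simp: gen_submodule_def)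

lemma submoduleI:
  assumes "N \<subseteq> carrier M" "\<zero>\<^bsub>M\<^esub> \<in> N" "\<And>x y. x \<in> N \<Longrightarrow> y \<in> N \<Longrightarrow> x \<oplus>\<^bsub>M\<^esub> y \<in> N"
    "\<And>a x. a \<in> carrier R \<Longrightarrow> x \<in> N \<Longrightarrow> a \<odot>\<^bsub>M\<^esub> x \<in> N"
  shows "submodule N R M"
proof (intro submodule.intro submodule_axioms.intro)
  show "subgroup N (add_monoid M)"
  proof (rule group.subgroupI[OF M.a_group])
    fix x assume x: "x \<in> N"
    then have "(\<ominus>\<^bsub>R\<^esub> \<one>\<^bsub>R\<^esub>) \<odot>\<^bsub>M\<^esub> x \<in> N" using assms(4) by simp
    moreover have "(\<ominus>\<^bsub>R\<^esub> \<one>\<^bsub>R\<^esub>) \<odot>\<^bsub>M\<^esub> x = \<ominus>\<^bsub>M\<^esub> x" using x assms(1) by (subst smult_minus_left) auto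
    ultimately show "inv\<^bsub>add_monoid M\<^esub> x \<in> N" by (simp add: a_inv_def)
  qed (use assms in auto)
qed (rule assms(4))

lemma cyclic_submodule_submodule:
  assumes "x \<in> carrier M" shows "submodule (cyclic_submodule R M x) R M"
proof (rule submoduleI)
  show "\<zero>\<^bsub>M\<^esub> \<in> cyclic_submodule R M x"
    using smult_zero_left[OF assms] by (force simp: cyclic_submodule_def)
  fix y z assume "y \<in> cyclic_submodule R M x" "z \<in> cyclic_submodule R M x"
  then show "y \<oplus>\<^bsub>M\<^esub> z \<in> cyclic_submodule R M x"
    using assms by (auto simp: cyclic_submodule_def smult_l_distr[symmetric])
next
  fix a y assume "a \<in> carrier R" "y \<in> cyclic_submodule R M x"
  then show "a \<odot>\<^bsub>M\<^esub> y \<in> cyclic_submodule R M x"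
    using assms by (auto simp: cyclic_submodule_def smult_assoc[symmetric])
qed (use assms in \<open>auto simp: cyclic_submodule_def\<close>)

lemma submodule_left_module:
  assumes N: "submodule N R M" shows "left_module R (M\<lparr>carrier := N\<rparr>)"
proof -
  have sub: "N \<subseteq> carrier M" using N subgroup.subset[of N "add_monoid M"] by (simp add: submodule_def)
  have sg: "subgroup N (add_monoid M)" using N by (simp add: submodule_def)
  have "abelian_group (M\<lparr>carrier := N\<rparr>)"
  proof (rule abelian_groupI)
    fix x assume x: "x \<in> carrier (M\<lparr>carrier := N\<rparr>)"
    then have "\<ominus>\<^bsub>M\<^esub> x \<in> N" using subgroup.m_inv_closed[OF sg, of x] by (simp add: a_inv_def)
    then show "\<exists>y\<in>carrier (M\<lparr>carrier := N\<rparr>). y \<oplus>\<^bsub>M\<lparr>carrier := N\<rparr>\<^esub> x = \<zero>\<^bsub>M\<lparr>carrier := N\<rparr>\<^esub>"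
      using x sub by (intro bexI[of _ "\<ominus>\<^bsub>M\<^esub> x"]) (auto simp: M.l_neg)
  qed (use subgroup.m_closed[OF sg] subgroup.one_closed[OF sg] sub in \<open>auto simp: M.a_ac subset_iff\<close>)
  then show ?thesis using N sub
    by (intro left_module.intro left_module_axioms.intro R.ring_axioms)
      (auto simp: submodule_def submodule_axioms_def subset_iff smult_l_distr smult_r_distr smult_assoc)
qed

lemma left_module_iso_refl: "left_module_iso R M M"
  unfolding left_module_iso_def left_module_hom_def using left_module_axioms
  by (intro conjI bexI[of _ id]) auto

lemma annihilator_ideal: "ideal (annihilator R M) R"
proof (rule idealI)
  show "ring R" by (rule R.ring_axioms)
  show "subgroup (annihilator R M) (add_monoid R)"
  proof (rule group.subgroupI[OF R.a_group])
    fix a assume "a \<in> annihilator R M"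
    then show "inv\<^bsub>add_monoid R\<^esub> a \<in> annihilator R M"
      by (auto simp: annihilator_def smult_minus_left simp flip: a_inv_def)
  next
    show "annihilator R M \<noteq> {}" using smult_zero_left by (auto simp: annihilator_def)
  qed (auto simp: annihilator_def smult_l_distr)
qed (auto simp: annihilator_def smult_assoc smult_zero_right)

end

text \<open>The elements g with g p in J for all p form a two-sided ideal that contains the
  relations. Taking p = 1 gives the inclusion.\<close>

lemma klr_ideal_subset:
  assumes "klr_left_ideal e \<alpha> J" shows "klr_ideal e \<alpha> \<subseteq> J"
proof -
  interpret J: klr_left_ideal e \<alpha> J by fact
  let ?A = "free_algebra (klr_gens \<alpha>) :: 'a free_klr ring"
  interpret A: ring ?A by (rule ring_free_algebra)
  let ?X = "{g \<in> J.C. \<forall>p \<in> J.C. g * p \<in> J}"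
  have "ideal ?X ?A"
  proof (rule idealI)
    show "subgroup ?X (add_monoid ?A)"
    proof (rule group.subgroupI[OF A.a_group])
      show "?X \<noteq> {}" using free_algebra_zero by fastforce
      fix g assume g: "g \<in> ?X"
      have "- g \<in> ?X" using g J.I_uminus free_algebra_uminus by fastforce
      moreover have "\<ominus>\<^bsub>?A\<^esub> g = - g"
        using A.add.inv_equality[of "- g" g] g free_algebra_uminus[of g] by (simp add: free_algebra_def)
      ultimately show "inv\<^bsub>add_monoid ?A\<^esub> g \<in> ?X" by (simp add: a_inv_def)
      fix h assume h: "h \<in> ?X"
      have "g \<otimes>\<^bsub>add_monoid ?A\<^esub> h = g + h" by (simp add: free_algebra_def)
      moreover have "g + h \<in> J.C" using g h free_algebra_add_closed by blast
      moreover have "(g + h) * p \<in> J" if "p \<in> J.C" for p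
        using g h that J.I_add by (simp add: distrib_right)
      ultimately show "g \<otimes>\<^bsub>add_monoid ?A\<^esub> h \<in> ?X" by simp
    qed auto
  next
    fix a x assume "a \<in> ?X" "x \<in> carrier ?A"
    moreover have "x \<otimes>\<^bsub>?A\<^esub> a = x * a" "a \<otimes>\<^bsub>?A\<^esub> x = a * x" by (simp_all add: free_algebra_def)
    ultimately show "x \<otimes>\<^bsub>?A\<^esub> a \<in> ?X" "a \<otimes>\<^bsub>?A\<^esub> x \<in> ?X"
      using J.I_mult by (auto simp: mult.assoc free_algebra_mult_closed)
  qed (rule A.ring_axioms)
  moreover have "klr_relations e \<alpha> \<subseteq> ?X" using klr_relations_closed J.I_rel by blast
  ultimately have "klr_ideal e \<alpha> \<subseteq> ?X" unfolding klr_ideal_def by (rule A.genideal_minimal)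
  then show ?thesis using free_algebra_one by (fastforce dest!: subsetD)
qed

text \<open>
  The left ideal of relations of an element \<open>v\<close> of a module over the KLR algebra, lifted to the
  free algebra.
\<close>

definition lifted_relations ::
    "nat \<Rightarrow> int multiset \<Rightarrow> ('k::field klr_elt, 'b, 'd) module_scheme \<Rightarrow> 'b \<Rightarrow> 'k free_klr set" where
  "lifted_relations e \<alpha> M v =
     {p \<in> carrier (free_algebra (klr_gens \<alpha>)). klr_class e \<alpha> p \<odot>\<^bsub>M\<^esub> v = \<zero>\<^bsub>M\<^esub>}"

lemma lifted_relations_left_ideal:
  assumes "left_module (klr e \<alpha>) M" "v \<in> carrier M"
  shows "klr_left_ideal e \<alpha> (lifted_relations e \<alpha> M v)"
proof
  interpret left_module "klr e \<alpha>" M by fact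
  let ?C = "carrier (free_algebra (klr_gens \<alpha>))"
  show "lifted_relations e \<alpha> M v \<subseteq> ?C" by (auto simp: lifted_relations_def)
  show "0 \<in> lifted_relations e \<alpha> M v"
    using assms(2) by (simp add: lifted_relations_def free_algebra_zero klr_class_zero smult_zero_left)
  show "p + q \<in> lifted_relations e \<alpha> M v" if "p \<in> lifted_relations e \<alpha> M v" "q \<in> lifted_relations e \<alpha> M v" for p q
    using that assms(2) by (auto simp: lifted_relations_def free_algebra_add_closed klr_class_add klr_class_closed smult_l_distr)
  have m: "klr_class e \<alpha> (g * p) \<odot>\<^bsub>M\<^esub> v = klr_class e \<alpha> g \<odot>\<^bsub>M\<^esub> (klr_class e \<alpha> p \<odot>\<^bsub>M\<^esub> v)"
    if "g \<in> ?C" "p \<in> ?C" for g p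
    using that assms(2) by (simp add: klr_mult_class[symmetric] klr_class_closed smult_assoc)
  show "g * p \<in> lifted_relations e \<alpha> M v" if "g \<in> ?C" "p \<in> lifted_relations e \<alpha> M v" for g p
    using that m[of g p] by (auto simp: lifted_relations_def free_algebra_mult_closed klr_class_closed smult_zero_right)
  show "g * p \<in> lifted_relations e \<alpha> M v" if "g \<in> klr_relations e \<alpha>" "p \<in> ?C" for g p
  proof -
    have g: "g \<in> ?C" using that klr_relations_closed by blast
    have "g \<in> klr_ideal e \<alpha>" unfolding klr_ideal_def
      using ring.genideal_self[OF ring_free_algebra klr_relations_closed] that by blast
    then have "klr_class e \<alpha> g = \<zero>\<^bsub>klr e \<alpha>\<^esub>"
      using klr_class_eq_iff[OF g free_algebra_zero, of e] by (simp add: klr_class_zero)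
    then show ?thesis using that g m[OF g, of p] assms(2)
      by (simp add: lifted_relations_def free_algebra_mult_closed klr_class_closed smult_zero_left)
  qed
qed

definition free_perm_relations :: "nat \<Rightarrow> int list \<Rightarrow> nat list list \<Rightarrow> 'k::field free_klr set" where
  "free_perm_relations e \<kappa> \<mu> =
     (let \<alpha> = content e \<kappa> \<mu> in
        {fE js - (if js = initial_residues e \<kappa> \<mu> then 1 else 0) |js. js \<in> res_seqs \<alpha>}
      \<union> {fY r |r. r \<in> {1..size \<alpha>}}
      \<union> {fPsi r |r. r \<in> {1..<size \<alpha>} \<and> same_row \<mu> r (r + 1)})"

lemma free_perm_relations_closed:
  "free_perm_relations e \<kappa> \<mu> \<subseteq> carrier (free_algebra (klr_gens (content e \<kappa> \<mu>)))"
  by (auto simp: free_perm_relations_def Let_def klr_gens_def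
      intro!: free_algebra_diff fgen_closed free_algebra_one free_algebra_zero)

lemma perm_relations_eq: "(perm_relations e \<kappa> \<mu> :: 'k::field klr_elt set) = klr_class e (content e \<kappa> \<mu>) ` free_perm_relations e \<kappa> \<mu>"
proof -
  have "klr_e e (content e \<kappa> \<mu>) js \<ominus>\<^bsub>klr e (content e \<kappa> \<mu>)\<^esub> (if b then \<one>\<^bsub>klr e (content e \<kappa> \<mu>)\<^esub> else \<zero>\<^bsub>klr e (content e \<kappa> \<mu>)\<^esub>)
      = klr_class e (content e \<kappa> \<mu>) (fE js - (if b then 1 else 0) :: 'k free_klr)" if "js \<in> res_seqs (content e \<kappa> \<mu>)" for js b
  proof -
    have "(fE js :: 'k free_klr) \<in> carrier (free_algebra (klr_gens (content e \<kappa> \<mu>)))"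
      using that by (intro fgen_closed) (simp add: klr_gens_def)
    moreover have "(if b then 1 else 0 :: 'k free_klr) \<in> carrier (free_algebra (klr_gens (content e \<kappa> \<mu>)))"
      by (simp add: free_algebra_one free_algebra_zero)
    ultimately show ?thesis
      by (cases b) (simp_all only: klr_e_def klr_class_diff if_True if_False klr_class_one klr_class_zero)
  qed
  note D = this
  show ?thesis unfolding perm_relations_def free_perm_relations_def Let_def image_Un klr_y_def klr_psi_def
      setcompr_eq_image image_image
    by (intro arg_cong2[of _ _ _ _ "(\<union>)"] image_cong refl D) simp
qed

locale perm_setup =
  fixes e :: nat and \<kappa> :: "int list" and \<mu> :: "nat list list" and Per :: "('k::field klr_elt, 'k klr_elt set) module"
  assumes Per_def: "Per = perm_module e \<kappa> \<mu>"
begin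

abbreviation \<alpha> :: "int multiset" where "\<alpha> \<equiv> content e \<kappa> \<mu>"
abbreviation K :: "'k klr_elt ring" where "K \<equiv> klr e \<alpha>"
abbreviation C :: "'k free_klr set" where "C \<equiv> carrier (free_algebra (klr_gens \<alpha>))"
abbreviation gen :: "'k klr_elt set" where "gen \<equiv> perm_gen e \<kappa> \<mu>"
abbreviation I :: "'k free_klr set" where "I \<equiv> lifted_relations e \<alpha> Per gen"

sublocale M: left_module K Per unfolding Per_def by (rule left_module_perm)

interpretation Rg: left_module K "regular_module K" by (rule left_module_regular[OF ring_klr])

lemma perm_kernel_submodule: "submodule (perm_kernel e \<kappa> \<mu>) K (regular_module K)"
  unfolding perm_kernel_def Let_def
  by (rule Rg.gen_submodule_submodule) (use perm_relations_closed in \<open>auto simp: regular_module_def\<close>)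

lemma gen_eq: "gen = perm_kernel e \<kappa> \<mu> +>\<^bsub>regular_module K\<^esub> \<one>\<^bsub>K\<^esub>"
  by (simp add: perm_gen_def Let_def)

lemma class_gen:
  assumes "p \<in> C"
  shows "klr_class e \<alpha> p \<odot>\<^bsub>Per\<^esub> gen = perm_kernel e \<kappa> \<mu> +>\<^bsub>regular_module K\<^esub> klr_class e \<alpha> p"
proof -
  interpret ring K by (rule ring_klr)
  have "klr_class e \<alpha> p \<in> carrier K" using assms by (rule klr_class_closed)
  then show ?thesis unfolding gen_eq Per_def perm_module_def
    by (subst Rg.quot_smult[OF perm_kernel_submodule]) (auto simp: regular_module_def)
qed

lemma gen_closed: "gen \<in> carrier Per"
proof -
  interpret ring K by (rule ring_klr)
  show ?thesis unfolding gen_eq Per_def perm_module_def Rg.quot_carrier by (auto simp: regular_module_def)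
qed

lemma Per_surj: "x \<in> carrier Per \<Longrightarrow> \<exists>p \<in> C. x = klr_class e \<alpha> p \<odot>\<^bsub>Per\<^esub> gen"
proof -
  assume "x \<in> carrier Per"
  then obtain X where X: "X \<in> carrier K" "x = perm_kernel e \<kappa> \<mu> +>\<^bsub>regular_module K\<^esub> X"
    unfolding Per_def perm_module_def Rg.quot_carrier by (auto simp: regular_module_def)
  then show ?thesis using klr_class_surj class_gen by metis
qed

lemma I_left_ideal: "klr_left_ideal e \<alpha> I"
  by (rule lifted_relations_left_ideal[OF M.left_module_axioms gen_closed])

lemma class_mult:
  assumes "p \<in> C" "q \<in> C"
  shows "klr_class e \<alpha> (p * q) \<odot>\<^bsub>Per\<^esub> gen = klr_class e \<alpha> p \<odot>\<^bsub>Per\<^esub> (klr_class e \<alpha> q \<odot>\<^bsub>Per\<^esub> gen)"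
  using assms gen_closed by (simp add: klr_mult_class[symmetric] klr_class_closed M.smult_assoc)

lemma class_add:
  assumes "p \<in> C" "q \<in> C"
  shows "klr_class e \<alpha> (p + q) \<odot>\<^bsub>Per\<^esub> gen = klr_class e \<alpha> p \<odot>\<^bsub>Per\<^esub> gen \<oplus>\<^bsub>Per\<^esub> klr_class e \<alpha> q \<odot>\<^bsub>Per\<^esub> gen"
  using assms gen_closed by (simp add: klr_class_add klr_class_closed M.smult_l_distr)

lemma class_eq_iff:
  assumes "p \<in> C" "q \<in> C"
  shows "klr_class e \<alpha> p \<odot>\<^bsub>Per\<^esub> gen = klr_class e \<alpha> q \<odot>\<^bsub>Per\<^esub> gen \<longleftrightarrow> p - q \<in> I"
proof -
  have c: "klr_class e \<alpha> r \<odot>\<^bsub>Per\<^esub> gen \<in> carrier Per" if "r \<in> C" for r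
    using that gen_closed by (intro M.smult_closed klr_class_closed)
  have d: "p - q \<in> C" using assms by (rule free_algebra_diff)
  have "klr_class e \<alpha> p \<odot>\<^bsub>Per\<^esub> gen = klr_class e \<alpha> (p - q) \<odot>\<^bsub>Per\<^esub> gen \<oplus>\<^bsub>Per\<^esub> klr_class e \<alpha> q \<odot>\<^bsub>Per\<^esub> gen"
    using class_add[OF d assms(2)] by simp
  moreover have "z \<oplus>\<^bsub>Per\<^esub> y = y \<longleftrightarrow> z = \<zero>\<^bsub>Per\<^esub>" if "z \<in> carrier Per" "y \<in> carrier Per" for z y
    using M.M.add.right_cancel[of y z "\<zero>\<^bsub>Per\<^esub>"] that by simp
  ultimately show ?thesis using c[OF d] c[OF assms(2)] d by (simp add: lifted_relations_def)
qed

lemma relators_in_I: "free_perm_relations e \<kappa> \<mu> \<subseteq> I"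
proof
  fix p :: "'k free_klr" assume p: "p \<in> free_perm_relations e \<kappa> \<mu>"
  then have pC: "p \<in> C" using free_perm_relations_closed by blast
  have "klr_class e \<alpha> p \<in> perm_kernel e \<kappa> \<mu>"
    unfolding perm_kernel_def Let_def 
    by (rule subsetD[OF Rg.gen_submodule_subset]) (use p in \<open>auto simp: perm_relations_eq\<close>)
  moreover have "klr_class e \<alpha> p \<in> carrier (regular_module K)" using klr_class_closed[OF pC] by (simp add: regular_module_def)
  ultimately have "klr_class e \<alpha> p \<odot>\<^bsub>Per\<^esub> gen = perm_kernel e \<kappa> \<mu>"
    unfolding class_gen[OF pC] using Rg.quot_eq_zero[OF perm_kernel_submodule] by blast
  then show "p \<in> I" using pC by (simp add: lifted_relations_def Per_def perm_module_def Rg.quot_zero)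
qed

text \<open>The universal property of the presented module, lifted to the free algebra. The classes
  of J form a left ideal containing the relations, and passing back to representatives stays inside
  J because J contains the ideal of relations.\<close>

lemma I_least:
  assumes "klr_left_ideal e \<alpha> J" "free_perm_relations e \<kappa> \<mu> \<subseteq> J"
  shows "I \<subseteq> J"
proof
  interpret J: klr_left_ideal e \<alpha> J by fact
  interpret ring K by (rule ring_klr)
  fix p assume "p \<in> I"
  then have p: "p \<in> C" "klr_class e \<alpha> p \<odot>\<^bsub>Per\<^esub> gen = \<zero>\<^bsub>Per\<^esub>" by (auto simp: lifted_relations_def)
  have JC: "J \<subseteq> C" by (rule J.I_sub)
  have pc: "klr_class e \<alpha> p \<in> carrier (regular_module K)" using klr_class_closed[OF p(1)] by (simp add: regular_module_def)
  have "perm_kernel e \<kappa> \<mu> +>\<^bsub>regular_module K\<^esub> klr_class e \<alpha> p = perm_kernel e \<kappa> \<mu>"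
    using p unfolding class_gen[OF p(1)] by (simp add: Per_def perm_module_def Rg.quot_zero)
  then have "klr_class e \<alpha> p \<in> perm_kernel e \<kappa> \<mu>" using Rg.quot_eq_zero[OF perm_kernel_submodule pc] by simp
  moreover have "submodule (klr_class e \<alpha> ` J) K (regular_module K)"
  proof (rule Rg.submoduleI)
    show "klr_class e \<alpha> ` J \<subseteq> carrier (regular_module K)" using JC klr_class_closed by (auto simp: regular_module_def)
    show "\<zero>\<^bsub>regular_module K\<^esub> \<in> klr_class e \<alpha> ` J"
      using J.I_zero klr_class_zero[of e \<alpha>] by (force simp: regular_module_def)
    fix X Y assume "X \<in> klr_class e \<alpha> ` J" "Y \<in> klr_class e \<alpha> ` J"
    then show "X \<oplus>\<^bsub>regular_module K\<^esub> Y \<in> klr_class e \<alpha> ` J"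
      using JC J.I_add by (auto simp: regular_module_def klr_class_add[symmetric] subset_iff)
  next
    fix a X assume "a \<in> carrier K" "X \<in> klr_class e \<alpha> ` J"
    then obtain g q where "g \<in> C" "a = klr_class e \<alpha> g" "q \<in> J" "X = klr_class e \<alpha> q" using klr_class_surj by blast
    then show "a \<odot>\<^bsub>regular_module K\<^esub> X \<in> klr_class e \<alpha> ` J"
      using JC J.I_mult by (auto simp: regular_module_def klr_mult_class subset_iff)
  qed
  moreover have "perm_relations e \<kappa> \<mu> \<subseteq> klr_class e \<alpha> ` J" using assms(2) by (auto simp: perm_relations_eq)
  ultimately have "klr_class e \<alpha> p \<in> klr_class e \<alpha> ` J"
    unfolding perm_kernel_def Let_def using Rg.gen_submodule_least by blast
  then obtain q where q: "q \<in> J" "klr_class e \<alpha> p = klr_class e \<alpha> q" by auto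
  then have "p - q \<in> J" using klr_class_eq_iff[of p \<alpha> q e] p JC klr_ideal_subset[OF assms(1)] by auto
  then show "p \<in> J" using J.I_add[of "p - q" q] q by simp
qed

end

section \<open>Tableaux with two rows\<close>

lemma row_res_replicate_nth:
  "j < m \<Longrightarrow> row_res x y (replicate m False) ! j = x + int j"
  "j < m \<Longrightarrow> row_res x y (replicate m True) ! j = y + int j"
proof -
  show "j < m \<Longrightarrow> row_res x y (replicate m False) ! j = x + int j"
  proof (induction m arbitrary: x j)
    case (Suc m)
    then show ?case by (cases j) auto
  qed simp
  show "j < m \<Longrightarrow> row_res x y (replicate m True) ! j = y + int j"
  proof (induction m arbitrary: y j)
    case (Suc m)
    then show ?case by (cases j) auto
  qed simp
qed

lemma length_top_word: "length (top_word K N) = K + N"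
  by (simp add: top_word_def)

lemma row_res_top_nth:
  "j < K + N \<Longrightarrow> row_res x y (top_word K N) ! j = (if j < K then x + int j else y + int (j - K))"
  by (simp add: top_word_def nth_append row_res_replicate_nth)

text \<open>The second row sits at (1, 2) for a partition and at (2, 1) for a bipartition with two
  one-row components, so that both shapes share the facts about reading order.\<close>

locale two_row_shape =
  fixes \<mu> :: "nat list list" and m2 a2 K N :: nat
  assumes diag: "diagram \<mu> = (\<lambda>c. (1, 1, c)) ` {1..K} \<union> (\<lambda>c. (m2, a2, c)) ` {1..N}"
    and second: "1 < m2 \<or> m2 = 1 \<and> 1 < a2"
begin

definition node :: "nat \<Rightarrow> node" where "node t = (if t \<le> K then (1, 1, t) else (m2, a2, t - K))"

lemma node_image: "node ` {1..K + N} = diagram \<mu>"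
proof (intro equalityI subsetI)
  fix A assume "A \<in> node ` {1..K + N}"
  then obtain t where t: "A = node t" "1 \<le> t" "t \<le> K + N" by auto
  show "A \<in> diagram \<mu>"
  proof (cases "t \<le> K")
    case False
    then have "t - K \<in> {1..N}" using t by auto
    then show ?thesis using False t by (simp add: node_def diag)
  qed (use t in \<open>simp add: node_def diag\<close>)
next
  fix A assume "A \<in> diagram \<mu>"
  then consider c where "A = node c" "c \<in> {1..K}" | c where "A = node (K + c)" "c \<in> {1..N}"
    unfolding diag by (auto simp: node_def)
  then show "A \<in> node ` {1..K + N}" by cases auto
qed

lemma initial_node: "t \<in> {1..K + N} \<Longrightarrow> initial_tableau \<mu> (node t) = t"
proof -
  assume t: "t \<in> {1..K + N}"
  have inj: "inj (\<lambda>c. (m, a, c) :: node)" for m a by (simp add: inj_def)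
  have inD: "node t \<in> diagram \<mu>" using node_image t by blast
  show ?thesis
  proof (cases "t \<le> K")
    case True
    have "{(m', a', b') \<in> diagram \<mu>. m' < 1 \<or> (m' = 1 \<and> (a' < 1 \<or> (a' = 1 \<and> b' \<le> t)))} = (\<lambda>c. (1, 1, c)) ` {1..t}"
      using second True by (auto simp: diag)
    then show ?thesis using True inD by (simp add: initial_tableau_def node_def card_image[OF inj_on_subset[OF inj]])
  next
    case False
    have "{(m', a', b') \<in> diagram \<mu>. m' < m2 \<or> (m' = m2 \<and> (a' < a2 \<or> (a' = a2 \<and> b' \<le> t - K)))} =
        (\<lambda>c. (1, 1, c)) ` {1..K} \<union> (\<lambda>c. (m2, a2, c)) ` {1..t - K}"
      using second False t by (auto simp: diag)
    moreover have "card ((\<lambda>c. (1, 1, c) :: node) ` {1..K} \<union> (\<lambda>c. (m2, a2, c)) ` {1..t - K}) = K + (t - K)"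
      using second by (subst card_Un_disjoint) (auto simp: card_image[OF inj_on_subset[OF inj]])
    ultimately show ?thesis using False inD by (simp add: initial_tableau_def node_def)
  qed
qed

lemma inj_node: "inj_on node {1..K + N}"
  by (rule inj_on_inverseI[of _ "initial_tableau \<mu>"]) (rule initial_node)

lemma card_diagram: "card (diagram \<mu>) = K + N"
  using card_image[OF inj_node] unfolding node_image by simp

lemma node_initial: "A \<in> diagram \<mu> \<Longrightarrow> node (initial_tableau \<mu> A) = A \<and> initial_tableau \<mu> A \<in> {1..K + N}"
  using initial_node by (force simp flip: node_image)

lemma bij_initial: "bij_betw (initial_tableau \<mu>) (diagram \<mu>) {1..K + N}"
  using node_initial initial_node node_image
  by (intro bij_betw_byWitness[of _ node]) auto

lemma initial_residues_eq:
  assumes "\<And>c. residue e \<kappa> (1, 1, c) = (x + int c - 1) mod int e"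
    and "\<And>c. residue e \<kappa> (m2, a2, c) = (y + int c - 1) mod int e"
  shows "initial_residues e \<kappa> \<mu> = map (\<lambda>c. c mod int e) (row_res x y (top_word K N))"
proof (rule nth_equalityI)
  show "length (initial_residues e \<kappa> \<mu>) = length (map (\<lambda>c. c mod int e) (row_res x y (top_word K N)))"
    by (auto simp: initial_residues_def card_diagram top_word_def)
  fix j assume "j < length (initial_residues e \<kappa> \<mu>)"
  then have j: "j < K + N" by (simp add: initial_residues_def card_diagram del: upt_Suc)
  have "inv_into (diagram \<mu>) (initial_tableau \<mu>) (Suc j) = node (Suc j)"
    using j node_image initial_node[of "Suc j"] bij_initial
    by (intro inv_into_f_eq) (auto simp: bij_betw_def)
  then have "initial_residues e \<kappa> \<mu> ! j = residue e \<kappa> (node (Suc j))"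
    using j by (simp add: initial_residues_def card_diagram del: upt_Suc)
  also have "\<dots> = (row_res x y (top_word K N) ! j) mod int e"
  proof (cases "j < K")
    case True
    then show ?thesis by (simp add: node_def assms(1)[unfolded One_nat_def] row_res_top_nth[OF j])
  next
    case False
    then have "Suc j - K = Suc (j - K)" by simp
    then show ?thesis using False by (simp add: node_def assms(2) row_res_top_nth[OF j])
  qed
  also have "\<dots> = map (\<lambda>c. c mod int e) (row_res x y (top_word K N)) ! j"
    using j by (simp add: length_top_word)
  finally show "initial_residues e \<kappa> \<mu> ! j = map (\<lambda>c. c mod int e) (row_res x y (top_word K N)) ! j" .
qed

lemma content_eq: "content e \<kappa> \<mu> = mset (initial_residues e \<kappa> \<mu>)"
proof -
  have "mset (initial_residues e \<kappa> \<mu>) =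
      image_mset (residue e \<kappa>) (image_mset (inv_into (diagram \<mu>) (initial_tableau \<mu>)) (mset_set {1..K + N}))"
    unfolding initial_residues_def card_diagram mset_map
    by (simp add: image_mset.compositionality comp_def mset_upt atLeastLessThanSuc_atLeastAtMost del: upt_Suc flip: Suc_eq_plus1)
  also have "image_mset (inv_into (diagram \<mu>) (initial_tableau \<mu>)) (mset_set {1..K + N}) = mset_set (diagram \<mu>)"
    using bij_betw_inv_into[OF bij_initial] by (metis bij_betw_def image_mset_mset_set)
  finally show ?thesis by (simp add: content_def)
qed

lemma same_row_iff:
  assumes "1 \<le> t" "t < K + N"
  shows "same_row \<mu> t (t + 1) \<longleftrightarrow> t \<noteq> K"
proof
  assume "same_row \<mu> t (t + 1)"
  then obtain m a b c where "(m, a, b) \<in> diagram \<mu>" "(m, a, c) \<in> diagram \<mu>"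
    "initial_tableau \<mu> (m, a, b) = t" "initial_tableau \<mu> (m, a, c) = t + 1" by (auto simp: same_row_def)
  then have "node t = (m, a, b)" "node (t + 1) = (m, a, c)" using node_initial by metis+
  then show "t \<noteq> K" using second by (auto simp: node_def)
next
  assume t: "t \<noteq> K"
  have n: "node t \<in> diagram \<mu>" "node (t + 1) \<in> diagram \<mu>" using node_image assms by fastforce+
  have i: "initial_tableau \<mu> (node t) = t" "initial_tableau \<mu> (node (t + 1)) = t + 1"
    using assms by (auto intro!: initial_node)
  show "same_row \<mu> t (t + 1)"
  proof (cases "t < K")
    case True
    then show ?thesis unfolding same_row_def using n i
      by (intro exI[of _ 1] exI[of _ 1] exI[of _ t] exI[of _ "t + 1"]) (simp add: node_def)
  next
    case False
    then show ?thesis unfolding same_row_def using n i t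
      by (intro exI[of _ m2] exI[of _ a2] exI[of _ "t - K"] exI[of _ "t + 1 - K"]) (simp add: node_def)
  qed
qed

lemma tableau_perm:
  assumes G: "tableau \<mu> G"
  shows "tableau_perm \<mu> G permutes {1..K + N}" "t \<in> {1..K + N} \<Longrightarrow> tableau_perm \<mu> G t = G (node t)"
proof -
  let ?P = "\<lambda>w. w permutes {1..card (diagram \<mu>)} \<and> (\<forall>A\<in>diagram \<mu>. w (initial_tableau \<mu> A) = G A)"
  define w where "w = (\<lambda>t. if t \<in> {1..K + N} then G (node t) else t)"
  have bG: "bij_betw G (diagram \<mu>) {1..K + N}" using G by (simp add: tableau_def card_diagram)
  have "bij_betw node {1..K + N} (diagram \<mu>)" using inj_node node_image by (simp add: bij_betw_def)
  then have "bij_betw (G \<circ> node) {1..K + N} {1..K + N}" using bG by (rule bij_betw_trans)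
  moreover have "bij_betw w {1..K + N} {1..K + N} \<longleftrightarrow> bij_betw (G \<circ> node) {1..K + N} {1..K + N}"
    by (rule bij_betw_cong) (simp add: w_def)
  ultimately have "bij_betw w {1..K + N} {1..K + N}" by simp
  then have "w permutes {1..K + N}" by (rule bij_imp_permutes) (auto simp: w_def)
  moreover have "\<forall>A\<in>diagram \<mu>. w (initial_tableau \<mu> A) = G A" using node_initial by (auto simp: w_def)
  ultimately have P: "?P w" by (simp add: card_diagram)
  have "tableau_perm \<mu> G = w" unfolding tableau_perm_def
  proof (rule the_equality)
    show "?P w" by (rule P)
    fix w' assume w': "?P w'"
    show "w' = w"
    proof
      fix t
      show "w' t = w t"
      proof (cases "t \<in> {1..K + N}")
        case True
        then have "w' (initial_tableau \<mu> (node t)) = G (node t)" using w' node_image by blast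
        then show ?thesis using True initial_node by (simp add: w_def)
      next
        case False
        moreover have "w' permutes {1..K + N}" using w' by (simp add: card_diagram)
        ultimately have "w' t = t" by (rule permutes_not_in[rotated])
        then show ?thesis using False by (auto simp: w_def)
      qed
    qed
  qed
  then show "tableau_perm \<mu> G permutes {1..K + N}" "t \<in> {1..K + N} \<Longrightarrow> tableau_perm \<mu> G t = G (node t)"
    using P by (simp_all add: card_diagram w_def)
qed

end

lemma two_row_shape_partition: "r \<le> k \<Longrightarrow> two_row_shape [[k, r]] 1 2 k r"
proof
  show "diagram [[k, r]] = (\<lambda>c. (1, 1, c)) ` {1..k} \<union> (\<lambda>c. (1, 2, c)) ` {1..r}"
    by (auto simp: diagram_def nth_Cons' image_iff numeral_2_eq_2 le_Suc_eq split: if_splits)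
qed simp

lemma two_row_shape_bipartition: "two_row_shape [[p], [q]] 2 1 p q"
proof
  show "diagram [[p], [q]] = (\<lambda>c. (1, 1, c)) ` {1..p} \<union> (\<lambda>c. (2, 1, c)) ` {1..q}"
    by (auto simp: diagram_def nth_Cons' image_iff numeral_2_eq_2 le_Suc_eq split: if_splits)
qed simp

text \<open>A strictly increasing chain of m numbers in an interval of m integers leaves no gap.
  This forces the entries in the belt of a Garnir tableau.\<close>

lemma increasing_interval:
  fixes h :: "nat \<Rightarrow> nat"
  assumes "\<And>c. 1 \<le> c \<Longrightarrow> c < m \<Longrightarrow> h c < h (c + 1)" "1 \<le> m \<Longrightarrow> s < h 1" "1 \<le> m \<Longrightarrow> h m \<le> s + m" "1 \<le> c" "c \<le> m"
  shows "h c = s + c"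
proof -
  have lo: "1 \<le> c \<Longrightarrow> c \<le> m \<Longrightarrow> s + c \<le> h c" for c
  proof (induction c)
    case (Suc c)
    then show ?case using assms(1)[of c] assms(2) by (cases "c = 0") auto
  qed simp
  have hi: "c \<le> m \<Longrightarrow> 1 \<le> c \<Longrightarrow> h c \<le> s + c" for c
  proof (induction rule: inc_induct)
    case base
    then show ?case using assms(3) by simp
  next
    case (step c)
    then show ?case using assms(1)[of c] by simp
  qed
  show ?thesis using lo hi assms(4,5) by (simp add: le_antisym)
qed

context
  fixes k r b :: nat
  assumes rk: "r \<le> k" and b: "1 \<le> b" "b \<le> r"
begin

interpretation S: two_row_shape "[[k, r]]" 1 2 k r using rk by (rule two_row_shape_partition)

text \<open>Row-standardness and the order between the two rows of the belt arrange its k + 1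
  entries in a chain. The prescribed entries outside leave exactly b, ..., b + k for them, so the
  description has a unique solution.\<close>

lemma garnir_tableau_eq:
  assumes "node \<in> diagram [[k, r]]"
  shows "garnir_tableau [[k, r]] (1, 1, b) node =
     (case node of (m, a, c) \<Rightarrow> if a = 1 then (if c < b then c else c + b) else (if c \<le> b then b - 1 + c else k + c))"
    and "tableau [[k, r]] (garnir_tableau [[k, r]] (1, 1, b))"
proof -
  let ?D = "diagram [[k, r]]" and ?A = "(1, 1, b) :: node"
  define g :: "node \<Rightarrow> nat" where "g = (\<lambda>(m, a, c). if a = 1 then (if c < b then c else c + b) else (if c \<le> b then b - 1 + c else k + c))"
  define G where "G = restrict g ?D"
  have D: "node \<in> ?D \<longleftrightarrow> (\<exists>c. node = (1, 1, c) \<and> 1 \<le> c \<and> c \<le> k) \<or> (\<exists>c. node = (1, 2, c) \<and> 1 \<le> c \<and> c \<le> r)" for node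
    by (auto simp: S.diag)
  have T: "initial_tableau [[k, r]] (1, 1, c) = c" if "1 \<le> c" "c \<le> k" for c
    using S.initial_node[of c, unfolded S.node_def] that by simp
  have T2: "initial_tableau [[k, r]] (1, 2, c) = k + c" if "1 \<le> c" "c \<le> r" for c
    using S.initial_node[of "k + c", unfolded S.node_def] that by simp
  have U: "belt_upper [[k, r]] ?A = {(1, 1, c) |c. b \<le> c \<and> c \<le> k}"
    using b by (auto simp: belt_upper_def D)
  have L: "belt_lower ?A = {(1, 2, c) |c. 1 \<le> c \<and> c \<le> b}"
    by (auto simp: belt_lower_def numeral_2_eq_2)
  let ?P = "\<lambda>G. row_standard [[k, r]] G \<and>
        (\<forall>B \<in> ?D - (belt_upper [[k, r]] ?A \<union> belt_lower ?A). G B = initial_tableau [[k, r]] B) \<and>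
        (\<forall>B \<in> belt_lower ?A. \<forall>C \<in> belt_upper [[k, r]] ?A. G B < G C)"
  have "inj_on G ?D"
    by (rule inj_onI) (use b rk in \<open>auto simp: D G_def g_def split: if_splits\<close>)
  moreover have "G ` ?D \<subseteq> {1..k + r}" using b rk by (auto simp: D G_def g_def)
  ultimately have "bij_betw G ?D {1..k + r}"
    unfolding bij_betw_def using S.card_diagram by (metis card_image card_subset_eq card_atLeastAtMost diff_Suc_1 finite_atLeastAtMost plus_1_eq_Suc add.commute)
  then have tG: "tableau [[k, r]] G" by (simp add: tableau_def S.card_diagram G_def)
  have P: "?P G"
  proof (intro conjI ballI)
    show "row_standard [[k, r]] G" unfolding row_standard_def using tG b rk
      by (auto simp: D G_def g_def)
    show "G B = initial_tableau [[k, r]] B" if "B \<in> ?D - (belt_upper [[k, r]] ?A \<union> belt_lower ?A)" for B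
    proof -
      have "B \<in> ?D" and n: "B \<notin> belt_upper [[k, r]] ?A" "B \<notin> belt_lower ?A" using that by auto
      then consider c where "B = (1, 1, c)" "1 \<le> c" "c \<le> k" | c where "B = (1, 2, c)" "1 \<le> c" "c \<le> r"
        unfolding D by blast
      then show ?thesis
      proof cases
        case 1
        then have "c < b" using n unfolding U by (metis (mono_tags, lifting) mem_Collect_eq not_le)
        then show ?thesis unfolding 1(1) T[OF 1(2,3)] using 1 by (auto simp: D G_def g_def)
      next
        case 2
        then have "b < c" using n unfolding L by (metis (mono_tags, lifting) mem_Collect_eq not_le)
        then show ?thesis unfolding 2(1) T2[OF 2(2,3)] using 2 by (auto simp: D G_def g_def)
      qed
    qed
    show "G B < G C" if BC: "B \<in> belt_lower ?A" "C \<in> belt_upper [[k, r]] ?A" for B C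
    proof -
      obtain c c' where "B = (1, 2, c)" "1 \<le> c" "c \<le> b" "C = (1, 1, c')" "b \<le> c'" "c' \<le> k"
        using BC unfolding U L by blast
      then show ?thesis using b rk by (simp add: G_def g_def D)
    qed
  qed
  have "garnir_tableau [[k, r]] ?A = G" unfolding garnir_tableau_def
  proof (rule the_equality)
    show "?P G" by (rule P)
    fix G' assume G': "?P G'"
    have tG': "tableau [[k, r]] G'" using G' by (simp add: row_standard_def)
    then have bij: "bij_betw G' ?D {1..k + r}" by (simp add: tableau_def S.card_diagram)
    have inj: "B = B'" if "G' B = G' B'" "B \<in> ?D" "B' \<in> ?D" for B B' using bij that by (auto simp: bij_betw_def inj_on_def)
    have out: "G' B = initial_tableau [[k, r]] B" if "B \<in> ?D - (belt_upper [[k, r]] ?A \<union> belt_lower ?A)" for B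
      using G' that by blast
    have low: "G' (1, 1, c) = c" if "1 \<le> c" "c < b" for c
    proof -
      have "(1, 1, c) \<in> ?D - (belt_upper [[k, r]] ?A \<union> belt_lower ?A)" unfolding U L using that b rk by (simp add: D)
      from out[OF this] show ?thesis using T[of c] that b rk by simp
    qed
    have high: "G' (1, 2, c) = k + c" if "b < c" "c \<le> r" for c
    proof -
      have "(1, 2, c) \<in> ?D - (belt_upper [[k, r]] ?A \<union> belt_lower ?A)" unfolding U L using that b rk by (simp add: D)
      from out[OF this] show ?thesis using T2[of c] that b rk by simp
    qed
    have rs: "G' (1, 1, c) < G' (1, 1, c')" if "1 \<le> c" "c < c'" "c' \<le> k" for c c'
    proof -
      have "row_standard [[k, r]] G'" using G' by blast
      then show ?thesis using that unfolding row_standard_def by (simp add: D)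
    qed
    have rs2: "G' (1, 2, c) < G' (1, 2, c')" if "1 \<le> c" "c < c'" "c' \<le> r" for c c'
    proof -
      have "row_standard [[k, r]] G'" using G' by blast
      then show ?thesis using that unfolding row_standard_def by (simp add: D)
    qed
    have lu: "G' (1, 2, c) < G' (1, 1, c')" if "1 \<le> c" "c \<le> b" "b \<le> c'" "c' \<le> k" for c c'
    proof -
      have "(1, 2, c) \<in> belt_lower ?A" "(1, 1, c') \<in> belt_upper [[k, r]] ?A" unfolding U L using that by blast+
      then show ?thesis using G' by blast
    qed
    \<comment> \<open>The belt in increasing order: its b lower nodes come first, and the upper part
      starts at column b, so that the upper node in column c has index c + 1.\<close>
    define h where "h = (\<lambda>c. if c \<le> b then G' (1, 2, c) else G' (1, 1, c - 1))"
    have h: "h c = b - 1 + c" if "1 \<le> c" "c \<le> k + 1" for c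
    proof (rule increasing_interval[OF _ _ _ that])
      fix c assume c: "1 \<le> c" "c < k + 1"
      show "h c < h (c + 1)"
      proof (cases c b rule: linorder_cases)
        case less
        then show ?thesis using c b rs2[of c "c + 1"] by (simp add: h_def)
      next
        case equal
        then show ?thesis using c b rk lu[of b b] by (simp add: h_def)
      next
        case greater
        then show ?thesis using c b rs[of "c - 1" c] by (simp add: h_def)
      qed
    next
      have in1: "G' (1, 2, 1) \<in> {1..k + r}" using bij b unfolding bij_betw_def by (auto simp: D)
      have "G' (1, 2, 1) \<noteq> c" if "1 \<le> c" "c < b" for c
        using low[OF that] inj[of "(1, 2, 1)" "(1, 1, c)"] that b rk by (auto simp: D)
      then have "b - 1 < G' (1, 2, 1)" using in1 by (metis atLeastAtMost_iff b(1) le_add_diff_inverse not_less less_Suc_eq_le plus_1_eq_Suc)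
      then show "b - 1 < h 1" using b by (simp add: h_def)
      have kin: "G' (1, 1, k) \<in> {1..k + r}" using bij b rk unfolding bij_betw_def by (auto simp: D)
      have ne: "G' (1, 1, k) \<noteq> k + c" if "b < c" "c \<le> r" for c
        using high[OF that] inj[of "(1, 1, k)" "(1, 2, c)"] that b rk by (auto simp: D)
      have "G' (1, 1, k) \<le> k + b"
      proof (rule ccontr)
        assume "\<not> G' (1, 1, k) \<le> k + b"
        then obtain c where "G' (1, 1, k) = k + Suc (b + c)"
          by (metis add.assoc add_Suc_right less_iff_Suc_add not_le)
        then show False using ne[of "Suc (b + c)"] kin by simp
      qed
      then show "h (k + 1) \<le> b - 1 + (k + 1)" using b rk by (simp add: h_def)
    qed
    show "G' = G"
    proof
      fix B
      show "G' B = G B"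
      proof (cases "B \<in> ?D")
        case True
        then consider c where "B = (1, 1, c)" "1 \<le> c" "c \<le> k" | c where "B = (1, 2, c)" "1 \<le> c" "c \<le> r"
          unfolding D by blast
        then show ?thesis
        proof cases
          case 1
          then show ?thesis using low[of c] h[of "c + 1"] b by (auto simp: G_def g_def D h_def)
        next
          case 2
          then show ?thesis using high[of c] h[of c] b rk by (auto simp: G_def g_def D h_def)
        qed
      next
        case False
        then show ?thesis using tG' by (cases B) (simp add: G_def tableau_def extensional_def)
      qed
    qed
  qed
  then show "garnir_tableau [[k, r]] (1, 1, b) node =
     (case node of (m, a, c) \<Rightarrow> if a = 1 then (if c < b then c else c + b) else (if c \<le> b then b - 1 + c else k + c))"
    "tableau [[k, r]] (garnir_tableau [[k, r]] (1, 1, b))"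
    using tG assms by (simp_all add: G_def g_def)
qed

lemma garnir_perm:
  defines "w \<equiv> tableau_perm [[k, r]] (garnir_tableau [[k, r]] (1, 1, b))"
  shows "w permutes {1..k + r}"
    and "1 \<le> t \<Longrightarrow> t \<le> k \<Longrightarrow> w t = (if t < b then t else t + b)"
    and "1 \<le> c \<Longrightarrow> c \<le> r \<Longrightarrow> w (k + c) = (if c \<le> b then b - 1 + c else k + c)"
proof -
  have "(1, 1, 1) \<in> diagram [[k, r]]" using b rk by (auto simp: S.diag)
  note tab = garnir_tableau_eq(2)[OF this]
  show "w permutes {1..k + r}" unfolding w_def by (rule S.tableau_perm(1)[OF tab])
  have "S.node t \<in> diagram [[k, r]]" if "t \<in> {1..k + r}" for t using S.node_image that by blast
  then have w: "w t = (case S.node t of (m, a, c) \<Rightarrow> if a = 1 then (if c < b then c else c + b) else (if c \<le> b then b - 1 + c else k + c))"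
    if "t \<in> {1..k + r}" for t
    unfolding w_def S.tableau_perm(2)[OF tab that] using garnir_tableau_eq(1) that by blast
  show "1 \<le> t \<Longrightarrow> t \<le> k \<Longrightarrow> w t = (if t < b then t else t + b)"
    using w[of t, unfolded S.node_def] by simp
  show "1 \<le> c \<Longrightarrow> c \<le> r \<Longrightarrow> w (k + c) = (if c \<le> b then b - 1 + c else k + c)"
    using w[of "k + c", unfolded S.node_def] by simp
qed

end

section \<open>Reduced expressions of shuffles\<close>

lemma expr_prod_Cons: "expr_prod (t # rs) = Transposition.transpose t (t + 1) \<circ> expr_prod rs"
  by (simp add: expr_prod_def)

lemma expr_prod_permutes: "set rs \<subseteq> {1..<n} \<Longrightarrow> expr_prod rs permutes {1..n}"
proof (induction rs)
  case (Cons t rs)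
  have "Transposition.transpose t (t + 1) permutes {1..n}" using Cons.prems by (intro permutes_swap_id) auto
  then show ?case unfolding expr_prod_Cons using Cons by (intro permutes_compose) auto
qed (simp add: expr_prod_def permutes_id)

definition swap_letters :: "nat \<Rightarrow> bool list \<Rightarrow> bool list" where
  "swap_letters t T = T[t - 1 := T ! t, t := T ! (t - 1)]"

definition word_of :: "nat \<Rightarrow> nat \<Rightarrow> nat list \<Rightarrow> bool list" where
  "word_of K N rs = foldr swap_letters rs (top_word K N)"

definition psi_product :: "nat list \<Rightarrow> 'k::field free_klr" where
  "psi_product rs = foldr (\<lambda>t p. fPsi t * p) rs 1"

lemma swap_letters_append [simp]: "swap_letters (Suc (length u)) (u @ a # b # w) = u @ b # a # w"
  by (simp add: swap_letters_def nth_append list_update_append)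

lemma word_of_Cons: "word_of K N (t # rs) = swap_letters t (word_of K N rs)"
  by (simp add: word_of_def)

lemma length_word_of [simp]: "length (word_of K N rs) = K + N"
  by (induction rs) (simp_all add: word_of_Cons swap_letters_def, simp add: word_of_def length_top_word)

lemma word_of_nth:
  "set rs \<subseteq> {1..<K + N} \<Longrightarrow> q \<in> {1..K + N} \<Longrightarrow> word_of K N rs ! (expr_prod rs q - 1) \<longleftrightarrow> K < q"
proof (induction rs)
  case Nil
  then show ?case by (auto simp: word_of_def expr_prod_def top_word_def nth_append)
next
  case (Cons t rs)
  let ?p = "expr_prod rs q"
  have p: "?p \<in> {1..K + N}"
    using permutes_in_image[OF expr_prod_permutes[of rs "K + N"], of q] Cons.prems by simp
  have t: "1 \<le> t" "t < K + N" using Cons.prems by auto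
  have "swap_letters t T ! (Transposition.transpose t (t + 1) ?p - 1) = T ! (?p - 1)" if "length T = K + N" for T
    using p t that by (auto simp: swap_letters_def Transposition.transpose_def nth_list_update)
  then show ?case using Cons by (simp add: word_of_Cons expr_prod_Cons)
qed

text \<open>A transposition adds at most one inversion. If an expression is no longer than its
  number of inversions, each factor turns some False True into True False, which is a step of
  \<open>rep\<close>.\<close>

lemma word_of_rep:
  assumes "set rs \<subseteq> {1..<K + N}"
  shows "inv_count (word_of K N rs) \<le> length rs"
    and "length rs \<le> inv_count (word_of K N rs) \<Longrightarrow> rep K N (word_of K N rs) (psi_product rs)"
proof -
  have "inv_count (word_of K N rs) \<le> length rs \<and>
    (length rs \<le> inv_count (word_of K N rs) \<longrightarrow> rep K N (word_of K N rs) (psi_product rs :: 'a free_klr))"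
    using assms
  proof (induction rs)
    case Nil
    then show ?case by (simp add: word_of_def psi_product_def inv_top_word rep_top)
  next
    case (Cons t rs)
    then obtain u a b w where u: "word_of K N rs = u @ a # b # w" "t = Suc (length u)"
      using split_at_pair[of t "word_of K N rs"] by auto
    have w: "word_of K N (t # rs) = u @ b # a # w" using u by (simp add: word_of_Cons)
    have psi: "psi_product (t # rs) = (fPsi t * psi_product rs :: 'a free_klr)" by (simp add: psi_product_def)
    show ?case
    proof (cases "\<not> a \<and> b")
      case True
      then show ?thesis using Cons u rep_step[of K N u w "psi_product rs :: 'a free_klr"] unfolding w psi
        by (auto simp: inv_count_swap)
    next
      case False
      then have "inv_count (u @ b # a # w) \<le> inv_count (u @ a # b # w)"
        by (cases a; cases b) (simp_all add: inv_count_swap)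
      then show ?thesis using Cons u unfolding w psi by auto
    qed
  qed
  then show "inv_count (word_of K N rs) \<le> length rs"
    "length rs \<le> inv_count (word_of K N rs) \<Longrightarrow> rep K N (word_of K N rs) (psi_product rs :: 'a free_klr)" by auto
qed

text \<open>These are the shortest representatives of the left cosets of the row stabiliser.\<close>

definition row_increasing :: "nat \<Rightarrow> nat \<Rightarrow> (nat \<Rightarrow> nat) \<Rightarrow> bool" where
  "row_increasing K N w \<longleftrightarrow> (\<forall>q q'. 1 \<le> q \<longrightarrow> q < q' \<longrightarrow> q' \<le> K + N \<longrightarrow> (q' \<le> K \<or> K < q) \<longrightarrow> w q < w q')"

lemma increasing_expression:
  assumes "nF T = K" "nT T = N"
  shows "\<exists>rs. set rs \<subseteq> {1..<K + N} \<and> length rs = inv_count T \<and> word_of K N rs = T \<and> row_increasing K N (expr_prod rs)"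
  using assms
proof (induction "inv_count T" arbitrary: T rule: less_induct)
  case less
  show ?case
  proof (cases "\<exists>u w. T = u @ True # False # w")
    case False
    then have "T = top_word K N" using no_descent[of T] less.prems by auto
    then show ?thesis
      by (intro exI[of _ "[]"]) (simp add: word_of_def inv_top_word expr_prod_def row_increasing_def)
  next
    case True
    then obtain u w where T: "T = u @ True # False # w" by blast
    let ?T = "u @ False # True # w" and ?t = "Suc (length u)"
    obtain rs where rs: "set rs \<subseteq> {1..<K + N}" "length rs = inv_count ?T" "word_of K N rs = ?T"
      "row_increasing K N (expr_prod rs)"
      using less.hyps[of ?T] less.prems T inv_count_swap[of u w] by auto
    have "length ?T = K + N" using nF_nT[of ?T] less.prems T by simp
    then have t: "?t \<in> {1..<K + N}" by simp
    have "row_increasing K N (expr_prod (?t # rs))" unfolding row_increasing_def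
    proof (intro allI impI)
      fix q q' assume q: "1 \<le> q" "q < q'" "q' \<le> K + N" "q' \<le> K \<or> K < q"
      let ?p = "expr_prod rs q" and ?p' = "expr_prod rs q'"
      have lt: "?p < ?p'" using rs(4) q unfolding row_increasing_def by blast
      have "\<not> (?p = ?t \<and> ?p' = ?t + 1)"
      proof
        assume p: "?p = ?t \<and> ?p' = ?t + 1"
        have "?T ! (?p - 1) \<longleftrightarrow> K < q" "?T ! (?p' - 1) \<longleftrightarrow> K < q'"
          using word_of_nth[OF rs(1), of q] word_of_nth[OF rs(1), of q'] q unfolding rs(3) by simp_all
        then show False using p q by (auto simp: nth_append)
      qed
      then show "expr_prod (?t # rs) q < expr_prod (?t # rs) q'"
        using lt by (auto simp: expr_prod_Cons Transposition.transpose_def)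
    qed
    then show ?thesis using rs t T inv_count_swap[of u w]
      by (intro exI[of _ "?t # rs"]) (auto simp: word_of_Cons)
  qed
qed

text \<open>An increasing row is the sorted list of its entries, and T prescribes the set of entries
  of each row.\<close>

lemma row_increasing_unique:
  assumes w: "w permutes {1..K + N}" "row_increasing K N w" and w': "w' permutes {1..K + N}" "row_increasing K N w'"
    and T: "\<And>q. q \<in> {1..K + N} \<Longrightarrow> T ! (w q - 1) \<longleftrightarrow> K < q" "\<And>q. q \<in> {1..K + N} \<Longrightarrow> T ! (w' q - 1) \<longleftrightarrow> K < q"
  shows "w = w'"
proof
  have rows: "map v [a..<Suc c] = sorted_list_of_set (v ` {a..c})"
    if "1 \<le> a" "c \<le> K + N" "c \<le> K \<or> K < a" "row_increasing K N v" for v a c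
  proof -
    have "sorted_wrt (<) (map v [a..<Suc c])"
      using that unfolding row_increasing_def by (auto simp: sorted_wrt_map sorted_wrt_iff_nth_less simp del: upt_Suc)
    moreover have "set (map v [a..<Suc c]) = v ` {a..c}" by (simp only: set_map set_upt atLeastLessThanSuc_atLeastAtMost)
    ultimately show ?thesis
      by (metis strict_sorted_equal strict_sorted_list_of_set set_sorted_list_of_set finite_imageI finite_atLeastAtMost)
  qed
  have im: "v ` {1..K} = {p \<in> {1..K + N}. \<not> T ! (p - 1)}" "v ` {K + 1..K + N} = {p \<in> {1..K + N}. T ! (p - 1)}"
    if v: "v permutes {1..K + N}" "\<And>q. q \<in> {1..K + N} \<Longrightarrow> T ! (v q - 1) \<longleftrightarrow> K < q" for v
  proof -
    have i: "v ` {1..K + N} = {1..K + N}" using v(1) by (rule permutes_image)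
    have f: "{p \<in> {1..K + N}. Q p} = v ` {q \<in> {1..K + N}. Q (v q)}" for Q
      by (subst i[symmetric]) blast
    have "{q \<in> {1..K + N}. \<not> T ! (v q - 1)} = {1..K}" "{q \<in> {1..K + N}. T ! (v q - 1)} = {K + 1..K + N}"
      using v(2) by auto
    then show "v ` {1..K} = {p \<in> {1..K + N}. \<not> T ! (p - 1)}" "v ` {K + 1..K + N} = {p \<in> {1..K + N}. T ! (p - 1)}"
      using f[of "\<lambda>p. \<not> T ! (p - 1)"] f[of "\<lambda>p. T ! (p - 1)"] by simp_all
  qed
  have 1: "map w [1..<Suc K] = map w' [1..<Suc K]"
    using rows[of 1 K w] rows[of 1 K w'] w w' im(1)[OF w(1) T(1)] im(1)[OF w'(1) T(2)] by simp
  have 2: "map w [K + 1..<Suc (K + N)] = map w' [K + 1..<Suc (K + N)]"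
    using rows[of "K + 1" "K + N" w] rows[of "K + 1" "K + N" w'] w w' im(2)[OF w(1) T(1)] im(2)[OF w'(1) T(2)] by simp
  fix q
  consider "q \<in> set [1..<Suc K]" | "q \<in> set [K + 1..<Suc (K + N)]" | "q \<notin> {1..K + N}" by fastforce
  then show "w q = w' q"
  proof cases
    case 1
    then show ?thesis using \<open>map w [1..<Suc K] = map w' [1..<Suc K]\<close> by (simp only: map_eq_conv)
  next
    case 2
    then show ?thesis using \<open>map w [K + 1..<Suc (K + N)] = _\<close> by (simp only: map_eq_conv)
  next
    case 3
    then show ?thesis using permutes_not_in[OF w(1)] permutes_not_in[OF w'(1)] by simp
  qed
qed

text \<open>\<open>increasing_expression\<close> provides an expression of w with
  \<open>inv_count T\<close> factors, so a reduced one has no more, and \<open>word_of_rep\<close>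
  applies. Thus the argument covers every choice of reduced expressions.\<close>

lemma reduced_rep:
  assumes T: "nF T = K" "nT T = N" and w: "w permutes {1..K + N}" "row_increasing K N w"
    and wT: "\<And>q. q \<in> {1..K + N} \<Longrightarrow> T ! (w q - 1) \<longleftrightarrow> K < q"
    and red: "reduced_expression (K + N) w rs"
  shows "rep K N T (psi_product rs)" "set rs \<subseteq> {1..<K + N}"
proof -
  show rs: "set rs \<subseteq> {1..<K + N}" using red by (simp add: reduced_expression_def expresses_def)
  have prod: "expr_prod rs = w" using red by (simp add: reduced_expression_def expresses_def)
  obtain rs' where rs': "set rs' \<subseteq> {1..<K + N}" "length rs' = inv_count T" "word_of K N rs' = T"
    "row_increasing K N (expr_prod rs')" using increasing_expression[OF T] by blast
  have "expr_prod rs' = w"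
    using word_of_nth[OF rs'(1)] wT by (intro row_increasing_unique[OF expr_prod_permutes[OF rs'(1)] rs'(4) w, of T]) (auto simp: rs'(3))
  then have len: "length rs \<le> inv_count T"
    using red rs' by (auto simp: reduced_expression_def expresses_def)
  have lT: "length T = K + N" using T nF_nT[of T] by simp
  have "word_of K N rs = T"
  proof (rule nth_equalityI)
    fix j assume "j < length (word_of K N rs)"
    then have "Suc j \<in> w ` {1..K + N}" using permutes_image[OF w(1)] by simp
    then obtain q where "q \<in> {1..K + N}" "Suc j = w q" by blast
    then show "word_of K N rs ! j = T ! j" using word_of_nth[OF rs, of q] wT[of q] prod by (metis diff_Suc_1)
  qed (simp add: lT)
  then show "rep K N T (psi_product rs)" using word_of_rep(2)[OF rs] len by simp
qed

section \<open>The filtration\<close>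

lemma (in left_module) submodule_zero: "gen_submodule R M {} = {\<zero>\<^bsub>M\<^esub>}"
proof
  have "submodule {\<zero>\<^bsub>M\<^esub>} R M" by (rule submoduleI) (auto simp: smult_zero_right)
  then show "gen_submodule R M {} \<subseteq> {\<zero>\<^bsub>M\<^esub>}" by (rule gen_submodule_least) simp
  show "{\<zero>\<^bsub>M\<^esub>} \<subseteq> gen_submodule R M {}"
    using gen_submodule_submodule[of "{}"] subgroup.one_closed[of "gen_submodule R M {}" "add_monoid M"]
    by (simp add: submodule_def)
qed

context two_tokens
begin

lemma act_left_ideal:
  fixes f :: "int list \<Rightarrow> int set \<Rightarrow> 'k::field"
  assumes "f \<in> space"
  shows "klr_left_ideal e alpha {p \<in> carrier (free_algebra (klr_gens alpha)). act p f = 0}"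
proof unfold_locales
  fix g p :: "'k free_klr" assume "g \<in> klr_relations e alpha" "p \<in> carrier (free_algebra (klr_gens alpha))"
  then show "g * p \<in> {p \<in> carrier (free_algebra (klr_gens alpha)). act p f = 0}"
    using klr_relations_closed[of e alpha] act_klr_relation[OF _ space_act[OF _ assms], of g p]
    by (auto simp: act_mult free_algebra_mult_closed subset_iff)
qed (auto simp: act_add act_mult free_algebra_zero free_algebra_add_closed free_algebra_mult_closed)

lemma act_sum_right: "act p (\<Sum>x\<in>A. f x) = (\<Sum>x\<in>A. act p (f x))"
  by (induction A rule: infinite_finite_induct) (simp_all only: sum.infinite sum.empty sum.insert act_zero_right act_add_right not_False_eq_True)

lemma opE_pt: "opE js (pt J g) = (if js = resid J then pt J g else 0)"
  by (auto simp: opE_def pt_def fun_eq_iff)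

lemma words_second: "res1 (top_word (k + 1) (r - 1)) \<in> words"
  unfolding crossing_res[symmetric] using r1 by (intro res0_words) (simp_all add: descending_def)

lemma content_first: "content e [i] [[k, r]] = alpha"
  and initial_residues_first: "initial_residues e [i] [[k, r]] = resid (res0 (top_word k r))"
  and content_second: "content e [i - 1, i] [[k + 1], [r - 1]] = alpha"
  and initial_residues_second: "initial_residues e [i - 1, i] [[k + 1], [r - 1]] = resid (res1 (top_word (k + 1) (r - 1)))"
proof -
  interpret S: two_row_shape "[[k, r]]" 1 2 k r by (rule two_row_shape_partition[OF rk])
  interpret S1: two_row_shape "[[k + 1], [r - 1]]" 2 1 "k + 1" "r - 1" by (rule two_row_shape_bipartition)
  show i0: "initial_residues e [i] [[k, r]] = resid (res0 (top_word k r))"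
    unfolding resid_def by (rule S.initial_residues_eq) (simp_all add: residue_def)
  show i1: "initial_residues e [i - 1, i] [[k + 1], [r - 1]] = resid (res1 (top_word (k + 1) (r - 1)))"
    unfolding resid_def by (rule S1.initial_residues_eq) (simp_all add: residue_def)
  have w: "res0 (top_word k r) \<in> words" by (rule res0_words) simp_all
  have "res1 (top_word (k + 1) (r - 1)) \<in> words" by (rule words_second)
  then show "content e [i] [[k, r]] = alpha" "content e [i - 1, i] [[k + 1], [r - 1]] = alpha"
    using resid_words w i0 i1 S.content_eq S1.content_eq by (simp_all add: res_seqs_def)
qed

text \<open>On the first letter y_1 acts, up to sign, by x_{i-1} or x_i. The edge i - 1 is never in
  \<open>bel1\<close>, so x_{i-1} g = 0. If the first letter is i, the tokens can no longer meet at
  i, and the constraint gives x_i g = x_{i-1} g.\<close>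

lemma leading_opY:
  assumes L: "leading T g" and T: "nF T = k + 1" "nT T = r - 1"
  shows "opY 1 (pt (res1 T) g) = 0"
proof (rule space_eqI)
  have sp: "pt (res1 T) g \<in> space" using L by (simp add: leading_def)
  then show "opY 1 (pt (res1 T) g) \<in> space" by (rule space_opY)
  fix J
  have g0: "mulx (i - 1) g = 0"
  proof -
    have "i - 1 \<in> edges" by (simp add: edges_def)
    moreover have "i - 1 \<notin> bel1 T" using bel_bounds[of "i - 1" "i - 1" i T] by auto
    ultimately show ?thesis using L unfolding leading_def by blast
  qed
  obtain b T' where T': "T = b # T'" using T by (cases T) auto
  have "mulx (if b then i else i - 1) g = 0"
  proof (cases b)
    case True
    have "c \<noteq> i" if "c \<in> touch s0 (res1 T)" for c
    proof -
      have "res1 T = i # row_res (i - 1) (i + 1) T'" using True T' by simp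
      moreover have "ok (i + 1, i - 1) (row_res (i - 1) (i + 1) T')" using ok_res1[of T] True T' by simp
      ultimately show ?thesis using that touch_bounds[of "(i + 1, i - 1)" "row_res (i - 1) (i + 1) T'" c]
        by (auto simp: collision_def)
    qed
    then have "mulx (i - 1) g = mulx i g"
      using space_touch[OF sp, of "i - 1" "res1 T"] rk r1 by auto
    then show ?thesis using g0 True by simp
  qed (use g0 in simp)
  then have M: "mulx (if b then i else i - 1) (pt (res1 T) g (res1 T)) = 0" by simp
  have e: "entry (res1 T) 1 = (if b then i else i - 1)" using T' by (simp add: entry_def)
  show "opY 1 (pt (res1 T) g) J = 0 J"
  proof (cases "J = res1 T")
    case True
    then show ?thesis unfolding opY_def True e M by simp
  qed (simp add: opY_def pt_other)
qed simp

text \<open>The first residue of a shuffle is that of i - 1 or i and so occurs in the weight: the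
  exponent is positive and y_1 already gives 0. The other sequences are removed by the
  idempotent.\<close>

lemma cyclotomic_act:
  assumes L: "leading T g" and T: "nF T = k + 1" "nT T = r - 1"
  shows "act (fY 1 ^ count (charge_weight e [i - 1, i]) (entry js 1) * fE js) (pt (res1 T) g) = 0"
proof (cases "js = resid (res1 T)")
  case True
  obtain b T' where T': "T = b # T'" using T by (cases T) auto
  have "entry js 1 \<in># charge_weight e [i - 1, i]"
    unfolding True using T' by (auto simp: entry_def charge_weight_def)
  then obtain m where "count (charge_weight e [i - 1, i]) (entry js 1) = Suc m"
    by (metis count_greater_zero_iff gr0_implies_Suc)
  then show ?thesis using leading_opY[OF assms] True
    by (simp add: act_mult opE_pt power_Suc2 del: power_Suc)
qed (simp add: act_mult opE_pt)

text \<open>The first False of T has the letter i - 1. It is preceded by at most r - 1 letters, so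
  the word of v is still in its first row there and has a letter \<ge> i.\<close>

lemma first_not_second: "nF T = k + 1 \<Longrightarrow> nT T = r - 1 \<Longrightarrow> res1 T \<noteq> res0 (top_word k r)"
proof
  assume T: "nF T = k + 1" "nT T = r - 1" and eq: "res1 T = res0 (top_word k r)"
  have "False \<in> set T" using T by (metis Suc_eq_plus1 count_list_0_iff nat.simps(3))
  then obtain p s where p: "T = p @ False # s" "False \<notin> set p" using split_list_first by metis
  then have "nF p = 0" by (simp add: count_list_0_iff)
  then have l: "length p < k" using nF_nT[of p] T p rk r1 by auto
  have "res1 T ! length p = i - 1" using p \<open>nF p = 0\<close> by (simp add: nth_append)
  moreover have "res0 (top_word k r) ! length p = i + int (length p)" using l by (simp add: row_res_top_nth)
  ultimately show False using eq by simp
qed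

end

text \<open>The parameter \<open>field_type\<close> fixes the ground field of the locale, whose type
  occurs in none of the other parameters.\<close>

locale specht_filtration = two_tokens e k r i for e k r :: nat and i :: int +
  fixes red :: "(nat \<Rightarrow> nat) \<Rightarrow> nat list" and field_type :: "'k::field itself"
  assumes red: "reduced_choice (k + r) red"
begin

abbreviation C :: "'k free_klr set" where "C \<equiv> carrier (free_algebra (klr_gens alpha))"
abbreviation M :: "('k klr_elt, 'k klr_elt set) module" where "M \<equiv> perm_module e [i] [[k, r]]"
abbreviation M' :: "('k klr_elt, 'k klr_elt set) module" where "M' \<equiv> perm_module e [i - 1, i] [[k + 1], [r - 1]]"
abbreviation Kl :: "'k klr_elt ring" where "Kl \<equiv> klr e alpha"

text \<open>Both permutation modules are handled through the free algebra: \<open>q0\<close> and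
  \<open>q1\<close> map it onto them, with kernels \<open>I0\<close> and \<open>I1\<close>.\<close>

definition I0 :: "'k free_klr set" where "I0 = lifted_relations e alpha M (perm_gen e [i] [[k, r]])"
definition I1 :: "'k free_klr set" where "I1 = lifted_relations e alpha M' (perm_gen e [i - 1, i] [[k + 1], [r - 1]])"

definition q0 :: "'k free_klr \<Rightarrow> 'k klr_elt set" where "q0 p = klr_class e alpha p \<odot>\<^bsub>M\<^esub> perm_gen e [i] [[k, r]]"
definition q1 :: "'k free_klr \<Rightarrow> 'k klr_elt set" where
  "q1 p = klr_class e alpha p \<odot>\<^bsub>M'\<^esub> perm_gen e [i - 1, i] [[k + 1], [r - 1]]"

sublocale P0: perm_setup e "[i]" "[[k, r]]" M by unfold_locales simp
sublocale P1: perm_setup e "[i - 1, i]" "[[k + 1], [r - 1]]" M' by unfold_locales simp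
interpretation S: two_row_shape "[[k, r]]" 1 2 k r by (rule two_row_shape_partition[OF rk])
interpretation S1: two_row_shape "[[k + 1], [r - 1]]" 2 1 "k + 1" "r - 1" by (rule two_row_shape_bipartition)

lemmas cont = content_first content_second

lemma relations_first: "(free_perm_relations e [i] [[k, r]] :: 'k free_klr set) =
    {fE js - (if js = resid (res0 (top_word k r)) then 1 else 0) |js. js \<in> res_seqs alpha}
      \<union> {fY t |t. t \<in> {1..k + r}} \<union> {fPsi t |t. t \<in> {1..<k + r} \<and> t \<noteq> k}"
proof -
  have "same_row [[k, r]] t (t + 1) \<longleftrightarrow> t \<noteq> k" if "t \<in> {1..<k + r}" for t
    using S.same_row_iff[of t] that by simp
  then have rows: "{fPsi t |t. t \<in> {1..<k + r} \<and> same_row [[k, r]] t (t + 1)} = ({fPsi t |t. t \<in> {1..<k + r} \<and> t \<noteq> k} :: 'k free_klr set)"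
    by blast
  show ?thesis
    unfolding free_perm_relations_def Let_def cont initial_residues_first size_alpha rows by (rule refl)
qed

lemma relations_second: "(free_perm_relations e [i - 1, i] [[k + 1], [r - 1]] :: 'k free_klr set) =
    {fE js - (if js = resid (res1 (top_word (k + 1) (r - 1))) then 1 else 0) |js. js \<in> res_seqs alpha}
      \<union> {fY t |t. t \<in> {1..k + r}} \<union> {fPsi t |t. t \<in> {1..<k + r} \<and> t \<noteq> k + 1}"
proof -
  have "same_row [[k + 1], [r - 1]] t (t + 1) \<longleftrightarrow> t \<noteq> k + 1" if "t \<in> {1..<k + r}" for t
    using S1.same_row_iff[of t] that r1 by simp
  then have rows: "{fPsi t |t. t \<in> {1..<k + r} \<and> same_row [[k + 1], [r - 1]] t (t + 1)} = ( {fPsi t |t. t \<in> {1..<k + r} \<and> t \<noteq> k + 1} :: 'k free_klr set)"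
    by blast
  show ?thesis
    unfolding free_perm_relations_def Let_def cont initial_residues_second size_alpha rows by (rule refl)
qed

lemma I0_relations: "free_perm_relations e [i] [[k, r]] \<subseteq> I0"
  using P0.relators_in_I unfolding I0_def cont .

lemma I1_relations: "free_perm_relations e [i - 1, i] [[k + 1], [r - 1]] \<subseteq> I1"
  using P1.relators_in_I unfolding I1_def cont .

lemma I0_least: "klr_left_ideal e alpha J \<Longrightarrow> free_perm_relations e [i] [[k, r]] \<subseteq> J \<Longrightarrow> I0 \<subseteq> J"
  using P0.I_least[of J] unfolding I0_def cont .

lemma I1_least: "klr_left_ideal e alpha J \<Longrightarrow> free_perm_relations e [i - 1, i] [[k + 1], [r - 1]] \<subseteq> J \<Longrightarrow> I1 \<subseteq> J"
  using P1.I_least[of J] unfolding I1_def cont .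

sublocale L0: first_row_ideal e k r i alpha I0
proof -
  interpret J: klr_left_ideal e alpha I0 using P0.I_left_ideal unfolding I0_def cont .
  have w: "map (\<lambda>c. c mod int e) (res0 (top_word k r)) \<in> res_seqs alpha"
    using resid_words[OF res0_words[of "top_word k r"]] by (simp add: resid_def)
  show "first_row_ideal e k r i alpha I0"
  proof unfold_locales
    show "size alpha = k + r" by (rule size_alpha)
    show "map (\<lambda>c. c mod int e) (res0 (top_word k r)) \<in> res_seqs alpha" by (rule w)
    show "fE (map (\<lambda>c. c mod int e) (res0 (top_word k r))) - 1 \<in> I0"
      using w by (intro subsetD[OF I0_relations]) (auto simp: relations_first resid_def)
    show "fY t \<in> I0" if "1 \<le> t" "t \<le> k + r" for t
      using that by (intro subsetD[OF I0_relations]) (auto simp: relations_first)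
    show "fPsi t \<in> I0" if "1 \<le> t" "t < k + r" "t \<noteq> k" for t
      using that by (intro subsetD[OF I0_relations]) (auto simp: relations_first)
  qed (rule r1 rk e_large)+
qed

sublocale L1: two_row e alpha I1 "k + 1" "r - 1" "i - 1" i
proof -
  interpret J: klr_left_ideal e alpha I1 using P1.I_left_ideal unfolding I1_def cont .
  have w: "map (\<lambda>c. c mod int e) (res1 (top_word (k + 1) (r - 1))) \<in> res_seqs alpha"
    using resid_words[OF words_second] by (simp add: resid_def)
  show "two_row e alpha I1 (k + 1) (r - 1) (i - 1) i"
  proof unfold_locales
    show "size alpha = k + 1 + (r - 1)" using r1 by (simp add: size_alpha)
    show "map (\<lambda>c. c mod int e) (res1 (top_word (k + 1) (r - 1))) \<in> res_seqs alpha" by (rule w)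
    show "fE (map (\<lambda>c. c mod int e) (res1 (top_word (k + 1) (r - 1)))) - 1 \<in> I1"
      unfolding resid_def[symmetric]
    proof (rule subsetD[OF I1_relations], unfold relations_second, intro UnI1 CollectI exI conjI)
      show "resid (res1 (top_word (k + 1) (r - 1))) \<in> res_seqs alpha" using w by (simp add: resid_def)
    qed simp
    show "fY t \<in> I1" if "1 \<le> t" "t \<le> k + 1 + (r - 1)" for t
    proof (rule subsetD[OF I1_relations], unfold relations_second, rule UnI1, rule UnI2, intro CollectI exI conjI)
      show "t \<in> {1..k + r}" using that r1 by simp
    qed simp
    show "fPsi t \<in> I1" if "1 \<le> t" "t < k + 1 + (r - 1)" "t \<noteq> k + 1" for t
    proof (rule subsetD[OF I1_relations], unfold relations_second, rule UnI2, intro CollectI exI conjI)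
      show "t \<in> {1..<k + r}" "t \<noteq> k + 1" using that r1 by simp_all
    qed simp
  qed
qed

lemma I0_act: "p \<in> I0 \<Longrightarrow> act p w0 = 0"
proof -
  have "I0 \<subseteq> {p \<in> C. act p w0 = 0}"
  proof (rule I0_least[OF act_left_ideal[OF w0_space]])
    have "free_perm_relations e [i] [[k, r]] \<subseteq> C" using free_perm_relations_closed[of e "[i]" "[[k, r]]"] unfolding cont .
    moreover have "act p w0 = 0" if "p \<in> free_perm_relations e [i] [[k, r]]" for p :: "'k free_klr"
      using that unfolding relations_first
      by (auto simp: act_diff w0_opY w0_opP) (auto simp: w0_def opE_pt)
    ultimately show "free_perm_relations e [i] [[k, r]] \<subseteq> {p \<in> C. act p w0 = 0}" by blast
  qed
  then show "p \<in> I0 \<Longrightarrow> act p w0 = 0" by blast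
qed

lemma garnir_rep:
  assumes b: "1 \<le> b" "b \<le> r"
  obtains m :: "'k free_klr" where "rep k r (L0.garnir_word b) m" "psi_garnir e [i] red [[k, r]] (1, 1, b) = klr_class e alpha m"
proof -
  define w where "w = tableau_perm [[k, r]] (garnir_tableau [[k, r]] (1, 1, b))"
  note gp = garnir_perm[OF rk b, folded w_def]
  have inc: "row_increasing k r w" unfolding row_increasing_def
  proof (intro allI impI)
    fix q q' assume q: "1 \<le> q" "q < q'" "q' \<le> k + r" "q' \<le> k \<or> k < q"
    show "w q < w q'"
    proof (cases "q' \<le> k")
      case True
      then show ?thesis using q gp(2)[of q] gp(2)[of q'] by simp
    next
      case False
      then have "k < q" using q by simp
      define c c' where "c = q - k" and "c' = q' - k"
      have "q = k + c" "q' = k + c'" "1 \<le> c" "c < c'" "c' \<le> r"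
        using q \<open>k < q\<close> by (simp_all add: c_def c'_def)
      then show ?thesis using gp(3)[of c] gp(3)[of c'] b rk by auto
    qed
  qed
  have cnt: "nF (L0.garnir_word b) = k" "nT (L0.garnir_word b) = r"
    using b rk by (simp_all add: L0.garnir_word_def)
  have "L0.garnir_word b ! (w q - 1) \<longleftrightarrow> k < q" if q: "q \<in> {1..k + r}" for q
  proof (cases "q \<le> k")
    case True
    then show ?thesis using q gp(2)[of q] b rk by (auto simp: L0.garnir_word_def nth_append)
  next
    case False
    define c where "c = q - k"
    have c: "q = k + c" "1 \<le> c" "c \<le> r" using q False by (simp_all add: c_def)
    show ?thesis using c gp(3)[of c] b rk by (auto simp: L0.garnir_word_def nth_append)
  qed
  moreover have "reduced_expression (k + r) w (red w)" using red gp(1) by (simp add: reduced_choice_def)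
  ultimately have R: "rep k r (L0.garnir_word b) (psi_product (red w) :: 'k free_klr)" "set (red w) \<subseteq> {1..<k + r}"
    using reduced_rep[OF cnt gp(1) inc] by blast+
  have product: "set rs \<subseteq> {1..<k + r} \<Longrightarrow> psi_product rs \<in> C \<and> foldr (\<lambda>r x. klr_psi e alpha r \<otimes>\<^bsub>Kl\<^esub> x) rs \<one>\<^bsub>Kl\<^esub> = klr_class e alpha (psi_product rs)" for rs
  proof (induction rs)
    case Nil
    then show ?case by (simp add: psi_product_def free_algebra_one klr_class_one)
  next
    case (Cons t rs)
    then have "fPsi t \<in> C" by (intro L0.fPsi_C) (auto simp: size_alpha)
    then show ?case using Cons by (simp add: psi_product_def klr_psi_def klr_mult_class free_algebra_mult_closed)
  qed
  have "psi_garnir e [i] red [[k, r]] (1, 1, b) = klr_class e alpha (psi_product (red w) :: 'k free_klr)"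
    unfolding psi_garnir_def klr_psi_perm_def w_def[symmetric] cont by (rule product[OF R(2), THEN conjunct2])
  then show ?thesis using that R(1) by blast
qed

end

context specht_filtration
begin

sublocale A: left_module Kl M using P0.M.left_module_axioms unfolding cont .
sublocale B: left_module Kl M' using P1.M.left_module_axioms unfolding cont .

lemma q0_mult: "p \<in> C \<Longrightarrow> x \<in> C \<Longrightarrow> q0 (p * x) = klr_class e alpha p \<odot>\<^bsub>M\<^esub> q0 x"
  using P0.class_mult[of p x] unfolding q0_def cont .

lemma q0_add: "p \<in> C \<Longrightarrow> x \<in> C \<Longrightarrow> q0 (p + x) = q0 p \<oplus>\<^bsub>M\<^esub> q0 x"
  using P0.class_add[of p x] unfolding q0_def cont .

lemma q0_eq_iff: "p \<in> C \<Longrightarrow> x \<in> C \<Longrightarrow> q0 p = q0 x \<longleftrightarrow> p - x \<in> I0"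
  using P0.class_eq_iff[of p x] unfolding q0_def I0_def cont .

lemma q0_closed: "p \<in> C \<Longrightarrow> q0 p \<in> carrier M"
  unfolding q0_def using P0.gen_closed by (intro A.smult_closed klr_class_closed)

lemma q0_zero: "q0 0 = \<zero>\<^bsub>M\<^esub>"
  unfolding q0_def klr_class_zero by (rule A.smult_zero_left[OF P0.gen_closed])

lemma q1_mult: "p \<in> C \<Longrightarrow> x \<in> C \<Longrightarrow> q1 (p * x) = klr_class e alpha p \<odot>\<^bsub>M'\<^esub> q1 x"
  using P1.class_mult[of p x] unfolding q1_def cont .

lemma q1_add: "p \<in> C \<Longrightarrow> x \<in> C \<Longrightarrow> q1 (p + x) = q1 p \<oplus>\<^bsub>M'\<^esub> q1 x"
  using P1.class_add[of p x] unfolding q1_def cont .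

lemma q1_eq_iff: "p \<in> C \<Longrightarrow> x \<in> C \<Longrightarrow> q1 p = q1 x \<longleftrightarrow> p - x \<in> I1"
  using P1.class_eq_iff[of p x] unfolding q1_def I1_def cont .

lemma q1_closed: "p \<in> C \<Longrightarrow> q1 p \<in> carrier M'"
  unfolding q1_def using P1.gen_closed by (intro B.smult_closed klr_class_closed)

lemma q1_zero: "q1 0 = \<zero>\<^bsub>M'\<^esub>"
  unfolding q1_def klr_class_zero by (rule B.smult_zero_left[OF P1.gen_closed])

lemma q1_surj: "x \<in> carrier M' \<Longrightarrow> \<exists>p \<in> C. x = q1 p"
  using P1.Per_surj[of x] unfolding q1_def cont .

definition U :: "'k free_klr" where
  "U = (SOME m. rep k r L0.crossing_word m \<and> psi_garnir e [i] red [[k, r]] (1, 1, 1) = klr_class e alpha m)"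

lemma U: "rep k r L0.crossing_word U" "psi_garnir e [i] red [[k, r]] (1, 1, 1) = klr_class e alpha U"
proof -
  have "L0.garnir_word 1 = L0.crossing_word" by (simp add: L0.garnir_word_def L0.crossing_word_def)
  moreover obtain m :: "'k free_klr" where "rep k r (L0.garnir_word 1) m" "psi_garnir e [i] red [[k, r]] (1, 1, 1) = klr_class e alpha m"
    using garnir_rep[OF le_refl r1] by blast
  ultimately have "\<exists>m :: 'k free_klr. rep k r L0.crossing_word m \<and> psi_garnir e [i] red [[k, r]] (1, 1, 1) = klr_class e alpha m"
    by (intro exI[of _ m]) (simp only:)
  from someI_ex[OF this] show "rep k r L0.crossing_word U" "psi_garnir e [i] red [[k, r]] (1, 1, 1) = klr_class e alpha U"
    unfolding U_def by blast+
qed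

lemma U_C: "U \<in> C" by (rule L0.rep_C[OF U(1)])

definition w1 :: "int list \<Rightarrow> int set \<Rightarrow> 'k" where "w1 = pt (res1 (top_word (k + 1) (r - 1))) (- full)"

lemma descending_0: "descending 0 = L0.crossing_word"
  by (simp add: descending_def L0.crossing_word_def)

lemma act_U: "act U w0 = w1"
proof -
  obtain m :: "'k free_klr" where m: "rep k r (descending 0) m" "act m w0 = pt (res0 (descending 0)) (- full)"
    using act_descending[of 0] by auto
  have "U - m \<in> I0" using L0.rep_unique[OF U(1) m(1)[unfolded descending_0]] by (simp add: L0.eqv_def)
  then have "act (U - m) w0 = 0" by (rule I0_act)
  then show ?thesis using m(2) by (simp only: act_diff right_minus_eq w1_def crossing_res)
qed

text \<open>This is the homomorphism from M^{\<lambda>_1} to R U v that sends generator to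
  generator. By minimality of \<open>I1\<close> only the defining relations have to be tested on
  U.\<close>

lemma second_annihilates: "p \<in> I1 \<Longrightarrow> p \<in> C \<and> p * U \<in> I0"
proof -
  let ?J = "{p \<in> C. p * U \<in> I0}"
  have "I1 \<subseteq> ?J"
  proof (rule I1_least)
    show "klr_left_ideal e alpha ?J"
    proof unfold_locales
      fix g p :: "'k free_klr" assume g: "g \<in> klr_relations e alpha" "p \<in> C"
      have "g * (p * U) \<in> I0" by (rule L0.I_rel[OF g(1) free_algebra_mult_closed[OF g(2) U_C]])
      then show "g * p \<in> ?J"
        using free_algebra_mult_closed[OF subsetD[OF klr_relations_closed g(1)] g(2)] by (simp add: mult.assoc)
    next
      fix g p :: "'k free_klr" assume "g \<in> C" "p \<in> ?J"
      then show "g * p \<in> ?J" using L0.I_mult[of g "p * U"] by (simp add: mult.assoc free_algebra_mult_closed)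
    next
      fix p q :: "'k free_klr" assume "p \<in> ?J" "q \<in> ?J"
      then show "p + q \<in> ?J" using L0.I_add[of "p * U" "q * U"] by (simp add: distrib_right free_algebra_add_closed)
    qed (auto simp: free_algebra_zero)
    show "free_perm_relations e [i - 1, i] [[k + 1], [r - 1]] \<subseteq> ?J"
    proof
      fix p :: "'k free_klr" assume p: "p \<in> free_perm_relations e [i - 1, i] [[k + 1], [r - 1]]"
      then have pC: "p \<in> C" using free_perm_relations_closed[of e "[i - 1, i]" "[[k + 1], [r - 1]]"] unfolding cont by blast
      have n: "L0.n = k + r" by (rule size_alpha)
      consider js where "js \<in> res_seqs alpha" "p = fE js - (if js = resid (res1 (top_word (k + 1) (r - 1))) then 1 else 0)"
        | t where "1 \<le> t" "t \<le> k + r" "p = fY t"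
        | t where "1 \<le> t" "t < k + r" "t \<noteq> k + 1" "p = fPsi t"
        using p unfolding relations_second Un_iff mem_Collect_eq by (elim disjE exE conjE) auto
      then have "p * U \<in> I0"
      proof cases
        case (1 js)
        have "L0.seq L0.crossing_word = resid (res1 (top_word (k + 1) (r - 1)))"
          unfolding L0.seq_def resid_def crossing_res[unfolded descending_0] by (rule refl)
        then show ?thesis using L0.fE_wt[OF L0.rep_wt[OF U(1)] 1(1)] by (simp add: 1(2) left_diff_distrib L0.eqv_def split: if_splits)
      next
        case (2 t)
        then show ?thesis using L0.crossing_relations(1)[OF U(1), of t] by (simp add: n)
      next
        case (3 t)
        then show ?thesis using L0.crossing_relations(2)[OF U(1), of t] by (simp add: n)
      qed
      then show "p \<in> ?J" using pC by simp
    qed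
  qed
  then show "p \<in> I1 \<Longrightarrow> p \<in> C \<and> p * U \<in> I0" by blast
qed

lemma annihilator_act: "p * U \<in> I0 \<Longrightarrow> act p w1 = 0"
  using I0_act[of "p * U"] by (simp only: act_mult act_U)

lemma expansion:
  assumes "p \<in> C"
  obtains a G where "L1.eqv p (\<Sum>T\<in>L1.shuffle_words. Poly_Mapping.single 0 (a T) * L1.canon T)"
    "act p w1 = (\<Sum>T\<in>L1.shuffle_words. scl (a T) (pt (res1 T) (G T)))"
    "\<forall>T\<in>L1.shuffle_words. nF T = k + 1 \<and> nT T = r - 1 \<and> leading T (G T)"
proof -
  obtain a where a: "L1.eqv p (\<Sum>T\<in>L1.shuffle_words. Poly_Mapping.single 0 (a T) * L1.canon T)"
    using L1.linear_combination[OF assms] by blast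
  have "\<forall>T\<in>L1.shuffle_words. \<exists>g. act (L1.canon T) w1 = pt (res1 T) g \<and> leading T g"
    unfolding w1_def using act_rep_leading[OF L1.canon leading_top] by blast
  then obtain G where G: "\<And>T. T \<in> L1.shuffle_words \<Longrightarrow> act (L1.canon T) w1 = pt (res1 T) (G T) \<and> leading T (G T)"
    by metis
  have "act (p - (\<Sum>T\<in>L1.shuffle_words. Poly_Mapping.single 0 (a T) * L1.canon T)) w1 = 0"
    using a second_annihilates annihilator_act unfolding L1.eqv_def by blast
  then have "act p w1 = (\<Sum>T\<in>L1.shuffle_words. act (Poly_Mapping.single 0 (a T) * L1.canon T) w1)"
    by (simp only: act_diff right_minus_eq act_sum)
  also have "\<dots> = (\<Sum>T\<in>L1.shuffle_words. scl (a T) (pt (res1 T) (G T)))"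
  proof (rule sum.cong[OF refl])
    fix T assume "T \<in> L1.shuffle_words"
    then show "act (Poly_Mapping.single 0 (a T) * L1.canon T) w1 = scl (a T) (pt (res1 T) (G T))"
      using G by (simp add: act_mult act_single zero_word_def)
  qed
  finally have e: "act p w1 = (\<Sum>T\<in>L1.shuffle_words. scl (a T) (pt (res1 T) (G T)))" .
  have "\<forall>T\<in>L1.shuffle_words. nF T = k + 1 \<and> nT T = r - 1 \<and> leading T (G T)"
    using G unfolding L1.shuffle_words_def by blast
  from that[OF a e this] show ?thesis .
qed

text \<open>The homomorphism is injective: p U v = 0 implies that p kills \<open>w1\<close>, and
  then independence makes all coefficients of p in the shuffles vanish.\<close>

lemma second_iff:
  assumes p: "p \<in> C"
  shows "p * U \<in> I0 \<longleftrightarrow> p \<in> I1" and "act p w1 = 0 \<longleftrightarrow> p \<in> I1"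
proof -
  have "p \<in> I1" if "act p w1 = 0"
  proof -
    obtain a G where e: "L1.eqv p (\<Sum>T\<in>L1.shuffle_words. Poly_Mapping.single 0 (a T) * L1.canon T)"
      "act p w1 = (\<Sum>T\<in>L1.shuffle_words. scl (a T) (pt (res1 T) (G T)))"
      "\<forall>T\<in>L1.shuffle_words. nF T = k + 1 \<and> nT T = r - 1 \<and> leading T (G T)"
      by (rule expansion[OF p]) blast
    have "a T = 0" if "T \<in> L1.shuffle_words" for T
      by (rule leading_independent[OF L1.finite_shuffle_words bspec[OF e(3)] _ that]) (use e(2) \<open>act p w1 = 0\<close> in simp_all)
    then show ?thesis using e(1) by (simp add: L1.eqv_def)
  qed
  then show "p * U \<in> I0 \<longleftrightarrow> p \<in> I1" "act p w1 = 0 \<longleftrightarrow> p \<in> I1"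
    using second_annihilates annihilator_act by blast+
qed

text \<open>By \<open>first_not_second\<close> the elements generated by \<open>w1\<close> vanish at
  the word that supports \<open>w0\<close>.\<close>

lemma one_not_multiple: "p \<in> C \<Longrightarrow> 1 - p * U \<notin> I0"
proof
  assume p: "p \<in> C" and "1 - p * U \<in> I0"
  then have "act (1 - p * U) w0 = 0" using I0_act by blast
  then have w: "w0 = act p w1" by (simp only: act_diff right_minus_eq act_one act_mult act_U)
  obtain a G where "L1.eqv p (\<Sum>T\<in>L1.shuffle_words. Poly_Mapping.single 0 (a T) * L1.canon T)" and e: "act p w1 = (\<Sum>T\<in>L1.shuffle_words. scl (a T) (pt (res1 T) (G T)))"
      "\<forall>T\<in>L1.shuffle_words. nF T = k + 1 \<and> nT T = r - 1 \<and> leading T (G T)"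
    by (rule expansion[OF p]) blast
  have "w0 (res0 (top_word k r)) edges = (\<Sum>T\<in>L1.shuffle_words. scl (a T) (pt (res1 T) (G T)) (res0 (top_word k r)) edges)"
    unfolding w e(1) sum_apply by (rule refl)
  also have "\<dots> = 0"
  proof (rule sum.neutral, rule ballI)
    fix T assume "T \<in> L1.shuffle_words"
    then have "res0 (top_word k r) \<noteq> res1 T" using first_not_second e(2) by metis
    then show "scl (a T) (pt (res1 T) (G T)) (res0 (top_word k r)) edges = 0" by (simp add: scl_def pt_other)
  qed
  finally show False by (simp add: w0_def full_def)
qed

lemma U_notin: "U \<notin> I0"
proof
  assume "U \<in> I0"
  then have "w1 = 0" using I0_act act_U by simp
  then have "w1 (res1 (top_word (k + 1) (r - 1))) edges = 0" by simp
  then show False by (simp add: w1_def full_def)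
qed

end

context specht_filtration
begin

definition M1 :: "'k klr_elt set set" where "M1 = cyclic_submodule Kl M (q0 U)"

lemma M1_submodule: "submodule M1 Kl M"
  unfolding M1_def by (rule A.cyclic_submodule_submodule[OF q0_closed[OF U_C]])

lemma M1_mem: "x \<in> M1 \<longleftrightarrow> (\<exists>p \<in> C. x = q0 (p * U))"
proof
  assume "x \<in> M1"
  then obtain a where a: "a \<in> carrier Kl" "x = a \<odot>\<^bsub>M\<^esub> q0 U" by (auto simp: M1_def cyclic_submodule_def)
  then obtain p :: "'k free_klr" where "p \<in> C" "a = klr_class e alpha p" using klr_class_surj by blast
  then show "\<exists>p \<in> C. x = q0 (p * U)" using a q0_mult[OF _ U_C] by blast
next
  assume "\<exists>p \<in> C. x = q0 (p * U)"
  then obtain p where "p \<in> C" "x = q0 (p * U)" by blast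
  then show "x \<in> M1" unfolding M1_def cyclic_submodule_def using q0_mult[OF _ U_C] klr_class_closed[of p] by blast
qed

lemma M1_proper: "M1 \<subset> carrier M"
proof -
  have "M1 \<subseteq> carrier M" using M1_mem q0_closed free_algebra_mult_closed[OF _ U_C] by auto
  moreover have "q0 1 \<notin> M1"
  proof
    assume "q0 1 \<in> M1"
    then obtain p where p: "p \<in> C" "q0 1 = q0 (p * U)" using M1_mem by blast
    have "1 - p * U \<in> I0"
      using p(2) q0_eq_iff[OF free_algebra_one free_algebra_mult_closed[OF p(1) U_C]] by blast
    then show False using one_not_multiple[OF p(1)] by blast
  qed
  ultimately show ?thesis using q0_closed[OF free_algebra_one] by blast
qed

lemma M1_nonzero: "{\<zero>\<^bsub>M\<^esub>} \<subset> M1"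
proof -
  have "q0 (0 * U) \<in> M1" using M1_mem free_algebra_zero by blast
  then have "\<zero>\<^bsub>M\<^esub> \<in> M1" by (simp add: q0_zero)
  moreover have "q0 (1 * U) \<in> M1" using M1_mem free_algebra_one by blast
  moreover have "q0 U \<noteq> q0 0" using U_notin q0_eq_iff[OF U_C free_algebra_zero] by simp
  ultimately show ?thesis by (auto simp: q0_zero)
qed

lemma generator_eq:
  "(psi_garnir e [i] red [[k, r]] (1, 1, 1) \<otimes>\<^bsub>Kl\<^esub> klr_e e alpha (initial_residues e [i] [[k, r]])) \<odot>\<^bsub>M\<^esub> perm_gen e [i] [[k, r]] = q0 U"
proof -
  let ?js = "resid (res0 (top_word k r))"
  have js: "?js \<in> res_seqs alpha" by (rule resid_words[OF res0_words]) simp_all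
  have E: "fE ?js \<in> C" using js by (rule L0.fE_C)
  have "fE ?js - 1 \<in> I0" using L0.top_e unfolding resid_def .
  then have "U * (fE ?js - 1) \<in> I0" by (rule L0.I_mult[OF U_C])
  then have "q0 (U * fE ?js) = q0 U"
    using q0_eq_iff[OF free_algebra_mult_closed[OF U_C E] U_C] by (simp add: right_diff_distrib)
  then show ?thesis
    unfolding U(2) klr_e_def initial_residues_first klr_mult_class[OF U_C E] q0_def .
qed

lemma garnir_nodes_first: "garnir_nodes [[k, r]] = {(1, 1, b) |b. 1 \<le> b \<and> b \<le> r}"
proof -
  have "a = 1" if "1 \<le> a" "a \<le> length [k, r]" "a + 1 \<le> length [k, r]" for a using that by simp
  then show ?thesis using rk by (auto simp: garnir_nodes_def diagram_def)
qed

lemma garnir_nodes_second: "garnir_nodes [[k + 1], [r - 1]] = {}"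
proof -
  have "length ([[k + 1], [r - 1]] ! (m - 1)) = 1" if "1 \<le> m" "m \<le> length [[k + 1], [r - 1]]" for m
    using that by (cases "m = 1") (auto simp: numeral_2_eq_2 le_Suc_eq)
  then show ?thesis by (auto simp: garnir_nodes_def diagram_def simp del: length_Cons) 
qed

lemma specht_kernel_first: "specht_kernel e [i] red [[k, r]] = M1"
proof -
  let ?S = "{psi_garnir e [i] red [[k, r]] A \<odot>\<^bsub>M\<^esub> perm_gen e [i] [[k, r]] |A. A \<in> garnir_nodes [[k, r]]}"
  have S: "x \<in> carrier M \<and> x \<in> M1" if x: "x \<in> ?S" for x
  proof -
    obtain b where b: "1 \<le> b" "b \<le> r" "x = psi_garnir e [i] red [[k, r]] (1, 1, b) \<odot>\<^bsub>M\<^esub> perm_gen e [i] [[k, r]]"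
      using x unfolding garnir_nodes_first by blast
    obtain m :: "'k free_klr" where m: "rep k r (L0.garnir_word b) m" "psi_garnir e [i] red [[k, r]] (1, 1, b) = klr_class e alpha m"
      using garnir_rep[OF b(1,2)] by blast
    have "m \<in> L0.multiples U" by (rule L0.garnir_multiples[OF U(1) b(1,2) m(1)])
    then obtain q where q: "m \<in> C" "q \<in> C" "L0.eqv m (q * U)" unfolding L0.multiples_def by blast
    have "x = q0 m" unfolding b(3) m(2) q0_def by (rule refl)
    also have "\<dots> = q0 (q * U)"
      using q q0_eq_iff[OF q(1) free_algebra_mult_closed[OF q(2) U_C]] unfolding L0.eqv_def by blast
    finally show ?thesis using M1_mem q(2) M1_proper by blast
  qed
  have "gen_submodule Kl M ?S = M1"
  proof
    show "gen_submodule Kl M ?S \<subseteq> M1" using S by (intro A.gen_submodule_least[OF M1_submodule]) blast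
    have sub: "submodule (gen_submodule Kl M ?S) Kl M" using S by (intro A.gen_submodule_submodule) blast
    have mem: "psi_garnir e [i] red [[k, r]] (1, 1, 1) \<odot>\<^bsub>M\<^esub> perm_gen e [i] [[k, r]] \<in> ?S"
      unfolding garnir_nodes_first using r1 by blast
    have U_mem: "q0 U \<in> gen_submodule Kl M ?S"
      using subsetD[OF A.gen_submodule_subset mem] by (simp only: q0_def U(2))
    show "M1 \<subseteq> gen_submodule Kl M ?S"
    proof
      fix x assume "x \<in> M1"
      then obtain a where "a \<in> carrier Kl" "x = a \<odot>\<^bsub>M\<^esub> q0 U" by (auto simp: M1_def cyclic_submodule_def)
      then show "x \<in> gen_submodule Kl M ?S"
        using sub U_mem unfolding submodule_def submodule_axioms_def by blast
    qed
  qed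
  then show ?thesis unfolding specht_kernel_def Let_def cont .
qed

lemma quotient_iso: "left_module_iso Kl (quot_module M M1) (specht_module e [i] red [[k, r]])"
proof -
  interpret Q: left_module Kl "quot_module M M1" by (rule A.quot_left_module[OF M1_submodule])
  show ?thesis unfolding specht_module_def specht_kernel_first by (rule Q.left_module_iso_refl)
qed

abbreviation S1 :: "('k klr_elt, 'k klr_elt set set) module" where
  "S1 \<equiv> specht_module e [i - 1, i] red [[k + 1], [r - 1]]"

lemma zero_submodule: "submodule {\<zero>\<^bsub>M'\<^esub>} Kl M'"
  unfolding B.submodule_zero[symmetric] by (rule B.gen_submodule_submodule) simp

text \<open>Without Garnir nodes the Specht module is the quotient of the permutation module by
  zero. Its elements are the singleton cosets, which is why they appear as \<open>{q1 p}\<close>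
  from here on.\<close>

lemma S1_eq: "S1 = quot_module M' {\<zero>\<^bsub>M'\<^esub>}"
  unfolding specht_module_def specht_kernel_def Let_def cont garnir_nodes_second
  by (simp only: B.submodule_zero empty_iff simp_thms empty_def[symmetric])

lemma zero_coset: "x \<in> carrier M' \<Longrightarrow> {\<zero>\<^bsub>M'\<^esub>} +>\<^bsub>M'\<^esub> x = {x}"
  unfolding a_r_coset_def' using P1.M.M.l_zero by auto

lemma S1_left_module: "left_module Kl S1"
  unfolding S1_eq by (rule B.quot_left_module[OF zero_submodule])

lemma S1_carrier: "X \<in> carrier S1 \<longleftrightarrow> (\<exists>p \<in> C. X = {q1 p})"
  unfolding S1_eq B.quot_carrier using zero_coset q1_surj q1_closed by metis

lemma S1_smult: "g \<in> C \<Longrightarrow> p \<in> C \<Longrightarrow> klr_class e alpha g \<odot>\<^bsub>S1\<^esub> {q1 p} = {q1 (g * p)}"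
  unfolding S1_eq using B.quot_smult[OF zero_submodule klr_class_closed q1_closed, of g p]
  by (simp only: zero_coset q1_closed B.smult_closed klr_class_closed q1_mult)

lemma S1_add: "p \<in> C \<Longrightarrow> q \<in> C \<Longrightarrow> {q1 p} \<oplus>\<^bsub>S1\<^esub> {q1 q} = {q1 (p + q)}"
  unfolding S1_eq using B.quot_add[OF zero_submodule q1_closed q1_closed, of p q]
  by (simp only: zero_coset q1_closed P1.M.M.a_closed q1_add)

lemma S1_zero: "\<zero>\<^bsub>S1\<^esub> = {q1 0}"
  unfolding S1_eq B.quot_zero q1_zero by (rule refl)

lemma M1_eq_iff: "p \<in> C \<Longrightarrow> q \<in> C \<Longrightarrow> q0 (p * U) = q0 (q * U) \<longleftrightarrow> q1 p = q1 q"
  using q0_eq_iff[of "p * U" "q * U"] q1_eq_iff[of p q] second_iff(1)[of "p - q"] U_C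
  by (simp add: free_algebra_mult_closed free_algebra_diff left_diff_distrib)

lemma submodule_iso: "left_module_iso Kl (M\<lparr>carrier := M1\<rparr>) S1"
proof -
  define h where "h x = {q1 (SOME p. p \<in> C \<and> x = q0 (p * U))}" for x
  have h: "h (q0 (p * U)) = {q1 p}" if p: "p \<in> C" for p
  proof -
    have "\<exists>q. q \<in> C \<and> q0 (p * U) = q0 (q * U)" using p by blast
    from someI_ex[OF this] show ?thesis unfolding h_def using M1_eq_iff[OF p] by auto
  qed
  have hom: "h \<in> left_module_hom Kl (M\<lparr>carrier := M1\<rparr>) S1"
    unfolding left_module_hom_def mem_Collect_eq
  proof (intro conjI ballI)
    show "h \<in> carrier (M\<lparr>carrier := M1\<rparr>) \<rightarrow> carrier S1"
    proof
      fix x assume "x \<in> carrier (M\<lparr>carrier := M1\<rparr>)"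
      then obtain p where "p \<in> C" "x = q0 (p * U)" using M1_mem by auto
      then show "h x \<in> carrier S1" unfolding S1_carrier using h by blast
    qed
  next
    fix x y assume "x \<in> carrier (M\<lparr>carrier := M1\<rparr>)" "y \<in> carrier (M\<lparr>carrier := M1\<rparr>)"
    then obtain p q where p: "p \<in> C" "x = q0 (p * U)" and q: "q \<in> C" "y = q0 (q * U)" using M1_mem by auto
    have "x \<oplus>\<^bsub>M\<^esub> y = q0 ((p + q) * U)"
      using p q q0_add[of "p * U" "q * U"] U_C by (simp add: distrib_right free_algebra_mult_closed)
    then show "h (x \<oplus>\<^bsub>M\<lparr>carrier := M1\<rparr>\<^esub> y) = h x \<oplus>\<^bsub>S1\<^esub> h y"
      using p q h S1_add by (simp add: free_algebra_add_closed)
  next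
    fix a x assume "a \<in> carrier Kl" "x \<in> carrier (M\<lparr>carrier := M1\<rparr>)"
    then obtain g p :: "'k free_klr" where g: "g \<in> C" "a = klr_class e alpha g" and p: "p \<in> C" "x = q0 (p * U)"
      using M1_mem klr_class_surj[of a e alpha] by auto
    have "a \<odot>\<^bsub>M\<^esub> x = q0 (g * p * U)"
      using g p q0_mult[of g "p * U"] U_C by (simp add: mult.assoc free_algebra_mult_closed)
    then show "h (a \<odot>\<^bsub>M\<lparr>carrier := M1\<rparr>\<^esub> x) = a \<odot>\<^bsub>S1\<^esub> h x"
      using g p h S1_smult by (simp add: free_algebra_mult_closed)
  qed
  have "bij_betw h M1 (carrier S1)"
  proof (rule bij_betwI')
    fix x y assume "x \<in> M1" "y \<in> M1"
    then obtain p q where "p \<in> C" "x = q0 (p * U)" "q \<in> C" "y = q0 (q * U)" unfolding M1_mem by blast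
    then show "h x = h y \<longleftrightarrow> x = y" using h M1_eq_iff by simp
  next
    fix x assume "x \<in> M1"
    then obtain p where "p \<in> C" "x = q0 (p * U)" unfolding M1_mem by blast
    then show "h x \<in> carrier S1" unfolding S1_carrier using h by blast
  next
    fix X assume "X \<in> carrier S1"
    then obtain p where p: "p \<in> C" "X = {q1 p}" unfolding S1_carrier by blast
    have "q0 (p * U) \<in> M1" unfolding M1_mem using p(1) by blast
    moreover have "X = h (q0 (p * U))" using p h by simp
    ultimately show "\<exists>x \<in> M1. X = h x" by blast
  qed
  then show ?thesis
    unfolding left_module_iso_def using hom A.submodule_left_module[OF M1_submodule] S1_left_module by auto
qed

lemma klr_y_pow: "klr_y e alpha 1 [^]\<^bsub>Kl\<^esub> (c :: nat) = klr_class e alpha (fY 1 ^ c :: 'k free_klr) \<and> (fY 1 ^ c :: 'k free_klr) \<in> C"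
proof (induction c)
  case 0
  show ?case by (simp add: nat_pow_def klr_class_one free_algebra_one)
next
  case (Suc c)
  have Y: "fY 1 \<in> C" using r1 by (intro L0.fY_C) (simp_all add: size_alpha)
  have "fY 1 ^ Suc c = fY 1 ^ c * (fY 1 :: 'k free_klr)" by (rule power_Suc2)
  then show ?case using Suc Y by (simp only: A.R.nat_pow_Suc klr_y_def klr_mult_class free_algebra_mult_closed simp_thms)
qed

text \<open>The relation is checked in the explicit module, where by \<open>second_iff\<close> an
  element vanishes on \<open>w1\<close> exactly if it lies in \<open>I1\<close>.\<close>

lemma cyclotomic: "cyclotomic_ideal e (charge_weight e [i - 1, i]) alpha \<subseteq> annihilator Kl S1"
proof -
  interpret Sp: left_module Kl S1 by (rule S1_left_module)
  let ?L = "charge_weight e [i - 1, i]"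
  have "klr_y e alpha 1 [^]\<^bsub>Kl\<^esub> count ?L (entry js 1) \<otimes>\<^bsub>Kl\<^esub> klr_e e alpha js \<in> annihilator Kl S1"
    if js: "js \<in> res_seqs alpha" for js
  proof -
    define g :: "'k free_klr" where "g = fY 1 ^ count ?L (entry js 1) * fE js"
    have E: "fE js \<in> C" by (rule L0.fE_C[OF js])
    have gC: "g \<in> C" unfolding g_def using klr_y_pow E free_algebra_mult_closed by blast
    have eq: "klr_y e alpha 1 [^]\<^bsub>Kl\<^esub> count ?L (entry js 1) \<otimes>\<^bsub>Kl\<^esub> klr_e e alpha js = klr_class e alpha g"
      unfolding g_def klr_e_def using klr_y_pow[of "count ?L (entry js 1)"] klr_mult_class[OF _ E] by simp
    have "klr_class e alpha g \<odot>\<^bsub>S1\<^esub> X = \<zero>\<^bsub>S1\<^esub>" if X: "X \<in> carrier S1" for X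
    proof -
      obtain p where p: "p \<in> C" "X = {q1 p}" using X S1_carrier by blast
      obtain a G where "L1.eqv p (\<Sum>T\<in>L1.shuffle_words. Poly_Mapping.single 0 (a T) * L1.canon T)" and e: "act p w1 = (\<Sum>T\<in>L1.shuffle_words. scl (a T) (pt (res1 T) (G T)))"
          "\<forall>T\<in>L1.shuffle_words. nF T = k + 1 \<and> nT T = r - 1 \<and> leading T (G T)"
        by (rule expansion[OF p(1)]) blast
      have "act (g * p) w1 = (\<Sum>T\<in>L1.shuffle_words. scl (a T) (act g (pt (res1 T) (G T))))"
        by (simp only: act_mult e(1) act_sum_right act_scl_right)
      also have "\<dots> = 0"
      proof (rule sum.neutral, rule ballI)
        fix T assume T: "T \<in> L1.shuffle_words"
        have "act g (pt (res1 T) (G T)) = 0" unfolding g_def using cyclotomic_act bspec[OF e(2) T] by blast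
        then show "scl (a T) (act g (pt (res1 T) (G T))) = 0" by (simp only: scl_simps)
      qed
      finally have "g * p \<in> I1" using second_iff(2)[OF free_algebra_mult_closed[OF gC p(1)]] by blast
      then have "q1 (g * p) = q1 0"
        using q1_eq_iff[OF free_algebra_mult_closed[OF gC p(1)] free_algebra_zero] by simp
      then show ?thesis unfolding p(2) S1_smult[OF gC p(1)] S1_zero by simp
    qed
    then show ?thesis unfolding eq annihilator_def using klr_class_closed[OF gC] by blast
  qed
  then show ?thesis unfolding cyclotomic_ideal_def
    by (intro A.R.genideal_minimal Sp.annihilator_ideal) blast
qed

end

theorem theorem5p9:
  fixes k r :: nat
  assumes "1 \<le> r" and "r \<le> k"
  shows
    "\<exists>e\<^sub>0. \<forall>e. e = 0 \<or> (2 < e \<and> e\<^sub>0 \<le> e) \<longrightarrow>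
       (\<forall>i \<in> vertices e. \<forall>red. reduced_choice (k + r) red \<longrightarrow>
         (let lam = [[k, r]];
              lam1 = [[k + 1], [r - 1]];
              \<alpha> = content e [i] lam;
              R = (klr e \<alpha> :: 'k::field klr_elt ring);
              M = perm_module e [i] lam;
              v = perm_gen e [i] lam;
              B1 = (1, 1, 1);
              M1 = cyclic_submodule R M
                     ((psi_garnir e [i] red lam B1 \<otimes>\<^bsub>R\<^esub> klr_e e \<alpha> (initial_residues e [i] lam)) \<odot>\<^bsub>M\<^esub> v);
              S = specht_module e [i] red lam;
              S1 = specht_module e [i - 1, i] red lam1
          in left_module R M \<and>
             submodule M1 R M \<and> M1 \<subset> carrier M \<and> {\<zero>\<^bsub>M\<^esub>} \<subset> M1 \<and>
             left_module_iso R (quot_module M M1) S \<and>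
             content e [i - 1, i] lam1 = \<alpha> \<and>
             cyclotomic_ideal e (charge_weight e [i - 1, i]) \<alpha> \<subseteq> annihilator R S1 \<and>
             left_module_iso R (M\<lparr>carrier := M1\<rparr>) S1))"
proof (intro exI[of _ "k + r + 5"] allI impI ballI, goal_cases)
  case (1 e i red)
  interpret specht_filtration e k r i red "TYPE('k)"
    by unfold_locales (use assms 1 in auto)
  show ?case
    unfolding Let_def cont generator_eq M1_def[symmetric]
    by (intro conjI refl A.left_module_axioms M1_submodule M1_proper M1_nonzero quotient_iso cyclotomic submodule_iso)
qed

end
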